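(* Let $\mathcal{C}$ be a closed algebraic subset of $\mathbb{R}^2$ of dimension $1$ and degree $2$, defined over $\mathbb{Q}$ and irreducible over $\mathbb{Q}$. Then $\lambda(\mathcal{C})=1/\gamma$, where $\gamma=(1+\sqrt5)/2$ is the golden ratio. Moreover, the set of points $\underline{\xi}\in\mathcal{C}^{\mathrm{li}}$ with $\lambda(\underline{\xi})=1/\gamma$ is countably infinite.
   Context: For $\underline{\xi}=(\xi_1,\dots,\xi_n)\in\mathbb{R}^n$, the uniform exponent of approximation $\lambda(\underline{\xi})$ is the supremum of all real $\lambda$ such that the system $|x_0|\le X$, $\max_{1\le i\le n}|x_0\xi_i-x_i|\le X^{-\lambda}$ has a nonzero solution $(x_0,\dots,x_n)\in\mathbb{Z}^{n+1}$ for every sufficiently large real $X>1$. The degree of $\mathcal{C}$ is the degree of the irreducible polynomial of $\mathbb{Q}[x_1,x_2]$ defining it. $\mathcal{C}^{\mathrm{li}}$ denotes the set of points $(\xi_1,\xi_2)\in\mathcal{C}$ such that $1,\xi_1,\xi_2$ are linearly independent over $\mathbb{Q}$, and $\lambda(\mathcal{C})=\sup\{\lambda(\underline{\xi});\ \underline{\xi}\in\mathcal{C}^{\mathrm{li}}\}$. *)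

theory Defs
  imports "HOL-Analysis.Analysis" "HOL-Computational_Algebra.Computational_Algebra"
begin

section \<open>Uniform exponent of approximation\<close>

definition approx_solvable :: "real ^ 'n \<Rightarrow> real \<Rightarrow> real \<Rightarrow> bool" where
  "approx_solvable \<xi> l X \<longleftrightarrow>
     (\<exists>(x0 :: int) (x :: int ^ 'n). (x0, x) \<noteq> (0, 0) \<and>
        \<bar>real_of_int x0\<bar> \<le> X \<and>
        Max (range (\<lambda>i. \<bar>real_of_int x0 * (\<xi> $ i) - real_of_int (x $ i)\<bar>)) \<le> X powr (- l))"

text \<open>The supremum is taken in the extended reals, since it is infinite at rational points.\<close>

definition uniform_exponent :: "real ^ 'n \<Rightarrow> ereal" where
  "uniform_exponent \<xi> = (SUP l \<in> {l. \<forall>\<^sub>F X in at_top. approx_solvable \<xi> l X}. ereal l)"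

section \<open>Algebraic subsets of the real plane\<close>

text \<open>
  A polynomial in two variables \<open>x\<^sub>1, x\<^sub>2\<close> over \<open>K\<close> is an element of \<open>K[x\<^sub>1][x\<^sub>2]\<close>: the coefficient
  of \<open>x\<^sub>1\<^sup>j x\<^sub>2\<^sup>i\<close> in \<open>f\<close> is \<open>coeff (coeff f i) j\<close>.
\<close>

definition eval2 :: "real poly poly \<Rightarrow> real ^ 2 \<Rightarrow> real" where
  "eval2 f \<xi> = poly (poly f [:\<xi> $ 2:]) (\<xi> $ 1)"

definition zero_set :: "real poly poly set \<Rightarrow> (real ^ 2) set" where
  "zero_set F = {\<xi>. \<forall>f\<in>F. eval2 f \<xi> = 0}"

definition total_degree :: "'a::zero poly poly \<Rightarrow> nat" where
  "total_degree f = Max (insert 0 {i + j | i j. coeff (coeff f i) j \<noteq> 0})"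

text \<open>Closed algebraic subsets defined over the subfield \<open>K\<close> of the reals, and irreducibility for
  the Zariski topology on the plane whose closed sets these are.\<close>

definition algebraic_over :: "real set \<Rightarrow> (real ^ 2) set \<Rightarrow> bool" where
  "algebraic_over K C \<longleftrightarrow>
     (\<exists>F. (\<forall>f\<in>F. \<forall>i j. coeff (coeff f i) j \<in> K) \<and> C = zero_set F)"

definition irreducible_over :: "real set \<Rightarrow> (real ^ 2) set \<Rightarrow> bool" where
  "irreducible_over K C \<longleftrightarrow>
     algebraic_over K C \<and> C \<noteq> {} \<and>
     (\<forall>A B. algebraic_over K A \<longrightarrow> algebraic_over K B \<longrightarrow> C = A \<union> B \<longrightarrow> C = A \<or> C = B)"

text \<open>Krull dimension for the real Zariski topology: the supremum of the lengths \<open>n\<close> of chains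
  \<open>Z\<^sub>0 \<subset> \<dots> \<subset> Z\<^sub>n\<close> of irreducible closed subsets. The empty set gets dimension 0.\<close>

definition alg_dim :: "(real ^ 2) set \<Rightarrow> enat" where
  "alg_dim C = (SUP n \<in> {n. \<exists>Z :: nat \<Rightarrow> (real ^ 2) set.
       (\<forall>i\<le>n. irreducible_over UNIV (Z i) \<and> Z i \<subseteq> C) \<and> (\<forall>i<n. Z i \<subset> Z (Suc i))}. enat n)"

text \<open>The polynomial \<open>f\<close> below is unique up to a nonzero constant factor when \<open>C\<close> has dimension 1
  (equivalently, when its zero set is infinite), so that \<open>d\<close> is then determined by \<open>C\<close>.\<close>

definition has_degree :: "(real ^ 2) set \<Rightarrow> nat \<Rightarrow> bool" where
  "has_degree C d \<longleftrightarrow>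
     (\<exists>f :: rat poly poly. irreducible f \<and> total_degree f = d \<and>
        C = zero_set {map_poly (map_poly of_rat) f})"

section \<open>Exponent of a curve\<close>

definition li_points :: "(real ^ 2) set \<Rightarrow> (real ^ 2) set" where
  "li_points C = {\<xi> \<in> C. \<forall>a b c :: rat.
     of_rat a + of_rat b * (\<xi> $ 1) + of_rat c * (\<xi> $ 2) = 0 \<longrightarrow> a = 0 \<and> b = 0 \<and> c = 0}"

definition curve_exponent :: "(real ^ 2) set \<Rightarrow> ereal" where
  "curve_exponent C = (SUP \<xi> \<in> li_points C. uniform_exponent \<xi>)"

definition golden_ratio :: real where
  "golden_ratio = (1 + sqrt 5) / 2"

end

theory Submission imports Defs begin

text \<open>
  Following D. Roy (``Rational approximation to real points on conics''), let \<open>q\<close> be the integral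
  ternary quadratic form that defines the conic, with polar form \<open>2b\<close>, and let \<open>\<Xi> = (1, \<xi>\<^sub>1, \<xi>\<^sub>2)\<close>.
  Write \<open>X\<^sub>i\<close> for the norms of the successive minimal points \<open>x\<^sub>i\<close> of \<open>\<Xi>\<close> and \<open>L\<^sub>i\<close> for their distances to
  the line \<open>\<real>\<Xi>\<close>. As \<open>q\<close> vanishes at \<open>\<Xi>\<close> but, if \<open>\<lambda> > 1/2\<close>, not at \<open>x\<^sub>i\<close> for large \<open>i\<close>, integrality gives
  \<open>1 \<lless> X\<^sub>i L\<^sub>i\<close>; combined with the nonvanishing of infinitely many determinants of three consecutive minimal points
  and with \<open>L\<^sub>i \<lless> X\<^sub>i\<^sub>+\<^sub>1\<^sup>-\<^sup>\<lambda>\<close> this yields \<open>\<lambda>\<^sup>2 + \<lambda> \<le> 1\<close>.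

  If \<open>\<lambda>\<close> is close to \<open>1/\<gamma>\<close>, the same estimates force \<open>y\<^sub>k\<^sub>+\<^sub>1\<close> to be proportional to the integral vector
  \<open>2 b(y\<^sub>k, y\<^sub>k\<^sub>-\<^sub>2) y\<^sub>k - q(y\<^sub>k) y\<^sub>k\<^sub>-\<^sub>2\<close> along a subsequence \<open>y\<^sub>k\<close> of the minimal points. So \<open>\<Xi>\<close> is determined by
  three integer vectors, whence countability. Conversely, running this recurrence from three suitable points with
  the same value of \<open>q\<close>, found with Pell's equation, produces points of exponent \<open>1/\<gamma>\<close>, and the
  images of one of them under the reflections in integer vectors are infinitely many.
\<close>

text \<open>Integrality of \<open>q\<close> gives no information at integer zeros of
  \<open>q\<close>, so these must be kept away from the minimal points. That is the purpose of
  \<open>isotropic_gap\<close>: consecutive minimal points \<open>x\<close>, \<open>x'\<close> span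
  a plane of height at most a constant times \<open>norm x' powr (1 - l)\<close>, which for
  \<open>l > 1/2\<close> is too small if \<open>x'\<close> is isotropic. The gap rests on
  \<open>q\<close> not being a product of two rational linear forms. The reflection enters because
  \<open>\<Xi>\<close> is isotropic. When the point \<open>y\<^sub>k\<^sub>+\<^sub>1\<close> is
  reflected in \<open>y\<^sub>k\<close>, the leading terms cancel; the result is an integer vector
  so short and so close to the line that its determinants with earlier points are less than 1, hence
  0, and it is a multiple of \<open>y\<^sub>k\<^sub>-\<^sub>2\<close>. Reflecting once more gives
  the recurrence. Conversely, along a sequence with constant \<open>q\<close>, the recurrence makes
  the norm of each point comparable to the product of the two preceding norms. The logarithms then
  grow like Fibonacci numbers, and the golden ratio appears.\<close>

unbundle cross3_syntax
no_notation fps_nth (infixl "$" 75)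

section \<open>Integer vectors\<close>

definition Z3 :: "(real ^ 3) set" where
  "Z3 = {x. \<forall>i. x $ i \<in> \<int>}"

lemma Z3_0 [simp]: "0 \<in> Z3"
  by (simp add: Z3_def)

lemma Z3_add: "x \<in> Z3 \<Longrightarrow> y \<in> Z3 \<Longrightarrow> x + y \<in> Z3"
  by (simp add: Z3_def)

lemma Z3_minus: "x \<in> Z3 \<Longrightarrow> - x \<in> Z3"
  by (simp add: Z3_def)

lemma Z3_diff: "x \<in> Z3 \<Longrightarrow> y \<in> Z3 \<Longrightarrow> x - y \<in> Z3"
  by (simp add: Z3_def)

lemma Z3_scale: "a \<in> \<int> \<Longrightarrow> x \<in> Z3 \<Longrightarrow> a *\<^sub>R x \<in> Z3"
  by (simp add: Z3_def)

lemma Z3_axis: "axis i 1 \<in> Z3"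
  by (simp add: Z3_def axis_def)

lemma Z3_inner: "x \<in> Z3 \<Longrightarrow> y \<in> Z3 \<Longrightarrow> x \<bullet> y \<in> \<int>"
  by (auto simp: Z3_def inner_vec_def intro!: Ints_sum)

lemma Z3_cross: "x \<in> Z3 \<Longrightarrow> y \<in> Z3 \<Longrightarrow> x \<times> y \<in> Z3"
  by (simp add: Z3_def forall_3 cross_components)

lemma Z3_vector: "a \<in> \<int> \<Longrightarrow> b \<in> \<int> \<Longrightarrow> c \<in> \<int> \<Longrightarrow> vector [a, b, c] \<in> Z3"
  by (simp add: Z3_def forall_3)

lemma Z3_norm_ge_1:
  assumes "x \<in> Z3" "x \<noteq> 0"
  shows "norm x \<ge> 1"
proof -
  obtain i where i: "x $ i \<noteq> 0"
    using assms(2) by (metis vec_eq_iff zero_index)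
  have "\<bar>x $ i\<bar> \<ge> 1"
    using assms(1) i by (intro Ints_nonzero_abs_ge1) (auto simp: Z3_def)
  then show ?thesis
    using component_le_norm_cart[of x i] by linarith
qed

lemma countable_Z3: "countable Z3"
proof -
  have "Z3 \<subseteq> (\<lambda>(a, b, c). vector [of_int a, of_int b, of_int c]) ` (UNIV :: (int \<times> int \<times> int) set)"
  proof
    fix x :: "real ^ 3" assume "x \<in> Z3"
    then obtain a b c where "x $ 1 = of_int a" "x $ 2 = of_int b" "x $ 3 = of_int c"
      unfolding Z3_def by (metis (mono_tags, lifting) Ints_cases mem_Collect_eq)
    then have "x = vector [of_int a, of_int b, of_int c]"
      by (simp add: vec_eq_iff forall_3)
    then show "x \<in> (\<lambda>(a, b, c). vector [of_int a, of_int b, of_int c]) ` (UNIV :: (int \<times> int \<times> int) set)"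
      by (intro image_eqI[of _ _ "(a, b, c)"]) auto
  qed
  then show ?thesis
    by (rule countable_subset) simp
qed

lemma finite_Z3_ball: "finite {x \<in> Z3. norm x \<le> r}"
proof -
  let ?I = "of_int ` {- \<lceil>r\<rceil> .. \<lceil>r\<rceil>} :: real set"
  have "{x \<in> Z3. norm x \<le> r} \<subseteq> (\<lambda>(a, b, c). vector [a, b, c]) ` (SIGMA a:?I. SIGMA b:?I. ?I)"
  proof
    fix x assume x: "x \<in> {x \<in> Z3. norm x \<le> r}"
    have "x $ i \<in> ?I" for i
    proof -
      obtain n where n: "x $ i = of_int n"
        using x unfolding Z3_def by (auto elim: Ints_cases)
      have "\<bar>x $ i\<bar> \<le> r"
        using x component_le_norm_cart[of x i] by auto
      then have "n \<in> {- \<lceil>r\<rceil> .. \<lceil>r\<rceil>}"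
        unfolding n by (auto simp: le_ceiling_iff) linarith+
      then show ?thesis
        using n by simp
    qed
    moreover have "x = vector [x $ 1, x $ 2, x $ 3]"
      by (simp add: vec_eq_iff forall_3)
    ultimately show "x \<in> (\<lambda>(a, b, c). vector [a, b, c]) ` (SIGMA a:?I. SIGMA b:?I. ?I)"
      by (intro image_eqI[of _ _ "(x $ 1, x $ 2, x $ 3)"]) auto
  qed
  then show ?thesis
    by (rule finite_subset) auto
qed

text \<open>Linear independence of the coordinates over the rationals, with denominators
  cleared.\<close>

definition lin_indep :: "real ^ 3 \<Rightarrow> bool" where
  "lin_indep \<Xi> \<longleftrightarrow> (\<forall>w\<in>Z3. w \<bullet> \<Xi> = 0 \<longrightarrow> w = 0)"

section \<open>Distance to a line\<close>

lemma norm_cross_le: "norm (x \<times> y) \<le> norm x * norm y"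
proof (rule power2_le_imp_le)
  show "(norm (x \<times> y))\<^sup>2 \<le> (norm x * norm y)\<^sup>2"
    using norm_cross_dot[of x y] by (smt (verit) zero_le_power2)
qed simp

text \<open>For a unit vector \<open>\<Xi>\<close>, the distance of \<open>x\<close> to its line is
  \<open>norm (x \<times> \<Xi>)\<close>. In this form it is visibly homogeneous in
  \<open>x\<close>, and its components are integer linear forms in \<open>\<Xi>\<close> when
  \<open>x\<close> is integral.\<close>

lemma line_decomp:
  fixes \<Xi> x :: "real ^ 3"
  assumes "norm \<Xi> = 1"
  obtains t d where "x = t *\<^sub>R \<Xi> + d" "\<bar>t\<bar> \<le> norm x" "norm d = norm (x \<times> \<Xi>)" "t = x \<bullet> \<Xi>" "d \<bullet> \<Xi> = 0"
proof
  have i: "\<Xi> \<bullet> \<Xi> = 1" using assms by (simp add: norm_eq_1)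
  have eq: "x - (x \<bullet> \<Xi>) *\<^sub>R \<Xi> = \<Xi> \<times> (x \<times> \<Xi>)"
    by (simp add: Lagrange i inner_commute)
  show "x = (x \<bullet> \<Xi>) *\<^sub>R \<Xi> + (x - (x \<bullet> \<Xi>) *\<^sub>R \<Xi>)" by simp
  show "\<bar>x \<bullet> \<Xi>\<bar> \<le> norm x" using Cauchy_Schwarz_ineq2[of x \<Xi>] assms by simp
  have "(norm (\<Xi> \<times> (x \<times> \<Xi>)))\<^sup>2 = (norm (x \<times> \<Xi>))\<^sup>2"
    using norm_cross_dot[of \<Xi> "x \<times> \<Xi>"] assms by (simp add: dot_cross_self)
  then show "norm (x - (x \<bullet> \<Xi>) *\<^sub>R \<Xi>) = norm (x \<times> \<Xi>)"
    unfolding eq by (simp add: power2_eq_iff_nonneg)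
  show "(x - (x \<bullet> \<Xi>) *\<^sub>R \<Xi>) \<bullet> \<Xi> = 0" by (simp add: inner_diff_left i)
qed simp

lemma cross_self_le:
  assumes "norm \<Xi> = 1"
  shows "norm (x \<times> \<Xi>) \<le> norm x"
  using norm_cross_le[of x \<Xi>] assms by simp

text \<open>The components of \<open>x\<close> and \<open>y\<close> along \<open>\<Xi>\<close> have
  cross product 0, so every remaining term carries a distance to the line.\<close>

lemma norm_cross_line_le:
  assumes "norm \<Xi> = 1"
  shows "norm (x \<times> y) \<le> 2 * norm x * norm (y \<times> \<Xi>) + norm y * norm (x \<times> \<Xi>)"
proof -
  obtain t d where x: "x = t *\<^sub>R \<Xi> + d" "\<bar>t\<bar> \<le> norm x" "norm d = norm (x \<times> \<Xi>)"
    using line_decomp[OF assms] by metis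
  obtain u e where y: "y = u *\<^sub>R \<Xi> + e" "\<bar>u\<bar> \<le> norm y" "norm e = norm (y \<times> \<Xi>)"
    using line_decomp[OF assms] by metis
  have "x \<times> y = x \<times> e + u *\<^sub>R (d \<times> \<Xi>)"
    unfolding y(1) by (subst (1) x(1)) (simp add: x(1) cross_add_left cross_add_right cross_mult_left cross_mult_right)
  then have "norm (x \<times> y) \<le> norm x * norm e + \<bar>u\<bar> * (norm d * norm \<Xi>)"
    using norm_cross_le[of x e] mult_left_mono[OF norm_cross_le[of d \<Xi>], of "\<bar>u\<bar>"]
    by (simp add: norm_triangle_le)
  also have "\<dots> \<le> norm x * norm (y \<times> \<Xi>) + norm y * norm (x \<times> \<Xi>)"
    using x y assms by (simp add: mult_right_mono)
  finally show ?thesis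
    using mult_nonneg_nonneg[OF norm_ge_zero[of x] norm_ge_zero[of "y \<times> \<Xi>"]] by linarith
qed

text \<open>A determinant vanishes as soon as two of its arguments are replaced by their components
  along \<open>\<Xi>\<close>. Hence each surviving term has at most one norm and at least two
  distances.\<close>

lemma triple_line_le:
  assumes "norm \<Xi> = 1"
  shows "\<bar>x \<bullet> (y \<times> z)\<bar> \<le> 2 * (norm x * norm (y \<times> \<Xi>) * norm (z \<times> \<Xi>)
     + norm y * norm (x \<times> \<Xi>) * norm (z \<times> \<Xi>) + norm z * norm (x \<times> \<Xi>) * norm (y \<times> \<Xi>))"
proof -
  obtain t d where x: "x = t *\<^sub>R \<Xi> + d" "\<bar>t\<bar> \<le> norm x" "norm d = norm (x \<times> \<Xi>)"
    using line_decomp[OF assms] by metis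
  obtain u e where y: "y = u *\<^sub>R \<Xi> + e" "\<bar>u\<bar> \<le> norm y" "norm e = norm (y \<times> \<Xi>)"
    using line_decomp[OF assms] by metis
  obtain v f where z: "z = v *\<^sub>R \<Xi> + f" "\<bar>v\<bar> \<le> norm z" "norm f = norm (z \<times> \<Xi>)"
    using line_decomp[OF assms] by metis
  have "\<Xi> \<bullet> (y \<times> z) = \<Xi> \<bullet> (e \<times> f)"
    unfolding y(1) z(1)
    by (simp add: cross_add_left cross_add_right cross_mult_left cross_mult_right inner_add_right dot_cross_self)
  then have eq: "x \<bullet> (y \<times> z) = t * (\<Xi> \<bullet> (e \<times> f)) + d \<bullet> (y \<times> z)"
    by (subst x(1)) (simp add: inner_add_left)
  have "\<bar>\<Xi> \<bullet> (e \<times> f)\<bar> \<le> norm e * norm f"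
    using Cauchy_Schwarz_ineq2[of \<Xi> "e \<times> f"] norm_cross_le[of e f] assms by simp
  then have 1: "\<bar>t * (\<Xi> \<bullet> (e \<times> f))\<bar> \<le> norm x * (norm e * norm f)"
    using x(2) by (simp add: abs_mult mult_mono)
  have "\<bar>d \<bullet> (y \<times> z)\<bar> \<le> norm d * norm (y \<times> z)"
    by (rule Cauchy_Schwarz_ineq2)
  also have "\<dots> \<le> norm d * (2 * norm y * norm f + norm z * norm e)"
    unfolding y(3) z(3) by (intro mult_left_mono norm_cross_line_le assms) simp
  finally have 2: "\<bar>d \<bullet> (y \<times> z)\<bar> \<le> norm d * (2 * norm y * norm f + norm z * norm e)" .
  have "\<bar>x \<bullet> (y \<times> z)\<bar> \<le> norm x * (norm e * norm f) + norm d * (2 * norm y * norm f + norm z * norm e)"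
    using 1 2 unfolding eq by linarith
  moreover have "0 \<le> norm x * (norm e * norm f)" "0 \<le> norm d * (norm z * norm e)"
    by simp_all
  ultimately show ?thesis
    unfolding x(3)[symmetric] y(3)[symmetric] z(3)[symmetric] by (simp only: algebra_simps)
qed

text \<open>The components of \<open>x \<times> \<Xi>\<close> are the values at \<open>\<Xi>\<close>
  of the integer functionals \<open>axis i 1 \<times> x\<close>.\<close>

lemma lin_indep_cross_pos:
  assumes "lin_indep \<Xi>" "x \<in> Z3" "x \<noteq> 0"
  shows "norm (x \<times> \<Xi>) > 0"
proof -
  have "x \<times> \<Xi> \<noteq> 0"
  proof
    assume 0: "x \<times> \<Xi> = 0"
    have "axis i 1 \<times> x = 0" for i
    proof -
      have "(axis i 1 \<times> x) \<bullet> \<Xi> = 0"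
        using 0 cross_triple[of "axis i 1" x \<Xi>] by simp
      then show ?thesis
        using assms(1) Z3_cross[OF Z3_axis assms(2)] by (simp add: lin_indep_def)
    qed
    then have "x \<times> axis i 1 = 0" for i
      by (metis cross_skew neg_equal_0_iff_equal)
    then show False
      using cross_basis_nonzero[OF assms(3)] by blast
  qed
  then show ?thesis by simp
qed

lemma cross_eq_0_scaleR:
  assumes "x \<times> y = 0" "x \<noteq> 0"
  obtains r where "y = r *\<^sub>R x"
proof -
  have "x \<times> (x \<times> y) = 0" using assms by simp
  then have "(x \<bullet> x) *\<^sub>R y = (x \<bullet> y) *\<^sub>R x" by (simp add: Lagrange)
  then have "y = ((x \<bullet> y) / (x \<bullet> x)) *\<^sub>R x"
    using assms(2) by (metis divide_inverse_commute inner_eq_zero_iff scaleR_left_imp_eq scaleR_one scaleR_scaleR right_inverse)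
  then show ?thesis using that by blast
qed

text \<open>Cramer's rule without the division by the determinant.\<close>

lemma triple_expand: "(x \<bullet> (y \<times> z)) *\<^sub>R v = (v \<bullet> (y \<times> z)) *\<^sub>R x + (x \<bullet> (v \<times> z)) *\<^sub>R y + (x \<bullet> (y \<times> v)) *\<^sub>R z"
  by (simp add: cross3_simps) (simp add: forall_3 algebra_simps)

lemma orth_cross_parallel:
  assumes "n \<bullet> x = 0" "n \<bullet> y = 0"
  shows "n \<times> (x \<times> y) = 0"
  using assms by (simp add: Lagrange)

text \<open>Constant factors do not affect the exponent; admitting them makes the property stable
  under scaling of \<open>\<Xi>\<close> and under integral linear maps.\<close>

definition uniform_approx :: "real ^ 3 \<Rightarrow> real \<Rightarrow> bool" where
  "uniform_approx \<Xi> l \<longleftrightarrow> (\<exists>c>0. \<forall>X\<ge>1. \<exists>x\<in>Z3. x \<noteq> 0 \<and> norm x \<le> c * X \<and>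
     norm (x \<times> \<Xi>) \<le> c * X powr (- l))"

lemma uniform_approx_mono:
  assumes "uniform_approx \<Xi> l" "l' \<le> l"
  shows "uniform_approx \<Xi> l'"
proof -
  obtain c where c: "c > 0" and
    U: "\<And>X. X \<ge> 1 \<Longrightarrow> \<exists>x\<in>Z3. x \<noteq> 0 \<and> norm x \<le> c * X \<and> norm (x \<times> \<Xi>) \<le> c * X powr (- l)"
    using assms(1) by (auto simp: uniform_approx_def)
  have "\<exists>x\<in>Z3. x \<noteq> 0 \<and> norm x \<le> c * X \<and> norm (x \<times> \<Xi>) \<le> c * X powr (- l')" if "X \<ge> 1" for X
  proof -
    have "c * X powr (- l) \<le> c * X powr (- l')"
      using c that assms(2) by (simp add: powr_mono)
    then show ?thesis using U[OF that] by (meson order_trans)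
  qed
  then show ?thesis using c by (auto simp: uniform_approx_def)
qed

text \<open>\<open>T\<close> maps the component of \<open>x\<close> along \<open>\<Xi>\<close> to
  the line of \<open>T \<Xi>\<close>, so it enlarges distances by at most a constant factor;
  injectivity keeps the approximating vectors nonzero. This transports the exponent along the
  reflections \<open>refl\<close>.\<close>

lemma uniform_approx_linear:
  fixes T :: "real ^ 3 \<Rightarrow> real ^ 3"
  assumes U: "uniform_approx \<Xi> l" and n: "norm \<Xi> = 1" and T: "linear T"
    and TZ: "\<And>x. x \<in> Z3 \<Longrightarrow> T x \<in> Z3" and Ti: "\<And>x. T x = 0 \<Longrightarrow> x = 0"
  shows "uniform_approx (T \<Xi>) l"
proof -
  obtain c where c: "c > 0" and
    U: "\<And>X. X \<ge> 1 \<Longrightarrow> \<exists>x\<in>Z3. x \<noteq> 0 \<and> norm x \<le> c * X \<and> norm (x \<times> \<Xi>) \<le> c * X powr (- l)"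
    using U by (auto simp: uniform_approx_def)
  obtain K where K: "K > 0" "\<And>x. norm (T x) \<le> norm x * K"
    using bounded_linear.pos_bounded[OF linear_conv_bounded_linear[THEN iffD1, OF T]] by blast
  let ?c = "c * K * (1 + K)"
  have "\<exists>x\<in>Z3. x \<noteq> 0 \<and> norm x \<le> ?c * X \<and> norm (x \<times> T \<Xi>) \<le> ?c * X powr (- l)" if X: "X \<ge> 1" for X
  proof -
    obtain x where x: "x \<in> Z3" "x \<noteq> 0" "norm x \<le> c * X" "norm (x \<times> \<Xi>) \<le> c * X powr (- l)"
      using U[OF X] by blast
    obtain t d where d: "x = t *\<^sub>R \<Xi> + d" "norm d = norm (x \<times> \<Xi>)"
      using line_decomp[OF n] by metis
    have "T x \<times> T \<Xi> = T d \<times> T \<Xi>"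
      unfolding d(1) using T by (simp add: linear_add linear_scale cross_add_left cross_mult_left)
    then have "norm (T x \<times> T \<Xi>) \<le> (norm d * K) * (norm \<Xi> * K)"
      using norm_cross_le[of "T d" "T \<Xi>"] K(2)[of d] K(2)[of \<Xi>]
      by (smt (verit) mult_mono norm_ge_zero)
    also have "\<dots> \<le> (c * X powr (- l) * K) * K"
      using x(4) d(2) n K(1) by (simp add: mult_right_mono)
    also have "\<dots> \<le> ?c * X powr (- l)"
      using c K(1) by (simp add: algebra_simps)
    finally have 1: "norm (T x \<times> T \<Xi>) \<le> ?c * X powr (- l)" .
    have "norm (T x) \<le> c * X * K"
      using K(2)[of x] mult_right_mono[OF x(3), of K] K(1) by linarith
    also have "\<dots> \<le> ?c * X"
      using c K(1) X by (simp add: algebra_simps)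
    finally show ?thesis using 1 TZ[OF x(1)] Ti x(2) by blast
  qed
  moreover have "?c > 0" using c K(1) by simp
  ultimately show ?thesis unfolding uniform_approx_def by blast
qed

lemma uniform_approx_scaleR:
  assumes U: "uniform_approx \<Xi> l"
  shows "uniform_approx (r *\<^sub>R \<Xi>) l"
proof -
  obtain c where c: "c > 0" and
    U: "\<And>X. X \<ge> 1 \<Longrightarrow> \<exists>x\<in>Z3. x \<noteq> 0 \<and> norm x \<le> c * X \<and> norm (x \<times> \<Xi>) \<le> c * X powr (- l)"
    using U by (auto simp: uniform_approx_def)
  let ?c = "c * (1 + \<bar>r\<bar>)"
  have "\<exists>x\<in>Z3. x \<noteq> 0 \<and> norm x \<le> ?c * X \<and> norm (x \<times> (r *\<^sub>R \<Xi>)) \<le> ?c * X powr (- l)" if X: "X \<ge> 1" for X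
  proof -
    obtain x where x: "x \<in> Z3" "x \<noteq> 0" "norm x \<le> c * X" "norm (x \<times> \<Xi>) \<le> c * X powr (- l)"
      using U[OF X] by blast
    have "norm (x \<times> (r *\<^sub>R \<Xi>)) \<le> \<bar>r\<bar> * (c * X powr (- l))"
      using x(4) by (simp add: cross_mult_right mult_left_mono)
    also have "\<dots> \<le> ?c * X powr (- l)" using c by (simp add: algebra_simps)
    finally have 1: "norm (x \<times> (r *\<^sub>R \<Xi>)) \<le> ?c * X powr (- l)" .
    have "c * X \<le> ?c * X" using c X by (simp add: algebra_simps)
    then show ?thesis using x 1 by (meson order_trans)
  qed
  moreover have "?c > 0" using c by (simp add: add_pos_nonneg)
  ultimately show ?thesis unfolding uniform_approx_def by blast
qed

lemma lin_indep_scaleR: "lin_indep \<Xi> \<Longrightarrow> r \<noteq> 0 \<Longrightarrow> lin_indep (r *\<^sub>R \<Xi>)"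
  by (auto simp: lin_indep_def)

lemma lin_indep_nonzero: "lin_indep \<Xi> \<Longrightarrow> \<Xi> \<noteq> 0"
  using Z3_axis[of 1] by (auto simp: lin_indep_def axis_eq_0_iff)

section \<open>Minimal points\<close>

text \<open>\<open>y\<close> is a shortest nonzero integer vector among those strictly closer to the
  line than \<open>x\<close>. It is a relation because a shortest vector is determined at best up to
  sign.\<close>

definition next_point :: "real ^ 3 \<Rightarrow> real ^ 3 \<Rightarrow> real ^ 3 \<Rightarrow> bool" where
  "next_point \<Xi> x y \<longleftrightarrow> y \<in> Z3 \<and> y \<noteq> 0 \<and> norm (y \<times> \<Xi>) < norm (x \<times> \<Xi>) \<and>
     (\<forall>z\<in>Z3. z \<noteq> 0 \<longrightarrow> norm z < norm y \<longrightarrow> norm (x \<times> \<Xi>) \<le> norm (z \<times> \<Xi>))"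

text \<open>Approximation with a large parameter yields some closer vector, and a ball holds only
  finitely many integer vectors.\<close>

lemma next_point_exists:
  assumes li: "lin_indep \<Xi>" and U: "uniform_approx \<Xi> l" and l: "l > 0" and x: "x \<in> Z3" "x \<noteq> 0"
  shows "\<exists>y. next_point \<Xi> x y"
proof -
  obtain c where c: "c > 0" and
    U: "\<And>X. X \<ge> 1 \<Longrightarrow> \<exists>x\<in>Z3. x \<noteq> 0 \<and> norm x \<le> c * X \<and> norm (x \<times> \<Xi>) \<le> c * X powr (- l)"
    using U by (auto simp: uniform_approx_def)
  have Lx: "norm (x \<times> \<Xi>) > 0" by (rule lin_indep_cross_pos[OF li x])
  have "((\<lambda>X. c * X powr (- l)) \<longlongrightarrow> c * 0) at_top"
    by (intro tendsto_intros tendsto_neg_powr) (use l in \<open>auto simp: filterlim_ident\<close>)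
  then have "\<forall>\<^sub>F X in at_top. c * X powr (- l) < norm (x \<times> \<Xi>)"
    using Lx by (simp add: order_tendstoD(2))
  moreover have "\<forall>\<^sub>F X in at_top. (1::real) \<le> X" by (rule eventually_ge_at_top)
  ultimately have "\<forall>\<^sub>F X in at_top. c * X powr (- l) < norm (x \<times> \<Xi>) \<and> 1 \<le> X"
    by eventually_elim simp
  then obtain X where X: "c * X powr (- l) < norm (x \<times> \<Xi>)" "1 \<le> X"
    using eventually_happens'[OF trivial_limit_at_top_linorder] by blast
  obtain y0 where y0: "y0 \<in> Z3" "y0 \<noteq> 0" "norm (y0 \<times> \<Xi>) < norm (x \<times> \<Xi>)"
    using U[OF X(2)] X(1) by force
  let ?S = "{y \<in> {y \<in> Z3. norm y \<le> norm y0}. y \<noteq> 0 \<and> norm (y \<times> \<Xi>) < norm (x \<times> \<Xi>)}"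
  have fin: "finite ?S" using finite_Z3_ball[of "norm y0"] by (rule rev_finite_subset) auto
  have ne: "?S \<noteq> {}" using y0 by auto
  define y where "y = arg_min_on norm ?S"
  have yS: "y \<in> ?S" unfolding y_def by (rule arg_min_if_finite(1)[OF fin ne])
  have ymin: "\<not> (\<exists>z\<in>?S. norm z < norm y)" unfolding y_def by (rule arg_min_if_finite(2)[OF fin ne])
  have "next_point \<Xi> x y"
    unfolding next_point_def
  proof (intro conjI ballI impI)
    fix z assume z: "z \<in> Z3" "z \<noteq> 0" "norm z < norm y"
    show "norm (x \<times> \<Xi>) \<le> norm (z \<times> \<Xi>)"
    proof (rule ccontr)
      assume "\<not> ?thesis"
      then have "z \<in> ?S" using z yS by auto
      then show False using ymin z(3) by blast
    qed
  qed (use yS in auto)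
  then show ?thesis by blast
qed

locale minimal_points =
  fixes \<Xi> :: "real ^ 3" and l :: real and x :: "nat \<Rightarrow> real ^ 3" and C :: real
  assumes nrm: "norm \<Xi> = 1" and li: "lin_indep \<Xi>" and l_pos: "l > 0" and C_pos: "C > 0"
    and Z3: "x i \<in> Z3" and nz: "x i \<noteq> 0"
    and next_pt: "next_point \<Xi> (x i) (x (Suc i))"
    and norm_Suc: "norm (x i) \<le> norm (x (Suc i))"
    and L_le: "norm (x i \<times> \<Xi>) \<le> C * norm (x (Suc i)) powr (- l)"

lemma minimal_points_exist:
  assumes n: "norm \<Xi> = 1" and li: "lin_indep \<Xi>" and U: "uniform_approx \<Xi> l" and l: "l > 0"
  obtains x C where "minimal_points \<Xi> l x C"
proof -
  \<comment> \<open>The first vector has norm 1, the least possible norm, so that the norms increase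
    from the start.\<close>
  define x where "x = rec_nat (axis 1 1) (\<lambda>_ v. SOME y. next_point \<Xi> v y)"
  have x0: "x 0 = axis 1 1" and xS: "x (Suc i) = (SOME y. next_point \<Xi> (x i) y)" for i
    by (simp_all add: x_def)
  have xZ: "x i \<in> Z3 \<and> x i \<noteq> 0" for i
  proof (induction i)
    case 0
    then show ?case by (simp add: x0 Z3_axis axis_eq_0_iff)
  next
    case (Suc i)
    have "next_point \<Xi> (x i) (x (Suc i))"
      unfolding xS using next_point_exists[OF li U l] Suc someI_ex by metis
    then show ?case by (simp add: next_point_def)
  qed
  have np: "next_point \<Xi> (x i) (x (Suc i))" for i
    unfolding xS using next_point_exists[OF li U l] xZ someI_ex by metis
  have L_dec: "norm (x (Suc i) \<times> \<Xi>) < norm (x i \<times> \<Xi>)" for i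
    using np by (simp add: next_point_def)
  have mono: "norm (x i) \<le> norm (x (Suc i))" for i
  proof (cases i)
    case 0
    then show ?thesis using Z3_norm_ge_1[of "x (Suc 0)"] xZ by (simp add: x0)
  next
    case (Suc j)
    show ?thesis
    proof (rule ccontr)
      assume "\<not> ?thesis"
      then have "norm (x j \<times> \<Xi>) \<le> norm (x (Suc (Suc j)) \<times> \<Xi>)"
        using np[of j] xZ[of "Suc (Suc j)"] Suc by (auto simp: next_point_def)
      then show False using L_dec[of j] L_dec[of "Suc j"] by simp
    qed
  qed
  obtain c where c: "c > 0" and
    U: "\<And>X. X \<ge> 1 \<Longrightarrow> \<exists>x\<in>Z3. x \<noteq> 0 \<and> norm x \<le> c * X \<and> norm (x \<times> \<Xi>) \<le> c * X powr (- l)"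
    using U by (auto simp: uniform_approx_def)
  \<comment> \<open>The approximation property is applied with parameter
    \<open>norm (x (Suc i)) / (2 * c)\<close>: it gives a vector shorter than
    \<open>x (Suc i)\<close>, hence no closer to the line than \<open>x i\<close>. If that parameter
    is below 1, the bound follows from \<open>norm (x i \<times> \<Xi>) \<le> 1\<close>.\<close>
  let ?C = "(c + 1) * (2 * c) powr l"
  have L_le: "norm (x i \<times> \<Xi>) \<le> ?C * norm (x (Suc i)) powr (- l)" for i
  proof -
    let ?X = "norm (x (Suc i))"
    have X: "?X \<ge> 1" using xZ Z3_norm_ge_1 by blast
    have eq: "(?X / (2 * c)) powr (- l) = (2 * c) powr l * ?X powr (- l)"
      using X c by (simp add: powr_divide powr_minus field_simps)
    show ?thesis
    proof (cases "?X / (2 * c) \<ge> 1")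
      case True
      obtain z where z: "z \<in> Z3" "z \<noteq> 0" "norm z \<le> c * (?X / (2 * c))"
          "norm (z \<times> \<Xi>) \<le> c * (?X / (2 * c)) powr (- l)"
        using U[OF True] by blast
      have "norm z < ?X" using z(3) c X by simp
      then have "norm (x i \<times> \<Xi>) \<le> norm (z \<times> \<Xi>)"
        using np[of i] z by (simp add: next_point_def)
      also have "\<dots> \<le> c * ((2 * c) powr l * ?X powr (- l))"
        using z(4) unfolding eq .
      also have "\<dots> \<le> ?C * ?X powr (- l)" using c by (simp add: algebra_simps)
      finally show ?thesis .
    next
      case False
      have "norm (x i \<times> \<Xi>) \<le> norm (x 0 \<times> \<Xi>)"
        by (rule lift_Suc_antimono_le[of "\<lambda>i. norm (x i \<times> \<Xi>)"]) (simp_all add: L_dec less_imp_le)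
      also have "\<dots> \<le> 1" using cross_self_le[OF n, of "x 0"] by (simp add: x0)
      also have "\<dots> \<le> (?X / (2 * c)) powr (- l)"
      proof -
        have "0 < ?X / (2 * c)" using X c by (intro divide_pos_pos) auto
        then show ?thesis using powr_mono2'[of "- l" "?X / (2 * c)" 1] False l by simp
      qed
      also have "\<dots> = (2 * c) powr l * ?X powr (- l)" by (rule eq)
      also have "\<dots> \<le> ?C * ?X powr (- l)" using c by (simp add: algebra_simps)
      finally show ?thesis .
    qed
  qed
  have "minimal_points \<Xi> l x ?C"
    using n li l c xZ np mono L_le by unfold_locales auto
  then show thesis using that by blast
qed

context minimal_points
begin

abbreviation L :: "real ^ 3 \<Rightarrow> real" where "L y \<equiv> norm (y \<times> \<Xi>)"
abbreviation N :: "nat \<Rightarrow> real" where "N i \<equiv> norm (x i)"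

lemma norm_ge_1: "N i \<ge> 1"
  using Z3 nz Z3_norm_ge_1 by blast

lemma L_dec: "i < j \<Longrightarrow> L (x j) < L (x i)"
proof (rule lift_Suc_mono_less[of "\<lambda>i. - L (x i)", simplified])
  show "L (x (Suc n)) < L (x n)" for n using next_pt by (simp add: next_point_def)
qed

lemma L_pos: "L (x i) > 0"
  by (rule lin_indep_cross_pos[OF li Z3 nz])

lemma minimal: "z \<in> Z3 \<Longrightarrow> z \<noteq> 0 \<Longrightarrow> norm z < N (Suc i) \<Longrightarrow> L (x i) \<le> L z"
  using next_pt by (simp add: next_point_def)

lemma norm_mono: "i \<le> j \<Longrightarrow> N i \<le> N j"
  using norm_Suc by (rule lift_Suc_mono_le)

text \<open>A multiple of \<open>x i\<close> that is at least as long as \<open>x i\<close> is also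
  at least as far from the line.\<close>

lemma not_parallel: "i < j \<Longrightarrow> x i \<times> x j \<noteq> 0"
proof
  assume ij: "i < j" and "x i \<times> x j = 0"
  then obtain r where r: "x j = r *\<^sub>R x i" using cross_eq_0_scaleR nz by metis
  have "N i \<le> \<bar>r\<bar> * N i" using norm_mono[of i j] ij unfolding r by simp
  then have "\<bar>r\<bar> \<ge> 1" using nz by simp
  then have "L (x i) \<le> L (x j)" unfolding r cross_mult_left
    using L_pos[of i] by (simp add: mult_le_cancel_right1)
  then show False using L_dec[OF ij] by simp
qed

lemma norm_at_top: "filterlim N at_top sequentially"
  unfolding filterlim_at_top
proof
  fix r
  have "\<exists>i. N i \<ge> r"
  proof (rule ccontr)
    assume "\<not> ?thesis"
    then have "range x \<subseteq> {v \<in> Z3. norm v \<le> r}" using Z3 by (auto simp: not_le less_imp_le)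
    then have "finite (range x)" using finite_Z3_ball finite_subset by blast
    moreover have "inj x" by (rule injI) (metis L_dec linorder_neqE_nat less_irrefl)
    ultimately show False using finite_imageD by blast
  qed
  then show "\<forall>\<^sub>F i in sequentially. r \<le> N i"
    unfolding eventually_sequentially using norm_mono order_trans by blast
qed

lemma L_tendsto_0: "(\<lambda>i. L (x i)) \<longlonglongrightarrow> 0"
proof (rule Lim_null_comparison)
  show "\<forall>\<^sub>F i in sequentially. norm (L (x i)) \<le> C * N (Suc i) powr (- l)"
    using L_le by simp
  have "filterlim (\<lambda>i. N (Suc i)) at_top sequentially"
    using norm_at_top by (rule filterlim_compose) (rule filterlim_Suc)
  then show "(\<lambda>i. C * N (Suc i) powr (- l)) \<longlonglongrightarrow> 0"
    using l_pos by (intro tendsto_mult_right_zero tendsto_neg_powr) auto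
qed

text \<open>As long as consecutive triples are dependent, the minimal points stay in one
  plane.\<close>

lemma plane_step:
  assumes w: "w \<bullet> x i = 0" "w \<bullet> x (Suc i) = 0"
    and dep: "x i \<bullet> (x (Suc i) \<times> x (Suc (Suc i))) = 0"
  shows "w \<bullet> x (Suc (Suc i)) = 0"
proof -
  have "w \<times> (x i \<times> x (Suc i)) = 0" using w by (simp add: orth_cross_parallel)
  then have "(x (Suc (Suc i)) \<bullet> (x i \<times> x (Suc i))) *\<^sub>R w
      - (x (Suc (Suc i)) \<bullet> w) *\<^sub>R (x i \<times> x (Suc i)) = 0"
    by (metis Lagrange cross_zero_right)
  moreover have "x (Suc (Suc i)) \<bullet> (x i \<times> x (Suc i)) = 0"
    using dep cross_triple[of "x i" "x (Suc i)" "x (Suc (Suc i))"] by (simp add: inner_commute)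
  ultimately show ?thesis
    using not_parallel[of i "Suc i"] by (simp add: inner_commute)
qed

text \<open>Otherwise almost all minimal points, and then \<open>\<Xi>\<close> itself, would lie in a rational plane.\<close>

lemma infinitely_many_independent: "infinite {i. x i \<bullet> (x (Suc i) \<times> x (Suc (Suc i))) \<noteq> 0}"
proof
  assume "finite {i. x i \<bullet> (x (Suc i) \<times> x (Suc (Suc i))) \<noteq> 0}"
  then obtain m where m: "\<And>i. i \<ge> m \<Longrightarrow> x i \<bullet> (x (Suc i) \<times> x (Suc (Suc i))) = 0"
    unfolding finite_nat_set_iff_bounded_le using not_less_eq_eq by (metis (mono_tags, lifting) mem_Collect_eq)
  define w where "w = x m \<times> x (Suc m)"
  have w: "w \<in> Z3" "w \<noteq> 0" using not_parallel[of m "Suc m"] Z3 by (auto simp: w_def Z3_cross)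
  have "w \<bullet> x (m + k) = 0 \<and> w \<bullet> x (Suc (m + k)) = 0" for k
  proof (induction k)
    case 0
    then show ?case by (simp add: w_def dot_cross_self)
  next
    case (Suc k)
    have "w \<bullet> x (Suc (Suc (m + k))) = 0"
      using Suc m[of "m + k"] by (intro plane_step) auto
    then show ?case using Suc by simp
  qed
  then have w0: "w \<bullet> x (m + k) = 0" for k by blast
  \<comment> \<open>Since \<open>w\<close> annihilates \<open>x i = t *\<^sub>R \<Xi> + d\<close>,
    the number \<open>t * (w \<bullet> \<Xi>)\<close> equals \<open>- (w \<bullet> d)\<close>, where
    \<open>d\<close> tends to 0 while \<open>t\<close> does not.\<close>
  have le: "\<bar>w \<bullet> \<Xi>\<bar> * (N i - L (x i)) \<le> norm w * L (x i)" if "i \<ge> m" for i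
  proof -
    obtain t d where d: "x i = t *\<^sub>R \<Xi> + d" "norm d = L (x i)"
      using line_decomp[OF nrm, of "x i"] by metis
    have "N i \<le> \<bar>t\<bar> + norm d" unfolding d(1) using norm_triangle_ineq[of "t *\<^sub>R \<Xi>" d] nrm by simp
    then have "\<bar>w \<bullet> \<Xi>\<bar> * (N i - L (x i)) \<le> \<bar>w \<bullet> \<Xi>\<bar> * \<bar>t\<bar>"
      using d by (intro mult_left_mono) auto
    also have "\<dots> = \<bar>w \<bullet> d\<bar>"
      using w0[of "i - m"] that d by (simp add: inner_add_right abs_mult[symmetric] mult.commute)
    also have "\<dots> \<le> norm w * L (x i)" using Cauchy_Schwarz_ineq2[of w d] d by simp
    finally show ?thesis .
  qed
  have "\<bar>w \<bullet> \<Xi>\<bar> \<le> 0"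
  proof (rule tendsto_le[OF sequentially_bot])
    show "(\<lambda>i. norm w * L (x i)) \<longlonglongrightarrow> 0"
      using tendsto_mult_right_zero[OF L_tendsto_0] by simp
    have "(\<lambda>i. \<bar>w \<bullet> \<Xi>\<bar> * (1 - L (x i))) \<longlonglongrightarrow> \<bar>w \<bullet> \<Xi>\<bar> * (1 - 0)"
      by (intro tendsto_mult tendsto_diff tendsto_const L_tendsto_0)
    then show "(\<lambda>i. \<bar>w \<bullet> \<Xi>\<bar> * (1 - L (x i))) \<longlonglongrightarrow> \<bar>w \<bullet> \<Xi>\<bar>"
      by simp
    show "\<forall>\<^sub>F i in sequentially. \<bar>w \<bullet> \<Xi>\<bar> * (1 - L (x i)) \<le> norm w * L (x i)"
      using eventually_ge_at_top[of m]
    proof eventually_elim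
      case (elim i)
      have "\<bar>w \<bullet> \<Xi>\<bar> * (1 - L (x i)) \<le> \<bar>w \<bullet> \<Xi>\<bar> * (N i - L (x i))"
        using norm_ge_1[of i] by (intro mult_left_mono) auto
      then show ?case using le[OF elim] by linarith
    qed
  qed
  then show False using li w by (auto simp: lin_indep_def)
qed

end

section \<open>Integral quadratic forms\<close>

locale int_form =
  fixes b :: "real ^ 3 \<Rightarrow> real ^ 3 \<Rightarrow> real"
  assumes bb: "bounded_bilinear b" and sym: "b x y = b y x"
    and int: "x \<in> Z3 \<Longrightarrow> y \<in> Z3 \<Longrightarrow> b x y \<in> \<int>"
begin

sublocale b: bounded_bilinear b by (rule bb)

lemmas b_simps = b.add_left b.add_right b.diff_left b.diff_right b.scaleR_left b.scaleR_right
  b.minus_left b.minus_right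

lemma b_bound: "\<exists>K>0. \<forall>x y. \<bar>b x y\<bar> \<le> K * norm x * norm y"
proof -
  obtain K where "K > 0" "\<And>x y. norm (b x y) \<le> norm x * norm y * K"
    using b.pos_bounded by blast
  then show ?thesis by (intro exI[of _ K]) (simp add: mult_ac)
qed

text \<open>Roy's operation: up to the factor \<open>- b x x\<close> it is the reflection of \<open>y\<close> in the plane
  orthogonal to \<open>x\<close>.\<close>

definition refl :: "real ^ 3 \<Rightarrow> real ^ 3 \<Rightarrow> real ^ 3" where
  "refl x y = (2 * b x y) *\<^sub>R x - b x x *\<^sub>R y"

lemma linear_refl: "linear (refl x)"
  by (rule linearI) (simp_all add: refl_def b_simps algebra_simps)

lemma refl_Z3: "x \<in> Z3 \<Longrightarrow> y \<in> Z3 \<Longrightarrow> refl x y \<in> Z3"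
  unfolding refl_def by (intro Z3_diff Z3_scale Ints_mult int) simp_all

lemma refl_refl: "refl x (refl x y) = (b x x)\<^sup>2 *\<^sub>R y"
  by (simp add: refl_def b_simps algebra_simps power2_eq_square)

lemma b_refl: "b (refl x y) (refl x y) = (b x x)\<^sup>2 * b y y"
  by (simp add: refl_def b_simps sym[of y x] algebra_simps power2_eq_square)

lemma refl_scale: "refl (r *\<^sub>R x) (s *\<^sub>R y) = (r\<^sup>2 * s) *\<^sub>R refl x y"
  by (simp add: refl_def b_simps algebra_simps power2_eq_square)

text \<open>An isotropic integer vector generates, together with any other integer vector, a plane of
  large height.\<close>

definition isotropic_gap :: bool where
  "isotropic_gap \<longleftrightarrow> (\<exists>c>0. \<forall>x\<in>Z3. \<forall>y\<in>Z3. b x x = 0 \<longrightarrow> x \<times> y \<noteq> 0 \<longrightarrow> c * norm x \<le> (norm (x \<times> y))\<^sup>2)"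

text \<open>Both vectors are split into a component along \<open>\<Xi>\<close> and an orthogonal
  one. As \<open>b \<Xi> \<Xi> = 0\<close>, the terms quadratic in the component along
  \<open>\<Xi>\<close> drop out.\<close>

lemma
  assumes n: "norm \<Xi> = 1" and z: "b \<Xi> \<Xi> = 0"
    and K: "K > 0" "\<And>x y. \<bar>b x y\<bar> \<le> K * norm x * norm y"
  shows q_line_le: "\<bar>b x x\<bar> \<le> 3 * K * (norm x * norm (x \<times> \<Xi>))"
    and refl_line_le: "norm (refl x y \<times> \<Xi>) \<le>
      7 * K * (norm x * norm (x \<times> \<Xi>) * norm (y \<times> \<Xi>) + norm y * (norm (x \<times> \<Xi>))\<^sup>2)"
    and refl_norm_le: "norm (refl x y) \<le>
      11 * K * ((norm x)\<^sup>2 * norm (y \<times> \<Xi>) + norm y * (norm (x \<times> \<Xi>))\<^sup>2)"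
proof -
  let ?X = "norm x" and ?Y = "norm y" and ?p = "norm (x \<times> \<Xi>)" and ?r = "norm (y \<times> \<Xi>)"
  obtain t d where x: "x = t *\<^sub>R \<Xi> + d" "\<bar>t\<bar> \<le> ?X" "norm d = ?p" "d \<bullet> \<Xi> = 0"
    using line_decomp[OF n] by metis
  obtain u e where y: "y = u *\<^sub>R \<Xi> + e" "\<bar>u\<bar> \<le> ?Y" "norm e = ?r" "e \<bullet> \<Xi> = 0"
    using line_decomp[OF n] by metis
  have px: "?p \<le> ?X" and ry: "?r \<le> ?Y" by (rule cross_self_le[OF n])+
  have bd: "\<bar>b \<Xi> d\<bar> \<le> K * ?p" "\<bar>b \<Xi> e\<bar> \<le> K * ?r" "\<bar>b d e\<bar> \<le> K * (?p * ?r)" "\<bar>b d d\<bar> \<le> K * ?p\<^sup>2"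
    using K(2)[of \<Xi> d] K(2)[of \<Xi> e] K(2)[of d e] K(2)[of d d] n x y
    by (simp_all add: power2_eq_square mult.assoc)
  have qx: "b x x = 2 * (t * b \<Xi> d) + b d d"
    unfolding x(1) by (simp add: b_simps z sym[of d \<Xi>])
  have bxy: "b x y = t * b \<Xi> e + u * b \<Xi> d + b d e"
    unfolding x(1) y(1) by (simp add: b_simps z sym[of d \<Xi>])
  have 1: "\<bar>t * b \<Xi> d\<bar> \<le> ?X * (K * ?p)" "\<bar>t * b \<Xi> e\<bar> \<le> ?X * (K * ?r)" "\<bar>u * b \<Xi> d\<bar> \<le> ?Y * (K * ?p)"
    unfolding abs_mult using x y bd by (auto intro!: mult_mono)
  have pp: "K * ?p\<^sup>2 \<le> K * (?X * ?p)" "K * (?p * ?r) \<le> K * (?X * ?r)"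
    using px K(1) by (simp_all add: power2_eq_square mult_right_mono)
  show q: "\<bar>b x x\<bar> \<le> 3 * K * (?X * ?p)"
    using 1(1) bd(4) pp(1) unfolding qx by (simp add: algebra_simps)
  have bxy_le: "\<bar>b x y\<bar> \<le> 2 * K * (?X * ?r) + K * (?Y * ?p)"
    using 1(2,3) bd(3) pp(2) unfolding bxy by (simp add: algebra_simps)
  have "refl x y \<times> \<Xi> = (2 * b x y) *\<^sub>R (x \<times> \<Xi>) - b x x *\<^sub>R (y \<times> \<Xi>)"
    by (simp add: refl_def Cross3.left_diff_distrib cross_mult_left)
  then have "norm (refl x y \<times> \<Xi>) \<le> \<bar>2 * b x y\<bar> * ?p + \<bar>b x x\<bar> * ?r"
    by (metis norm_triangle_ineq4 norm_scaleR)
  also have "\<dots> \<le> (2 * (2 * K * (?X * ?r) + K * (?Y * ?p))) * ?p + (3 * K * (?X * ?p)) * ?r"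
    using bxy_le q by (intro add_mono mult_right_mono) auto
  also have "\<dots> = 7 * K * (?X * ?p * ?r) + 2 * (K * (?Y * ?p\<^sup>2))"
    by (simp add: algebra_simps power2_eq_square)
  finally have 2: "norm (refl x y \<times> \<Xi>) \<le> 7 * K * (?X * ?p * ?r) + 2 * (K * (?Y * ?p\<^sup>2))" .
  moreover have nn: "0 \<le> K * (?Y * ?p\<^sup>2)" using K(1) by simp
  ultimately show "norm (refl x y \<times> \<Xi>) \<le> 7 * K * (?X * ?p * ?r + ?Y * ?p\<^sup>2)"
    unfolding distrib_left by linarith
  obtain v f where v: "refl x y = v *\<^sub>R \<Xi> + f" "norm f = norm (refl x y \<times> \<Xi>)" "v = refl x y \<bullet> \<Xi>"
    using line_decomp[OF n] by metis
  have "\<Xi> \<bullet> \<Xi> = 1" using n by (simp add: norm_eq_1)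
  then have xt: "x \<bullet> \<Xi> = t" and yu: "y \<bullet> \<Xi> = u"
    by (subst x(1) y(1), simp add: inner_add_left x y)+
  have "v = 2 * b x y * t - b x x * u"
    unfolding v(3) refl_def by (simp add: inner_diff_left xt yu)
  \<comment> \<open>The two terms \<open>2 * t * u * b \<Xi> d\<close> cancel. This is why the
    reflection of \<open>y\<close> in \<open>x\<close> can be much shorter than \<open>y\<close>
    times the size of \<open>b x x\<close>.\<close>
  also have "\<dots> = 2 * (t * (t * b \<Xi> e)) + 2 * (t * b d e) - u * b d d"
    unfolding bxy qx by (simp add: algebra_simps)
  finally have veq: "v = 2 * (t * (t * b \<Xi> e)) + 2 * (t * b d e) - u * b d d" .
  have 3: "\<bar>t * (t * b \<Xi> e)\<bar> \<le> ?X * (?X * (K * ?r))" "\<bar>t * b d e\<bar> \<le> ?X * (K * (?p * ?r))"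
     "\<bar>u * b d d\<bar> \<le> ?Y * (K * ?p\<^sup>2)"
    unfolding abs_mult using x y bd by (auto intro!: mult_mono)
  have 4: "?X * (K * (?p * ?r)) \<le> ?X * (?X * (K * ?r))"
  proof -
    have "?p * (K * ?r) \<le> ?X * (K * ?r)" using px K(1) by (intro mult_right_mono) auto
    then show ?thesis by (intro mult_left_mono) (auto simp: algebra_simps)
  qed
  have "\<bar>v\<bar> \<le> 4 * (?X * (?X * (K * ?r))) + ?Y * (K * ?p\<^sup>2)"
    unfolding veq using 3 4 by linarith
  moreover have "norm (refl x y) \<le> \<bar>v\<bar> + norm (refl x y \<times> \<Xi>)"
    using norm_triangle_ineq[of "v *\<^sub>R \<Xi>" f] n v(1,2) by simp
  ultimately have "norm (refl x y) \<le> 11 * (?X * (?X * (K * ?r))) + 3 * (?Y * (K * ?p\<^sup>2))"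
    using 2 4 by (simp add: algebra_simps)
  moreover have "11 * K * (?X\<^sup>2 * ?r + ?Y * ?p\<^sup>2) = 11 * (?X * (?X * (K * ?r))) + 11 * (K * (?Y * ?p\<^sup>2))"
    by (simp add: algebra_simps power2_eq_square)
  ultimately show "norm (refl x y) \<le> 11 * K * (?X\<^sup>2 * ?r + ?Y * ?p\<^sup>2)"
    using nn by (simp add: mult_ac)
qed

end

section \<open>The upper bound\<close>

locale conic_minimal = int_form b + minimal_points \<Xi> l x C
  for b :: "real ^ 3 \<Rightarrow> real ^ 3 \<Rightarrow> real" and \<Xi> l x C +
  assumes zero: "b \<Xi> \<Xi> = 0" and gap: isotropic_gap and l_gt: "l > 1 / 2"
begin

lemma eventually_powr_gt: "a > 0 \<Longrightarrow> \<forall>\<^sub>F i in sequentially. B < N i powr a"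
proof -
  assume "a > 0"
  then have "filterlim (\<lambda>t::real. t powr a) at_top at_top"
    by real_asymp
  then have "filterlim (\<lambda>i. N i powr a) at_top sequentially"
    using norm_at_top by (rule filterlim_compose)
  then show ?thesis by (simp add: filterlim_at_top_dense)
qed

lemma cross_le: "i < j \<Longrightarrow> norm (x i \<times> x j) \<le> 3 * (N j * L (x i))"
proof -
  assume ij: "i < j"
  have "N i * L (x j) \<le> N j * L (x i)"
    using L_dec[OF ij] norm_mono[of i j] ij by (intro mult_mono) auto
  then show ?thesis using norm_cross_line_le[OF nrm, of "x i" "x j"] by linarith
qed

text \<open>If \<open>x i\<close> were isotropic, the gap for \<open>x i\<close> and its predecessor
  would give \<open>c * N i \<le> 9 * C\<^sup>2 * N i powr (2 - 2 * l)\<close>. For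
  \<open>l > 1/2\<close> this bounds \<open>N i\<close>.\<close>

lemma eventually_nonisotropic: "\<forall>\<^sub>F i in sequentially. b (x i) (x i) \<noteq> 0"
proof -
  obtain c where c: "c > 0" "\<And>x y. x \<in> Z3 \<Longrightarrow> y \<in> Z3 \<Longrightarrow> b x x = 0 \<Longrightarrow> x \<times> y \<noteq> 0 \<Longrightarrow> c * norm x \<le> (norm (x \<times> y))\<^sup>2"
    using gap unfolding isotropic_gap_def by metis
  have "\<forall>\<^sub>F i in sequentially. 9 * C\<^sup>2 / c < N i powr (2 * l - 1)"
    using l_gt by (intro eventually_powr_gt) simp
  moreover have "\<forall>\<^sub>F i in sequentially. 1 \<le> i" by (rule eventually_ge_at_top)
  ultimately show ?thesis
  proof eventually_elim
    case (elim i)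
    then obtain j where i: "i = Suc j" by (cases i) auto
    show ?case
    proof
      assume 0: "b (x i) (x i) = 0"
      have "x i \<times> x j \<noteq> 0" using not_parallel[of j i] i by (metis cross_skew lessI neg_equal_0_iff_equal)
      then have "c * N i \<le> (norm (x i \<times> x j))\<^sup>2" using c(2) 0 Z3 by blast
      also have "norm (x i \<times> x j) = norm (x j \<times> x i)" by (metis cross_skew norm_minus_cancel)
      also have "\<dots>\<^sup>2 \<le> (3 * (N i * (C * N i powr (- l))))\<^sup>2"
      proof (rule power_mono)
        have "N i * L (x j) \<le> N i * (C * N i powr (- l))"
          using L_le[of j] i by (intro mult_left_mono) auto
        then show "norm (x j \<times> x i) \<le> 3 * (N i * (C * N i powr (- l)))"
          using cross_le[of j i] i by linarith
      qed simp
      also have "\<dots> = 9 * C\<^sup>2 * (N i * N i powr (1 - 2 * l))"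
      proof -
        have "(N i powr (- l))\<^sup>2 * N i = N i powr (1 - 2 * l)"
          using norm_ge_1[of i] nz[of i] by (simp add: power2_eq_square powr_add[symmetric] powr_mult_base algebra_simps)
        then show ?thesis by (simp add: power_mult_distrib algebra_simps power2_eq_square)
      qed
      finally have "N i * c \<le> N i * (9 * C\<^sup>2 * N i powr (1 - 2 * l))" by (simp only: mult_ac)
      then have "c \<le> 9 * C\<^sup>2 * N i powr (1 - 2 * l)"
        by (rule mult_left_le_imp_le) (use nz in simp)
      moreover have "N i powr (1 - 2 * l) = 1 / N i powr (2 * l - 1)"
        using powr_minus_divide[of "N i" "2 * l - 1"] by simp
      moreover have "N i powr (2 * l - 1) > 0" using nz by simp
      ultimately have "c * N i powr (2 * l - 1) \<le> 9 * C\<^sup>2" by (simp add: field_simps)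
      then show False using elim(1) c(1) by (simp add: field_simps)
    qed
  qed
qed

definition n :: "nat \<Rightarrow> real" where "n i = ln (N i)"
definition m :: "nat \<Rightarrow> real" where "m i = ln (L (x i))"

lemma n_nonneg: "n i \<ge> 0"
  unfolding n_def using norm_ge_1[of i] by simp

lemma n_mono: "i \<le> j \<Longrightarrow> n i \<le> n j"
  unfolding n_def using norm_ge_1[of i] norm_mono[of i j] by (intro ln_mono) auto

lemma n_at_top: "filterlim n at_top sequentially"
  unfolding n_def[abs_def] using filterlim_compose[OF ln_at_top norm_at_top] .

lemma exp_n: "exp (n i) = N i" and exp_m: "exp (m i) = L (x i)"
  unfolding n_def m_def using nz L_pos by simp_all

abbreviation indep :: "nat \<Rightarrow> bool" where
  "indep i \<equiv> x i \<bullet> (x (Suc i) \<times> x (Suc (Suc i))) \<noteq> 0"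

text \<open>With one common additive constant: uniform approximation, integrality of the nonzero
  number \<open>b (x i) (x i)\<close>, and integrality of a nonzero determinant, in which the
  longest vector with the two distances of the others dominates.\<close>

lemma log_bounds:
  obtains D where "D \<ge> 0" "\<And>i. m i \<le> D - l * n (Suc i)" "\<forall>\<^sub>F i in sequentially. 0 \<le> D + n i + m i"
    "\<And>i. indep i \<Longrightarrow> 0 \<le> D + n (Suc (Suc i)) + m i + m (Suc i)"
proof -
  obtain K where K: "K > 0" "\<And>x y. \<bar>b x y\<bar> \<le> K * norm x * norm y"
    using b_bound by blast
  define D where "D = \<bar>ln C\<bar> + \<bar>ln (3 * K)\<bar> + ln 6"
  have D: "D \<ge> 0" "ln C \<le> D" "ln (3 * K) \<le> D" "ln 6 \<le> D"
    unfolding D_def by (auto simp: add_increasing add_increasing2)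
  show thesis
  proof
    show "D \<ge> 0" by fact
    fix i
    have "m i \<le> ln (C * N (Suc i) powr (- l))"
      unfolding m_def using L_le L_pos by (smt (verit) ln_le_cancel_iff)
    also have "\<dots> = ln C - l * n (Suc i)"
      using C_pos nz by (simp add: ln_mult ln_powr n_def)
    finally show "m i \<le> D - l * n (Suc i)" using D by linarith
  next
    show "\<forall>\<^sub>F i in sequentially. 0 \<le> D + n i + m i"
      using eventually_nonisotropic
    proof eventually_elim
      case (elim i)
      have "1 \<le> \<bar>b (x i) (x i)\<bar>"
        using int[OF Z3 Z3] elim by (intro Ints_nonzero_abs_ge1) auto
      also have "\<dots> \<le> 3 * K * (N i * L (x i))" by (rule q_line_le[OF nrm zero K])
      finally have "0 \<le> ln (3 * K * (N i * L (x i)))" by simp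
      also have "\<dots> = ln (3 * K) + n i + m i"
        using K(1) nz L_pos[of i] by (simp add: ln_mult n_def m_def)
      finally show ?case using D by linarith
    qed
  next
    fix i
    assume "indep i"
    then have "1 \<le> \<bar>x i \<bullet> (x (Suc i) \<times> x (Suc (Suc i)))\<bar>"
      using Z3 by (intro Ints_nonzero_abs_ge1 Z3_inner Z3_cross) auto
    also have "\<dots> \<le> 2 * (N i * L (x (Suc i)) * L (x (Suc (Suc i))) + N (Suc i) * L (x i) * L (x (Suc (Suc i)))
        + N (Suc (Suc i)) * L (x i) * L (x (Suc i)))"
      by (rule triple_line_le[OF nrm])
    also have "\<dots> \<le> 6 * (N (Suc (Suc i)) * L (x i) * L (x (Suc i)))"
    proof -
      have "N (Suc i) * L (x i) * L (x (Suc (Suc i))) \<le> N (Suc (Suc i)) * L (x i) * L (x (Suc i))"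
        using L_dec[of "Suc i" "Suc (Suc i)"] norm_mono[of "Suc i" "Suc (Suc i)"] by (intro mult_mono) auto
      moreover have "N i * L (x (Suc i)) * L (x (Suc (Suc i))) \<le> N (Suc (Suc i)) * L (x i) * L (x (Suc i))"
        using L_dec[of "Suc i" "Suc (Suc i)"] L_dec[of i "Suc i"] norm_mono[of i "Suc (Suc i)"] by (intro mult_mono) auto
      moreover have "2 * (p + q + r) \<le> 6 * r" if "q \<le> r" "p \<le> r" for p q r :: real using that by simp
      ultimately show ?thesis by blast
    qed
    finally have "0 \<le> ln (6 * (N (Suc (Suc i)) * L (x i) * L (x (Suc i))))" by simp
    also have "\<dots> = ln 6 + n (Suc (Suc i)) + m i + m (Suc i)"
      using nz L_pos[of i] L_pos[of "Suc i"] by (simp add: ln_mult n_def m_def)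
    finally show "0 \<le> D + n (Suc (Suc i)) + m i + m (Suc i)" using D by linarith
  qed
qed

text \<open>At an independent triple the determinant bounds \<open>l * n (Suc i)\<close> by
  \<open>(1 - l) * n (Suc (Suc i))\<close>, and the nonisotropy of the middle point bounds
  \<open>l * n (Suc (Suc i))\<close> by \<open>n (Suc i)\<close>, up to constants. Eliminating
  \<open>n (Suc (Suc i))\<close> leaves \<open>(l\<^sup>2 + l - 1) * n (Suc i)\<close> bounded;
  \<open>l < 1\<close> fixes the sign of the multiplier \<open>1 - l\<close>.\<close>

lemma exponent_quadratic_le:
  assumes "l < 1"
  shows "l\<^sup>2 + l - 1 \<le> 0"
proof (rule ccontr)
  assume "\<not> ?thesis"
  then have pos: "l\<^sup>2 + l - 1 > 0" by simp
  obtain D where D: "D \<ge> 0" "\<And>i. m i \<le> D - l * n (Suc i)" "\<forall>\<^sub>F i in sequentially. 0 \<le> D + n i + m i"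
    "\<And>i. indep i \<Longrightarrow> 0 \<le> D + n (Suc (Suc i)) + m i + m (Suc i)"
    using log_bounds by blast
  have "\<forall>\<^sub>F i in sequentially. 5 * D / (l\<^sup>2 + l - 1) < n i"
    using n_at_top by (simp add: filterlim_at_top_dense)
  then have "\<forall>\<^sub>F i in sequentially. 0 \<le> D + n i + m i \<and> 5 * D / (l\<^sup>2 + l - 1) < n i"
    using D(3) by eventually_elim simp
  then obtain i0 where i0: "\<And>i. i \<ge> i0 \<Longrightarrow> 0 \<le> D + n i + m i \<and> 5 * D / (l\<^sup>2 + l - 1) < n i"
    unfolding eventually_sequentially by blast
  obtain i where i: "i \<ge> i0" "indep i"
    using infinitely_many_independent unfolding infinite_nat_iff_unbounded_le by blast
  have 1: "l * n (Suc (Suc i)) \<le> n (Suc i) + 2 * D"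
    using i0[of "Suc i"] i D(2)[of "Suc i"] by linarith
  have 2: "l * n (Suc i) \<le> (1 - l) * n (Suc (Suc i)) + 3 * D"
    using D(4)[OF i(2)] D(2)[of i] D(2)[of "Suc i"] by (simp add: algebra_simps)
  have "l * (l * n (Suc i)) \<le> l * ((1 - l) * n (Suc (Suc i)) + 3 * D)"
    using 2 l_pos by (intro mult_left_mono) auto
  also have "\<dots> = (1 - l) * (l * n (Suc (Suc i))) + 3 * D * l" by (simp add: algebra_simps)
  also have "\<dots> \<le> (1 - l) * (n (Suc i) + 2 * D) + 3 * D * l"
    using 1 assms by (intro add_right_mono mult_left_mono) auto
  finally have "(l\<^sup>2 + l - 1) * n (Suc i) \<le> 2 * D + D * l"
    by (simp add: algebra_simps power2_eq_square)
  moreover have "D * l \<le> D" using assms D(1) l_pos by (simp add: mult_left_le)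
  ultimately have "(l\<^sup>2 + l - 1) * n (Suc i) \<le> 5 * D" using D(1) by linarith
  then show False using i0[of "Suc i"] i pos by (simp add: field_simps)
qed

end

section \<open>Rigidity of the sequence of minimal points\<close>

context conic_minimal
begin

definition e :: "nat \<Rightarrow> nat" where "e = enumerate {i. indep i}"

definition y :: "nat \<Rightarrow> real ^ 3" where "y k = x (Suc (e k))"

text \<open>Normal vector of the plane that contains all minimal points from \<open>y k\<close> to
  \<open>y (Suc k)\<close>. The plane changes exactly at the independent triples, whose middle
  points are the \<open>y k\<close>, so \<open>y (Suc k)\<close> spans the intersection of two
  consecutive planes.\<close>

definition w :: "nat \<Rightarrow> real ^ 3" where "w k = x (Suc (e k)) \<times> x (Suc (Suc (e k)))"

lemma e_indep: "indep (e k)"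
  using enumerate_in_set[OF infinitely_many_independent] by (simp add: e_def)

lemma e_less: "j < k \<Longrightarrow> e j < e k"
  using enumerate_mono[OF _ infinitely_many_independent] by (simp add: e_def)

lemma e_ge: "k \<le> e k"
  using le_enumerate[OF infinitely_many_independent] by (simp add: e_def)

lemma e_gap: "e k < i \<Longrightarrow> i < e (Suc k) \<Longrightarrow> \<not> indep i"
  using enumerate_Suc''[OF infinitely_many_independent, of k] not_less_Least unfolding e_def by fastforce

lemma y_Z3: "y k \<in> Z3" and y_nz: "y k \<noteq> 0"
  by (simp_all add: y_def Z3 nz)

lemma y_not_parallel: "j < k \<Longrightarrow> y j \<times> y k \<noteq> 0"
  unfolding y_def using e_less by (intro not_parallel) simp

lemma w_Z3: "w k \<in> Z3"
  by (simp add: w_def Z3 Z3_cross)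

lemma w_indep: "w k \<bullet> x (e k) \<noteq> 0"
  using e_indep[of k] by (simp add: w_def inner_commute)

lemma w_orth: "Suc (e k) \<le> i \<Longrightarrow> i \<le> e (Suc k) \<Longrightarrow> w k \<bullet> x i = 0 \<and> w k \<bullet> x (Suc i) = 0"
proof (induction i rule: dec_induct)
  case base
  then show ?case by (simp add: w_def dot_cross_self)
next
  case (step i)
  then have "w k \<bullet> x i = 0 \<and> w k \<bullet> x (Suc i) = 0" by simp
  then show ?case using plane_step[of "w k" i] e_gap[of k i] step by auto
qed

lemma w_y: "w k \<bullet> y k = 0" "w k \<bullet> y (Suc k) = 0" "w k \<bullet> x (e (Suc k)) = 0"
  using w_orth[of k "e (Suc k)"] e_less[of k "Suc k"] by (auto simp: y_def w_def dot_cross_self)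

lemma w_w: "w k \<times> w (Suc k) \<noteq> 0"
proof
  assume "w k \<times> w (Suc k) = 0"
  moreover have "w k \<noteq> 0" using w_indep[of k] by auto
  ultimately obtain r where "w (Suc k) = r *\<^sub>R w k" using cross_eq_0_scaleR by blast
  then show False using w_y(3)[of k] w_indep[of "Suc k"] by simp
qed

text \<open>Were they dependent, \<open>y k\<close> would lie in the plane of
  \<open>w (Suc k)\<close> as well as in that of \<open>w k\<close>, hence on their common line,
  which is spanned by \<open>y (Suc k)\<close>.\<close>

lemma y_indep: "y k \<bullet> (y (Suc k) \<times> y (Suc (Suc k))) \<noteq> 0"
proof
  assume 0: "y k \<bullet> (y (Suc k) \<times> y (Suc (Suc k))) = 0"
  have "w (Suc k) \<times> (y (Suc k) \<times> y (Suc (Suc k))) = 0"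
    using w_y by (intro orth_cross_parallel)
  moreover have "w (Suc k) \<noteq> 0" using w_indep[of "Suc k"] by auto
  ultimately obtain r where r: "y (Suc k) \<times> y (Suc (Suc k)) = r *\<^sub>R w (Suc k)"
    using cross_eq_0_scaleR by blast
  then have "r \<noteq> 0" using y_not_parallel[of "Suc k" "Suc (Suc k)"] by auto
  then have "y k \<bullet> w (Suc k) = 0" using 0 r by simp
  then have 1: "y k \<times> (w k \<times> w (Suc k)) = 0" using w_y by (intro orth_cross_parallel) (simp_all add: inner_commute)
  have "y (Suc k) \<times> (w k \<times> w (Suc k)) = 0" using w_y by (intro orth_cross_parallel) (simp_all add: inner_commute)
  then obtain s where s: "w k \<times> w (Suc k) = s *\<^sub>R y (Suc k)" using cross_eq_0_scaleR y_nz by metis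
  then have "s \<noteq> 0" using w_w by auto
  then have "y k \<times> y (Suc k) = 0" using 1 s by (simp add: cross_mult_right)
  then show False using y_not_parallel by simp
qed

text \<open>The minimal point \<open>y\<^sub>k\<^sub>+\<^sub>1\<close> is, up to a factor of absolute value at most 1, the cross product of
  the integral normal vectors of the two planes that meet along it.\<close>

lemma y_norm_le: "norm (y (Suc k)) \<le> norm (w k) * norm (w (Suc k))"
proof -
  let ?z = "w k \<times> w (Suc k)"
  have "y (Suc k) \<times> ?z = 0" using w_y by (intro orth_cross_parallel) (simp_all add: inner_commute)
  then obtain r where r: "?z = r *\<^sub>R y (Suc k)" using cross_eq_0_scaleR y_nz by metis
  \<comment> \<open>Otherwise \<open>?z\<close> would be a nonzero integer vector shorter than
    \<open>y (Suc k)\<close> and at least as close to the line, against the minimality of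
    \<open>y (Suc k)\<close>.\<close>
  have "norm (y (Suc k)) \<le> norm ?z"
  proof (rule ccontr)
    assume less: "\<not> ?thesis"
    then have "\<bar>r\<bar> * norm (y (Suc k)) < 1 * norm (y (Suc k))" unfolding r by simp
    then have "\<bar>r\<bar> < 1" by (rule mult_right_less_imp_less) simp
    have "L (x (e (Suc k))) \<le> L ?z"
      using less w_w by (intro minimal Z3_cross w_Z3) (auto simp: y_def)
    also have "\<dots> \<le> L (y (Suc k))"
      using \<open>\<bar>r\<bar> < 1\<close> unfolding r cross_mult_left by (simp add: mult_left_le_one_le)
    also have "\<dots> < L (x (e (Suc k)))" unfolding y_def by (rule L_dec) simp
    finally show False by simp
  qed
  also have "\<dots> \<le> norm (w k) * norm (w (Suc k))" by (rule norm_cross_le)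
  finally show ?thesis .
qed

definition A :: "nat \<Rightarrow> real" where "A k = n (Suc (e k))"
definition M :: "nat \<Rightarrow> real" where "M k = m (Suc (e k))"

lemma exp_A: "exp (A k) = norm (y k)" and exp_M: "exp (M k) = L (y k)"
  unfolding A_def M_def y_def by (simp_all add: exp_n exp_m)

lemma A_at_top: "filterlim A at_top sequentially"
proof (rule filterlim_at_top_mono[OF n_at_top])
  show "\<forall>\<^sub>F k in sequentially. n k \<le> A k"
    unfolding A_def using e_ge by (intro always_eventually allI n_mono le_SucI)
qed

text \<open>For \<open>l = 1/\<gamma>\<close> the three factors below could be taken arbitrarily close to \<open>\<gamma>\<close>, \<open>\<gamma>\<close> and \<open>-1\<close>. The value
  \<open>617/1000\<close> is below \<open>1/\<gamma>\<close>, but so close to it that the determinants in the proof of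
  \<open>recurrence\<close> still tend to 0.\<close>

lemma growth:
  assumes l: "l = 617 / 1000"
  shows "\<forall>\<^sub>F k in sequentially. (161 / 100) * A k \<le> A (Suc k) \<and> A (Suc k) \<le> (164 / 100) * A k \<and> M k \<le> - (99 / 100) * A k"
proof -
  obtain D where D: "D \<ge> 0" "\<And>i. m i \<le> D - l * n (Suc i)" "\<forall>\<^sub>F i in sequentially. 0 \<le> D + n i + m i"
    "\<And>i. indep i \<Longrightarrow> 0 \<le> D + n (Suc (Suc i)) + m i + m (Suc i)"
    using log_bounds by blast
  define B where "B k = n (Suc (Suc (e k)))" for k
  have M_le: "M k \<le> D - l * B k" for k using D(2) by (simp add: M_def B_def)
  \<comment> \<open>With \<open>B k \<le> A (Suc k)\<close> this gives, up to constants, the growth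
    factor \<open>l / (1 - l) = 617/383 > 161/100\<close>; inserted in \<open>M_le\<close> it gives
    the factor \<open>- l\<^sup>2 / (1 - l) < - 99/100\<close> for \<open>M k\<close>.\<close>
  have lower: "(1 - l) * B k \<ge> l * A k - 3 * D" for k
    using D(4)[OF e_indep[of k]] D(2)[of "e k"] M_le[of k] unfolding A_def B_def M_def l
    by simp
  have AB: "B k \<le> A (Suc k)" for k
    unfolding A_def B_def using e_less[of k "Suc k"] by (intro n_mono) simp
  have ln_w: "norm (w k) \<le> exp (2 + D + (1 - l) * B k)" for k
  proof -
    have "norm (w k) \<le> 3 * (N (Suc (Suc (e k))) * L (x (Suc (e k))))"
      unfolding w_def by (rule cross_le) simp
    also have "\<dots> = 3 * exp (B k + M k)"
      by (simp add: exp_add B_def M_def exp_n exp_m)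
    also have "\<dots> \<le> exp 2 * exp (D + (1 - l) * B k)"
    proof (rule mult_mono)
      show "(3::real) \<le> exp 2" using exp_ge_add_one_self[of 2] by simp
      show "exp (B k + M k) \<le> exp (D + (1 - l) * B k)" using M_le[of k] by (simp add: algebra_simps)
    qed auto
    finally show ?thesis by (simp add: exp_add mult_ac)
  qed
  have upper: "A (Suc k) \<le> 4 + 2 * D + (1 - l) * B k + (1 - l) * B (Suc k)" for k
  proof -
    have "exp (A (Suc k)) \<le> norm (w k) * norm (w (Suc k))"
      unfolding exp_A by (rule y_norm_le)
    also have "\<dots> \<le> exp (2 + D + (1 - l) * B k) * exp (2 + D + (1 - l) * B (Suc k))"
      by (intro mult_mono ln_w) auto
    finally have "A (Suc k) \<le> (2 + D + (1 - l) * B k) + (2 + D + (1 - l) * B (Suc k))"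
      unfolding exp_add[symmetric] by simp
    then show ?thesis by simp
  qed
  obtain i0 where i0: "\<And>i. i \<ge> i0 \<Longrightarrow> 0 \<le> D + n i + m i"
    using D(3) unfolding eventually_sequentially by blast
  \<comment> \<open>Inserted in \<open>upper\<close> for \<open>k\<close> and \<open>Suc k\<close>,
    this gives up to constants the factor \<open>(1 - l) / (2 * l - 1) = 383/234 < 164/100\<close>.
    The constants are absorbed below by taking \<open>A k\<close> at least
    \<open>100000 * (D + 1)\<close>.\<close>
  have up: "l * B k \<le> A k + 2 * D" if "k \<ge> i0" for k
    using i0[of "Suc (e k)"] that e_ge[of k] M_le[of k] unfolding A_def M_def by simp
  have "\<forall>\<^sub>F k in sequentially. 100000 * (D + 1) \<le> A k"
    using A_at_top by (simp add: filterlim_at_top)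
  moreover have "\<forall>\<^sub>F k in sequentially. i0 \<le> k" by (rule eventually_ge_at_top)
  ultimately show ?thesis
  proof eventually_elim
    case (elim k)
    then show ?case
      using lower[of k] AB[of k] upper[of k] up[of k] up[of "Suc k"] M_le[of k] D(1)
      unfolding l by simp
  qed
qed

text \<open>The reflection of \<open>y (k + 4)\<close> in \<open>y (k + 3)\<close> has determinant 0
  with the pairs of indices \<open>k + 1, k + 2\<close> and \<open>k, k + 1\<close>, both
  determinants being integers of absolute value below 1. By \<open>y_indep\<close> the two planes
  meet in the line of \<open>y (k + 1)\<close>.\<close>

lemma recurrence:
  assumes l: "l = 617 / 1000"
  shows "\<forall>\<^sub>F k in sequentially. \<exists>c. y (k + 4) = c *\<^sub>R refl (y (k + 3)) (y (k + 1))"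
proof -
  obtain K where K: "K > 0" "\<And>x y. \<bar>b x y\<bar> \<le> K * norm x * norm y"
    using b_bound by blast
  obtain k0 where k0: "\<And>k. k \<ge> k0 \<Longrightarrow> (161 / 100) * A k \<le> A (Suc k) \<and> A (Suc k) \<le> (164 / 100) * A k \<and> M k \<le> - (99 / 100) * A k"
    using growth[OF l] unfolding eventually_sequentially by blast
  obtain i1 where i1: "\<And>i. i \<ge> i1 \<Longrightarrow> b (x i) (x i) \<noteq> 0"
    using eventually_nonisotropic unfolding eventually_sequentially by blast
  have "\<forall>\<^sub>F k in sequentially. 20 * ln (200 * K) < A k"
    using A_at_top by (simp add: filterlim_at_top_dense)
  moreover have "\<forall>\<^sub>F k in sequentially. max k0 i1 \<le> k" by (rule eventually_ge_at_top)
  ultimately show ?thesis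
  proof eventually_elim
    case (elim k)
    let ?A = "\<lambda>i. A (k + i)" and ?M = "\<lambda>i. M (k + i)" and ?y = "\<lambda>i. y (k + i)"
    have A_nn: "?A 0 \<ge> 0" by (simp add: A_def n_nonneg)
    have g: "(161 / 100) * ?A 0 \<le> ?A 1" "?A 1 \<le> (164 / 100) * ?A 0" "?M 0 \<le> - (99 / 100) * ?A 0"
      "(161 / 100) * ?A 1 \<le> ?A 2" "?A 2 \<le> (164 / 100) * ?A 1" "?M 1 \<le> - (99 / 100) * ?A 1"
      "(161 / 100) * ?A 2 \<le> ?A 3" "?A 3 \<le> (164 / 100) * ?A 2" "?M 2 \<le> - (99 / 100) * ?A 2"
      "(161 / 100) * ?A 3 \<le> ?A 4" "?A 4 \<le> (164 / 100) * ?A 3" "?M 3 \<le> - (99 / 100) * ?A 3" "?M 4 \<le> - (99 / 100) * ?A 4"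
      using k0[of k] k0[of "k + 1"] k0[of "k + 2"] k0[of "k + 3"] k0[of "k + 4"] elim(2)
      by (simp_all add: numeral_eq_Suc)
    let ?z = "refl (?y 3) (?y 4)" and ?T = "exp (- ?A 0 / 20)"
    have Ky: "norm (?y i) = exp (?A i)" "L (?y i) = exp (?M i)" for i by (simp_all add: exp_A exp_M)
    have Z: "norm ?z \<le> 11 * K * (exp (2 * ?A 3 + ?M 4) + exp (?A 4 + 2 * ?M 3))"
      using refl_norm_le[OF nrm zero K, of "?y 3" "?y 4"]
      by (simp add: Ky exp_add exp_of_nat_mult[of 2, simplified] exp_double)
    have Lz: "L ?z \<le> 7 * K * (exp (?A 3 + ?M 3 + ?M 4) + exp (?A 4 + 2 * ?M 3))"
      using refl_line_le[OF nrm zero K, of "?y 3" "?y 4"]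
      by (simp add: Ky exp_add exp_double)
    \<comment> \<open>The six hypotheses are the logarithms of the products in
      \<open>triple_line_le\<close>, as the bounds for \<open>norm ?z\<close> and
      \<open>L ?z\<close> have two summands each. If \<open>A\<close> grew exactly by the golden
      ratio and \<open>M\<close> were \<open>- A\<close>, the largest of them for the two pairs used
      below would be about \<open>- 0.618 * A k\<close>; the margin \<open>1/20\<close> leaves room
      for the tolerance in \<open>growth\<close>.\<close>
    have small: "\<bar>?z \<bullet> (?y i \<times> ?y j)\<bar> < 1"
      if h: "2 * ?A 3 + ?M 4 + ?M i + ?M j \<le> - ?A 0 / 20" "?A 4 + 2 * ?M 3 + ?M i + ?M j \<le> - ?A 0 / 20"
        "?A 3 + ?M 3 + ?M 4 + ?A i + ?M j \<le> - ?A 0 / 20" "?A 4 + 2 * ?M 3 + ?A i + ?M j \<le> - ?A 0 / 20"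
        "?A 3 + ?M 3 + ?M 4 + ?A j + ?M i \<le> - ?A 0 / 20" "?A 4 + 2 * ?M 3 + ?A j + ?M i \<le> - ?A 0 / 20"
      for i j
    proof -
      have 1: "norm ?z * exp (?M i) * exp (?M j) \<le> 22 * (K * ?T)"
      proof -
        have "norm ?z * exp (?M i) * exp (?M j)
          \<le> 11 * K * (exp (2 * ?A 3 + ?M 4) + exp (?A 4 + 2 * ?M 3)) * exp (?M i) * exp (?M j)"
          using Z by (intro mult_right_mono) auto
        also have "\<dots> = 11 * K * (exp (2 * ?A 3 + ?M 4 + ?M i + ?M j) + exp (?A 4 + 2 * ?M 3 + ?M i + ?M j))"
          by (simp add: exp_add algebra_simps)
        also have "\<dots> \<le> 11 * K * (?T + ?T)" using h K(1) by (intro mult_left_mono add_mono) auto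
        finally show ?thesis by simp
      qed
      have 2: "exp (?A i') * L ?z * exp (?M j') \<le> 14 * (K * ?T)"
        if h: "?A 3 + ?M 3 + ?M 4 + ?A i' + ?M j' \<le> - ?A 0 / 20" "?A 4 + 2 * ?M 3 + ?A i' + ?M j' \<le> - ?A 0 / 20" for i' j'
      proof -
        have "exp (?A i') * L ?z * exp (?M j')
          \<le> exp (?A i') * (7 * K * (exp (?A 3 + ?M 3 + ?M 4) + exp (?A 4 + 2 * ?M 3))) * exp (?M j')"
          using Lz by (intro mult_right_mono mult_left_mono) auto
        also have "\<dots> = 7 * K * (exp (?A 3 + ?M 3 + ?M 4 + ?A i' + ?M j') + exp (?A 4 + 2 * ?M 3 + ?A i' + ?M j'))"
          by (simp add: exp_add algebra_simps)
        also have "\<dots> \<le> 7 * K * (?T + ?T)" using h K(1) by (intro mult_left_mono add_mono) auto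
        finally show ?thesis by simp
      qed
      have "\<bar>?z \<bullet> (?y i \<times> ?y j)\<bar> \<le> 2 * (norm ?z * L (?y i) * L (?y j) + norm (?y i) * L ?z * L (?y j)
          + norm (?y j) * L ?z * L (?y i))"
        by (rule triple_line_le[OF nrm])
      \<comment> \<open>\<open>100 = 2 * (22 + 14 + 14)\<close>. The choice
        \<open>20 * ln (200 * K) < A k\<close> makes this smaller than 1.\<close>
      also have "\<dots> \<le> 100 * (K * ?T)"
        using 1 2[of i j] 2[of j i] h unfolding Ky by simp
      also have "\<dots> < 1"
      proof -
        have "exp (ln (200 * K)) < exp (?A 0 / 20)" using elim(1) by simp
        then have "200 * K < exp (?A 0 / 20)" using K(1) by simp
        then have "200 * K * ?T < exp (?A 0 / 20) * ?T" by (rule mult_strict_right_mono) simp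
        also have "\<dots> = 1" by (simp add: exp_add[symmetric])
        finally show ?thesis using K(1) by simp
      qed
      finally show ?thesis .
    qed
    have zero_if: "?z \<bullet> (?y i \<times> ?y j) = 0" if "\<bar>?z \<bullet> (?y i \<times> ?y j)\<bar> < 1" for i j
      using that Ints_nonzero_abs_ge1[of "?z \<bullet> (?y i \<times> ?y j)"]
      by (meson Z3_cross Z3_inner linorder_not_le refl_Z3 y_Z3)
    have d12: "?z \<bullet> (?y 1 \<times> ?y 2) = 0"
      using g A_nn by (intro zero_if small) linarith+
    have d01: "?z \<bullet> (?y 0 \<times> ?y 1) = 0"
      using g A_nn by (intro zero_if small) linarith+
    let ?d = "?y 0 \<bullet> (?y 1 \<times> ?y 2)"
    have d: "?d \<noteq> 0" using y_indep[of k] by (simp add: numeral_eq_Suc)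
    have "?d *\<^sub>R ?z = (?y 0 \<bullet> (?z \<times> ?y 2)) *\<^sub>R ?y 1"
      using triple_expand[of "?y 0" "?y 1" "?y 2" ?z] d12 d01 cross_triple[of "?y 0" "?y 1" ?z]
        cross_triple[of "?y 1" ?z "?y 0"] by (simp add: inner_commute)
    then have "(1 / ?d) *\<^sub>R (?d *\<^sub>R ?z) = (1 / ?d) *\<^sub>R ((?y 0 \<bullet> (?z \<times> ?y 2)) *\<^sub>R ?y 1)" by simp
    then obtain r where r: "?z = r *\<^sub>R ?y 1" using d by auto
    \<comment> \<open>Reflection in \<open>y (k + 3)\<close> is its own inverse up to the nonzero
      factor \<open>?q\<^sup>2\<close>, so the relation can be solved for
      \<open>y (k + 4)\<close>.\<close>
    let ?q = "b (?y 3) (?y 3)"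
    have q: "?q \<noteq> 0" unfolding y_def using elim(2) e_ge[of "k + 3"] by (intro i1) simp
    have "?q\<^sup>2 *\<^sub>R ?y 4 = refl (?y 3) (r *\<^sub>R ?y 1)" unfolding r[symmetric] by (rule refl_refl[symmetric])
    also have "\<dots> = r *\<^sub>R refl (?y 3) (?y 1)" by (simp add: linear_scale[OF linear_refl])
    finally have "(1 / ?q\<^sup>2) *\<^sub>R (?q\<^sup>2 *\<^sub>R ?y 4) = (1 / ?q\<^sup>2) *\<^sub>R (r *\<^sub>R refl (?y 3) (?y 1))" by simp
    then have "?y 4 = (r / ?q\<^sup>2) *\<^sub>R refl (?y 3) (?y 1)" using q by simp
    then show ?case by blast
  qed
qed

end

section \<open>Countability: a point is determined by three integer vectors\<close>

context int_form
begin

text \<open>The scalar in the recurrence is left free and the limit is taken of directions, so that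
  only the lines spanned by the \<open>v k\<close> matter.\<close>

definition generates :: "(real ^ 3) \<Rightarrow> (nat \<Rightarrow> real ^ 3) \<Rightarrow> bool" where
  "generates \<Xi> v \<longleftrightarrow> (\<forall>k. v k \<in> Z3 \<and> v k \<noteq> 0 \<and> (\<exists>c. v (k + 3) = c *\<^sub>R refl (v (k + 2)) (v k))) \<and>
     (\<lambda>k. norm (\<Xi> \<times> sgn (v k))) \<longlonglongrightarrow> 0"

lemma generates_exists:
  assumes "norm \<Xi> = 1" "lin_indep \<Xi>" "uniform_approx \<Xi> (617 / 1000)" "b \<Xi> \<Xi> = 0" isotropic_gap
  obtains v where "generates \<Xi> v"
proof -
  obtain x C where "minimal_points \<Xi> (617 / 1000) x C"
    using minimal_points_exist[OF assms(1-3)] by auto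
  then interpret minimal_points \<Xi> "617 / 1000" x C .
  interpret conic_minimal b \<Xi> "617 / 1000" x C
    using assms(4,5) by unfold_locales auto
  obtain k0 where k0: "\<And>k. k \<ge> k0 \<Longrightarrow> \<exists>c. y (k + 4) = c *\<^sub>R refl (y (k + 3)) (y (k + 1))"
    using recurrence unfolding eventually_sequentially by blast
  define v where "v k = y (k + (k0 + 1))" for k
  have "\<exists>c. v (k + 3) = c *\<^sub>R refl (v (k + 2)) (v k)" for k
    using k0[of "k + k0"] by (simp add: v_def ac_simps numeral_eq_Suc)
  moreover have "(\<lambda>k. norm (\<Xi> \<times> sgn (v k))) \<longlonglongrightarrow> 0"
  proof (rule Lim_null_comparison)
    have "filterlim (\<lambda>k. Suc (e (k + (k0 + 1)))) sequentially sequentially"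
    proof (rule filterlim_at_top_mono[OF filterlim_ident])
      show "\<forall>\<^sub>F k in sequentially. k \<le> Suc (e (k + (k0 + 1)))"
        using e_ge by (intro always_eventually allI) (meson le_SucI le_add1 le_trans)
    qed
    from filterlim_compose[OF L_tendsto_0 this]
    show "(\<lambda>k. L (v k)) \<longlonglongrightarrow> 0" by (simp add: v_def y_def)
    show "\<forall>\<^sub>F k in sequentially. norm (norm (\<Xi> \<times> sgn (v k))) \<le> L (v k)"
    proof (intro always_eventually allI)
      fix k
      have "norm (v k) \<ge> 1" unfolding v_def using y_Z3 y_nz Z3_norm_ge_1 by blast
      then have "L (v k) / norm (v k) \<le> L (v k)" by (simp add: divide_le_eq mult_le_cancel_left1)
      moreover have "norm (\<Xi> \<times> v k) = L (v k)" by (metis cross_skew norm_minus_cancel)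
      ultimately show "norm (norm (\<Xi> \<times> sgn (v k))) \<le> L (v k)"
        by (simp add: sgn_div_norm cross_mult_right divide_inverse mult.commute)
    qed
  qed
  ultimately have "generates \<Xi> v"
    unfolding generates_def using y_Z3 y_nz by (auto simp: v_def)
  then show thesis by (rule that)
qed

text \<open>Reflections of proportional vectors are proportional, and the scalars can be divided out
  since no \<open>v k\<close> is 0. So the sequences agree term by term up to scalars, and their
  limiting directions coincide.\<close>

lemma generates_unique:
  assumes v: "generates \<Xi> v" and v': "generates \<Xi>' v'"
    and eq: "v 0 = v' 0" "v 1 = v' 1" "v 2 = v' 2"
  shows "\<Xi> \<times> \<Xi>' = 0"
proof -
  have step: "\<exists>r. v' (k + 3) = r *\<^sub>R v (k + 3)"
    if par: "\<exists>r. v' k = r *\<^sub>R v k \<and> v' (k + 1) = s *\<^sub>R v (k + 1) \<and> v' (k + 2) = t *\<^sub>R v (k + 2)" for k s t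
  proof -
    obtain r where r: "v' k = r *\<^sub>R v k" "v' (k + 2) = t *\<^sub>R v (k + 2)" using par by blast
    obtain c where c: "v (k + 3) = c *\<^sub>R refl (v (k + 2)) (v k)" using v by (auto simp: generates_def)
    obtain c' where c': "v' (k + 3) = c' *\<^sub>R refl (v' (k + 2)) (v' k)" using v' by (auto simp: generates_def)
    have "v (k + 3) \<noteq> 0" using v by (simp add: generates_def)
    then have "c \<noteq> 0" using c by auto
    then have "refl (v (k + 2)) (v k) = (1 / c) *\<^sub>R v (k + 3)" unfolding c by simp
    then show ?thesis unfolding c' r refl_scale by (metis scaleR_scaleR)
  qed
  have "\<exists>r s t. v' k = r *\<^sub>R v k \<and> v' (k + 1) = s *\<^sub>R v (k + 1) \<and> v' (k + 2) = t *\<^sub>R v (k + 2)" for k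
  proof (induction k)
    case 0
    show ?case using eq by (intro exI[of _ 1]) (simp add: numeral_eq_Suc)
  next
    case (Suc k)
    then show ?case using step[of k] by (auto simp: numeral_eq_Suc)
  qed
  then have par: "\<exists>r. v' k = r *\<^sub>R v k" for k by blast
  have le: "norm (\<Xi> \<times> \<Xi>') \<le> 2 * norm \<Xi> * norm (\<Xi>' \<times> sgn (v' k)) + norm \<Xi>' * norm (\<Xi> \<times> sgn (v k))" for k
  proof -
    obtain r where r: "v' k = r *\<^sub>R v k" using par by blast
    have nz: "v k \<noteq> 0" "v' k \<noteq> 0" using v v' by (auto simp: generates_def)
    then have "norm (\<Xi>' \<times> sgn (v' k)) = norm (\<Xi>' \<times> sgn (v k))"
      unfolding r by (auto simp: sgn_scaleR cross_mult_right abs_sgn_eq)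
    moreover have "norm (sgn (v k)) = 1" using nz by (simp add: norm_sgn)
    ultimately show ?thesis using norm_cross_line_le[of "sgn (v k)" \<Xi> \<Xi>'] by simp
  qed
  have "(\<lambda>k. 2 * norm \<Xi> * norm (\<Xi>' \<times> sgn (v' k)) + norm \<Xi>' * norm (\<Xi> \<times> sgn (v k)))
    \<longlonglongrightarrow> 2 * norm \<Xi> * 0 + norm \<Xi>' * 0"
    using v v' unfolding generates_def by (intro tendsto_add tendsto_mult_left) auto
  then have "norm (\<Xi> \<times> \<Xi>') \<le> 0"
    using le by (intro LIMSEQ_le_const[of _ 0]) auto
  then show ?thesis by simp
qed

text \<open>Three initial vectors determine only the line of \<open>\<Xi>\<close>; hence the
  requirement that parallel members of \<open>S\<close> be equal.\<close>

lemma countable_approximable: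
  assumes gap: isotropic_gap
    and S: "\<And>\<Xi>. \<Xi> \<in> S \<Longrightarrow> norm \<Xi> = 1 \<and> lin_indep \<Xi> \<and> uniform_approx \<Xi> (617 / 1000) \<and> b \<Xi> \<Xi> = 0"
    and inj: "\<And>\<Xi> \<Xi>'. \<Xi> \<in> S \<Longrightarrow> \<Xi>' \<in> S \<Longrightarrow> \<Xi> \<times> \<Xi>' = 0 \<Longrightarrow> \<Xi> = \<Xi>'"
  shows "countable S"
proof -
  have "\<forall>\<Xi>\<in>S. \<exists>v. generates \<Xi> v" using generates_exists S gap by metis
  then obtain v where v: "\<And>\<Xi>. \<Xi> \<in> S \<Longrightarrow> generates \<Xi> (v \<Xi>)" by metis
  let ?f = "\<lambda>\<Xi>. (v \<Xi> 0, v \<Xi> 1, v \<Xi> 2)"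
  have "?f ` S \<subseteq> (SIGMA _:Z3. SIGMA _:Z3. Z3)"
    using v by (auto simp: generates_def)
  then have "countable (?f ` S)"
    by (rule countable_subset) (intro countable_SIGMA countable_Z3)
  moreover have "inj_on ?f S"
    using generates_unique v inj by (intro inj_onI) (metis prod.inject)
  ultimately show ?thesis by (simp add: countable_image_inj_eq)
qed

end

section \<open>Points of largest exponent\<close>

text \<open>The product of the factors is at most the exponential of a geometric sum;
  \<open>3 * c / 2 - 3 * c / 2 / 3 ^ n\<close> is the sum of its first \<open>n\<close>
  terms.\<close>

lemma bounded_of_slow_growth:
  fixes g :: "nat \<Rightarrow> real"
  assumes g0: "\<And>n. g n \<ge> 0" and c: "c \<ge> 0" and g: "\<And>n. g (Suc n) \<le> (1 + c / 3 ^ n) * g n"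
  shows "\<exists>K>0. \<forall>n. g n \<le> K"
proof -
  have "g n \<le> g 0 * exp (3 * c / 2 - 3 * c / 2 / 3 ^ n)" for n
  proof (induction n)
    case (Suc n)
    have "g (Suc n) \<le> exp (c / 3 ^ n) * g n"
      using g[of n] mult_right_mono[OF exp_ge_add_one_self[of "c / 3 ^ n"] g0[of n]] by linarith
    also have "\<dots> \<le> exp (c / 3 ^ n) * (g 0 * exp (3 * c / 2 - 3 * c / 2 / 3 ^ n))"
      using Suc by (intro mult_left_mono) auto
    also have "\<dots> = g 0 * exp (3 * c / 2 - 3 * c / 2 / 3 ^ Suc n)"
      by (simp add: exp_add[symmetric] field_simps)
    finally show ?case .
  qed simp
  also have "g 0 * exp (3 * c / 2 - 3 * c / 2 / 3 ^ n) \<le> g 0 * exp (3 * c / 2)" for n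
    using c g0[of 0] by (intro mult_left_mono) auto
  finally have "g n \<le> g 0 * exp (3 * c / 2) + 1" for n by (smt (verit))
  moreover have "g 0 * exp (3 * c / 2) + 1 > 0" using g0[of 0] by (simp add: add_nonneg_pos)
  ultimately show ?thesis by blast
qed

lemma geometric_limit:
  fixes z :: "nat \<Rightarrow> 'a :: banach"
  assumes z: "\<And>n. norm (z (Suc n) - z n) \<le> g n" and g: "\<And>n. g (Suc n) \<le> g n / 2"
  obtains l where "z \<longlonglongrightarrow> l" "\<And>n. norm (z n - l) \<le> 2 * g n"
proof -
  have g0: "g n \<ge> 0" for n using z[of n] norm_ge_zero order_trans by blast
  \<comment> \<open>The subtracted term \<open>2 * g (n + k)\<close> is what lets the induction
    close: one more step costs \<open>g (n + k)\<close>, and \<open>g\<close> at least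
    halves.\<close>
  have le: "norm (z (n + k) - z n) \<le> 2 * g n - 2 * g (n + k)" for n k
  proof (induction k)
    case (Suc k)
    have "norm (z (n + Suc k) - z n) \<le> norm (z (Suc (n + k)) - z (n + k)) + norm (z (n + k) - z n)"
      using norm_triangle_ineq[of "z (Suc (n + k)) - z (n + k)" "z (n + k) - z n"] by simp
    then show ?case using Suc z[of "n + k"] g[of "n + k"] by simp
  qed simp
  have gn: "g n \<le> g 0 * (1 / 2) ^ n" for n
  proof (induction n)
    case (Suc n)
    then show ?case using g[of n] by simp
  qed simp
  have "(\<lambda>n. g 0 * (1 / 2) ^ n) \<longlonglongrightarrow> g 0 * 0"
    by (intro tendsto_mult_left LIMSEQ_power_zero) simp
  then have g_lim: "g \<longlonglongrightarrow> 0"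
    by (intro Lim_null_comparison[of g "\<lambda>n. g 0 * (1 / 2) ^ n"]) (use gn g0 in auto)
  have "Cauchy z"
  proof (rule CauchyI)
    fix r :: real assume "r > 0"
    then have "\<forall>\<^sub>F n in sequentially. g n < r / 4" using order_tendstoD(2)[OF g_lim, of "r / 4"] by simp
    then obtain n0 where n0: "g n0 < r / 4" unfolding eventually_sequentially by blast
    have near: "norm (z m - z n0) < r / 2" if "m \<ge> n0" for m
      using le[of n0 "m - n0"] g0[of m] n0 that by simp
    show "\<exists>M. \<forall>m\<ge>M. \<forall>n\<ge>M. norm (z m - z n) < r"
    proof (intro exI[of _ n0] allI impI)
      fix m n assume "n0 \<le> m" "n0 \<le> n"
      then show "norm (z m - z n) < r"
        using near[of m] near[of n] norm_triangle_ineq4[of "z m - z n0" "z n - z n0"] by simp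
    qed
  qed
  then obtain l where l: "z \<longlonglongrightarrow> l" using Cauchy_convergent convergent_def by blast
  have "norm (z n - l) \<le> 2 * g n" for n
  proof (rule LIMSEQ_le_const2)
    show "(\<lambda>k. norm (z n - z (k + n))) \<longlonglongrightarrow> norm (z n - l)"
      by (intro tendsto_norm tendsto_diff tendsto_const LIMSEQ_ignore_initial_segment l)
    show "\<exists>N. \<forall>k\<ge>N. norm (z n - z (k + n)) \<le> 2 * g n"
      using le[of n] g0 by (intro exI[of _ 0] allI impI)
        (smt (verit, best) add.commute norm_minus_commute)
  qed
  then show thesis using that l by blast
qed

text \<open>The recurrence of reflections, normalised: if all \<open>b (y n) (y n)\<close> equal
  \<open>a\<close> and \<open>2 * b (y (n + 2)) (y n) = a * s (n + 2)\<close>, then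
  \<open>refl (y (n + 2)) (y n) = a *\<^sub>R y (n + 3)\<close>. The rule for \<open>s\<close> is
  the one that the values of the polar form then obey, and the bound 4 forces growth by a factor of
  at least 3.\<close>

locale fibonacci_points =
  fixes y :: "nat \<Rightarrow> real ^ 3" and s :: "nat \<Rightarrow> real"
  assumes y_rec: "y (n + 3) = s (n + 2) *\<^sub>R y (n + 2) - y n"
    and s_rec: "s (n + 3) = s (n + 2) * s (n + 1) - s n"
    and s_init: "s 0 \<ge> 4" "s 1 \<ge> 4" "s 2 \<ge> s 0" "s 2 \<ge> s 1"
    and s_Ints: "s 0 \<in> \<int>" "s 1 \<in> \<int>" "s 2 \<in> \<int>"
    and y_init: "y 0 \<in> Z3" "y 1 \<in> Z3" "y 2 \<in> Z3" "y 0 \<bullet> (y 1 \<times> y 2) \<noteq> 0"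
begin

lemma s_inv: "s n \<ge> 4 \<and> s (n + 1) \<ge> 4 \<and> s (n + 2) \<ge> s n \<and> s (n + 2) \<ge> s (n + 1)"
proof (induction n)
  case 0
  then show ?case using s_init by (simp add: numeral_2_eq_2)
next
  case (Suc n)
  have "s (n + 2) * 4 \<le> s (n + 2) * s (n + 1)" using Suc by (intro mult_left_mono) auto
  then have "s (n + 3) \<ge> 3 * s (n + 2)" using Suc s_rec[of n] by linarith
  then show ?case using Suc by (simp add: numeral_eq_Suc)
qed

lemma s_ge: "s n \<ge> 4" using s_inv by blast

lemma s_le: "s n \<le> s (n + 2)" using s_inv by blast

lemma s_rec_ge: "s (n + 3) \<ge> s (n + 2) * (s (n + 1) - 1)"
  using s_rec[of n] s_le[of n] by (simp add: algebra_simps)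

lemma s_growth: "s (n + 1) - 1 \<ge> 3 ^ n"
proof (induction n rule: less_induct)
  case (less n)
  consider "n = 0" | "n = 1" | m where "n = Suc (Suc m)"
    by (metis One_nat_def not0_implies_Suc)
  then show ?case
  proof cases
    case 1 then show ?thesis using s_ge[of 1] by simp
  next
    case 2 then show ?thesis using s_ge[of 2] by (simp add: numeral_2_eq_2)
  next
    case 3
    have "s (m + 2) * 3 \<le> s (m + 2) * (s (m + 1) - 1)"
      using s_ge[of "m + 1"] s_ge[of "m + 2"] by (intro mult_left_mono) auto
    from order_trans[OF this s_rec_ge] have "s (m + 3) - 1 \<ge> 3 * (s (m + 2) - 1)" by simp
    also have "3 * (s (m + 2) - 1) \<ge> 3 * 3 ^ Suc m" using less[of "Suc m"] 3 by simp
    finally show ?thesis using 3 by (simp add: numeral_3_eq_3)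
  qed
qed

lemma s_Int: "s n \<in> \<int>"
proof -
  have "s n \<in> \<int> \<and> s (n + 1) \<in> \<int> \<and> s (n + 2) \<in> \<int>"
  proof (induction n)
    case 0 then show ?case using s_Ints by (simp add: numeral_2_eq_2)
  next
    case (Suc n) then show ?case using s_rec[of n] by (auto simp: numeral_eq_Suc)
  qed
  then show ?thesis by blast
qed

lemma y_Int: "y n \<in> Z3"
proof -
  have "y n \<in> Z3 \<and> y (n + 1) \<in> Z3 \<and> y (n + 2) \<in> Z3"
  proof (induction n)
    case 0 then show ?case using y_init by (simp add: numeral_2_eq_2)
  next
    case (Suc n) then show ?case using y_rec[of n] s_Int[of "n + 2"] by (auto simp: numeral_eq_Suc Z3_diff Z3_scale)
  qed
  then show ?thesis by blast
qed

text \<open>Modulo \<open>y (n + 2)\<close> the new vector is \<open>- y n\<close>, so the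
  determinant only changes its sign.\<close>

lemma y_det: "y n \<bullet> (y (n + 1) \<times> y (n + 2)) \<noteq> 0"
proof (induction n)
  case 0 then show ?case using y_init by (simp add: numeral_2_eq_2)
next
  case (Suc n)
  have "y (n + 1) \<bullet> (y (n + 2) \<times> y (n + 3)) = - (y n \<bullet> (y (n + 1) \<times> y (n + 2)))"
    unfolding y_rec
    using cross_triple[of "y n" "y (n + 1)" "y (n + 2)"] cross_triple[of "y (n + 1)" "y (n + 2)" "y n"]
    by (simp add: Cross3.right_diff_distrib cross_mult_right inner_diff_right inner_commute)
  then show ?case using Suc by (simp add: numeral_eq_Suc)
qed

text \<open>The linear form \<open>e \<bullet> _\<close> takes the value 1 on the three initial points; it is a convenient
  replacement for the norm, being positive on the sequence and compatible with its recurrence.\<close>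

definition e :: "real ^ 3" where
  "e = (1 / (y 0 \<bullet> (y 1 \<times> y 2))) *\<^sub>R (y 1 \<times> y 2 + y 2 \<times> y 0 + y 0 \<times> y 1)"

definition t :: "nat \<Rightarrow> real" where "t n = e \<bullet> y n"

lemma t_init: "t 0 = 1" "t 1 = 1" "t 2 = 1"
  using y_init(4) cross_triple[of "y 0" "y 1" "y 2"] cross_triple[of "y 1" "y 2" "y 0"]
  by (simp_all add: t_def e_def inner_add_left inner_add_right dot_cross_self inner_commute)

lemma t_rec: "t (n + 3) = s (n + 2) * t (n + 2) - t n"
  by (simp add: t_def y_rec inner_diff_right)

lemma t_inv: "t n > 0 \<and> t n \<le> t (n + 1) \<and> t (n + 1) \<le> t (n + 2)"
proof (induction n)
  case 0 then show ?case using t_init by (simp add: numeral_2_eq_2)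
next
  case (Suc n)
  have "4 * t (n + 2) \<le> s (n + 2) * t (n + 2)" using Suc s_ge by (intro mult_right_mono) auto
  then have "t (n + 3) \<ge> t (n + 2)" using t_rec[of n] Suc by linarith
  then show ?case using Suc by (simp add: numeral_eq_Suc)
qed

lemma t_pos: "t n > 0" using t_inv by blast

lemma t_mono2: "t n \<le> t (n + 2)" using t_inv[of n] by linarith

lemma t_upper: "t (n + 3) \<le> s (n + 2) * t (n + 2)"
  using t_rec[of n] t_pos[of n] by simp

lemma t_lower: "t (n + 3) \<ge> (s (n + 2) - 1) * t (n + 2)"
  using t_rec[of n] t_mono2[of n] by (simp add: algebra_simps)

lemma t_3: "t (n + 3) \<ge> 3 * t (n + 2)"
  using t_lower[of n] s_ge[of "n + 2"] t_pos[of "n + 2"]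
    mult_right_mono[of 3 "s (n + 2) - 1" "t (n + 2)"] by linarith

lemma t_growth: "t (n + 2) \<ge> 3 ^ n"
proof (induction n)
  case 0 then show ?case using t_init by (simp add: numeral_2_eq_2)
next
  case (Suc n) then show ?case using t_3[of n] by (simp add: numeral_eq_Suc)
qed

lemma t_less: "m < n \<Longrightarrow> t (m + 2) < t (n + 2)"
proof (rule lift_Suc_mono_less[of "\<lambda>n. t (n + 2)"])
  show "t (k + 2) < t (Suc k + 2)" for k
    using t_3[of k] t_pos[of "k + 2"] by (simp add: numeral_eq_Suc)
qed

text \<open>From one index to the next, \<open>s (n + 3)\<close> and \<open>t (n + 2)\<close> are
  both multiplied by a number between \<open>s (n + 2) - 1\<close> and \<open>s (n + 2)\<close>. The
  relative discrepancies are summable, so the quotient stays bounded in both directions.\<close>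

lemma s_le_t: "\<exists>K>0. \<forall>n. s (n + 3) \<le> K * t (n + 2)"
  and t_le_s: "\<exists>K>0. \<forall>n. t (n + 2) \<le> K * s (n + 3)"
proof -
  have s1: "s (n + 2) / (s (n + 2) - 1) \<le> 1 + 1 / 3 ^ n" for n
  proof -
    have "(3::real) ^ n \<le> 3 ^ Suc n" by simp
    also have "\<dots> \<le> s (n + 2) - 1" using s_growth[of "Suc n"] by simp
    finally have g: "s (n + 2) - 1 \<ge> 3 ^ n" .
    have "s (n + 2) / (s (n + 2) - 1) = 1 + 1 / (s (n + 2) - 1)"
      using s_ge[of "n + 2"] by (simp add: field_simps)
    also have "1 / (s (n + 2) - 1) \<le> 1 / 3 ^ n" using g s_ge[of "n + 2"] by (intro divide_left_mono) auto
    finally show ?thesis by simp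
  qed
  have "\<exists>K>0. \<forall>n. s (n + 3) / t (n + 2) \<le> K"
  proof (rule bounded_of_slow_growth[of _ 1])
    fix n
    show "0 \<le> s (n + 3) / t (n + 2)" using s_ge[of "n + 3"] t_pos[of "n + 2"] by simp
    have "s (n + 4) / t (n + 3) \<le> (s (n + 3) * s (n + 2)) / ((s (n + 2) - 1) * t (n + 2))"
    proof (rule frac_le)
      show "s (n + 4) \<le> s (n + 3) * s (n + 2)" using s_rec[of "n + 1"] s_ge[of "n + 1"] by (simp add: numeral_eq_Suc)
      show "0 < (s (n + 2) - 1) * t (n + 2)" using s_ge[of "n + 2"] t_pos[of "n + 2"] by simp
    qed (use t_lower[of n] s_ge[of "n + 3"] s_ge[of "n + 2"] in auto)
    also have "\<dots> = (s (n + 2) / (s (n + 2) - 1)) * (s (n + 3) / t (n + 2))" by simp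
    also have "\<dots> \<le> (1 + 1 / 3 ^ n) * (s (n + 3) / t (n + 2))"
      using s1[of n] s_ge[of "n + 3"] t_pos[of "n + 2"] by (intro mult_right_mono) auto
    finally show "s (Suc n + 3) / t (Suc n + 2) \<le> (1 + 1 / 3 ^ n) * (s (n + 3) / t (n + 2))"
      by (simp add: numeral_eq_Suc)
  qed simp
  then show "\<exists>K>0. \<forall>n. s (n + 3) \<le> K * t (n + 2)" using t_pos by (simp add: divide_le_eq)
  have "\<exists>K>0. \<forall>n. t (n + 2) / s (n + 3) \<le> K"
  proof (rule bounded_of_slow_growth[of _ 1])
    fix n
    show "0 \<le> t (n + 2) / s (n + 3)" using s_ge[of "n + 3"] t_pos[of "n + 2"] by simp
    have "t (n + 3) / s (n + 4) \<le> (s (n + 2) * t (n + 2)) / (s (n + 3) * (s (n + 2) - 1))"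
    proof (rule frac_le)
      show "0 < s (n + 3) * (s (n + 2) - 1)" using s_ge[of "n + 2"] s_ge[of "n + 3"] by simp
      show "s (n + 3) * (s (n + 2) - 1) \<le> s (n + 4)" using s_rec_ge[of "n + 1"] by (simp add: numeral_eq_Suc)
    qed (use t_upper[of n] s_ge[of "n + 2"] t_pos[of "n + 2"] in auto)
    also have "\<dots> = (s (n + 2) / (s (n + 2) - 1)) * (t (n + 2) / s (n + 3))" by simp
    also have "\<dots> \<le> (1 + 1 / 3 ^ n) * (t (n + 2) / s (n + 3))"
      using s1[of n] s_ge[of "n + 3"] t_pos[of "n + 2"] by (intro mult_right_mono) auto
    finally show "t (Suc n + 2) / s (Suc n + 3) \<le> (1 + 1 / 3 ^ n) * (t (n + 2) / s (n + 3))"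
      by (simp add: numeral_eq_Suc)
  qed simp
  then show "\<exists>K>0. \<forall>n. t (n + 2) \<le> K * s (n + 3)"
    using s_ge by (smt (verit, best) divide_le_eq)
qed

definition w :: "nat \<Rightarrow> real ^ 3" where "w n = y n \<times> y (n + 1)"

lemma w_rec: "w (n + 3) = s (n + 2) *\<^sub>R w (n + 1) + w n"
proof -
  have "y (n + 4) = s (n + 3) *\<^sub>R y (n + 3) - y (n + 1)" using y_rec[of "n + 1"] by (simp add: numeral_eq_Suc)
  then have "w (n + 3) = - (y (n + 3) \<times> y (n + 1))"
    by (simp add: w_def numeral_eq_Suc Cross3.right_diff_distrib cross_mult_right)
  also have "\<dots> = y (n + 1) \<times> y (n + 3)" by (metis cross_skew)
  also have "\<dots> = s (n + 2) *\<^sub>R w (n + 1) - y (n + 1) \<times> y n"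
    unfolding y_rec by (simp add: w_def numeral_eq_Suc Cross3.right_diff_distrib cross_mult_right)
  also have "\<dots> = s (n + 2) *\<^sub>R w (n + 1) + w n" using cross_skew[of "y n" "y (n + 1)"] by (simp add: w_def)
  finally show ?thesis .
qed

text \<open>The rule \<open>w_rec\<close> differs from that of \<open>s\<close> only in its
  lower-order term, and \<open>s n\<close> is at most \<open>s (n + 3) / 3 ^ n\<close>. As the rule
  reaches back three steps, the maximum \<open>g\<close> of three consecutive quotients is
  followed.\<close>

lemma w_bound: "\<exists>K>0. \<forall>n. norm (w n) \<le> K * s n"
proof -
  define a where "a n = norm (w n) / s n" for n
  define g where "g n = max (a n) (max (a (n + 1)) (a (n + 2)))" for n
  have a0: "a n \<ge> 0" for n unfolding a_def using s_ge[of n] by simp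
  have wa: "norm (w n) = s n * a n" for n unfolding a_def using s_ge[of n] by simp
  have "\<exists>K>0. \<forall>n. g n \<le> K"
  proof (rule bounded_of_slow_growth[of _ 2])
    fix n
    show g0: "0 \<le> g n" unfolding g_def using a0[of n] by simp
    have "norm (w (n + 3)) \<le> s (n + 2) * norm (w (n + 1)) + norm (w n)"
      unfolding w_rec using norm_triangle_ineq[of "s (n + 2) *\<^sub>R w (n + 1)" "w n"] s_ge[of "n + 2"] by simp
    also have "\<dots> \<le> s (n + 2) * (s (n + 1) * g n) + s n * g n"
      unfolding wa using s_ge[of "n + 2"] s_ge[of "n + 1"] s_ge[of n]
      by (intro add_mono mult_left_mono) (auto simp: g_def)
    also have "\<dots> = (s (n + 2) * s (n + 1) + s n) * g n" by (simp add: algebra_simps)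
    also have "(s (n + 2) * s (n + 1) + s n) * g n = (s (n + 3) + 2 * s n) * g n" using s_rec[of n] by simp
    also have "\<dots> \<le> (s (n + 3) + 2 * (s (n + 3) / 3 ^ n)) * g n"
    proof -
      have "s n * 3 ^ n \<le> s (n + 2) * (s (n + 1) - 1)"
        using s_le[of n] s_growth[of n] s_ge[of "n + 2"] by (intro mult_mono) auto
      also have "\<dots> \<le> s (n + 3)" by (rule s_rec_ge)
      finally have "s n \<le> s (n + 3) / 3 ^ n" by (simp add: field_simps)
      then show ?thesis using g0 by (intro mult_right_mono) auto
    qed
    also have "\<dots> = s (n + 3) * ((1 + 2 / 3 ^ n) * g n)" by (simp add: algebra_simps)
    finally have "a (n + 3) \<le> (1 + 2 / 3 ^ n) * g n"
      unfolding wa using s_ge[of "n + 3"] by (simp add: mult_le_cancel_left)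
    moreover have "g n \<le> (1 + 2 / 3 ^ n) * g n" using g0 by (simp add: algebra_simps)
    ultimately show "g (Suc n) \<le> (1 + 2 / 3 ^ n) * g n"
      unfolding g_def[of "Suc n"] by (auto simp: numeral_eq_Suc g_def)
  qed simp
  then obtain K where K: "K > 0" "\<And>n. g n \<le> K" by blast
  have "norm (w n) \<le> K * s n" for n
  proof -
    have "a n \<le> K" using K(2)[of n] by (auto simp: g_def)
    then show ?thesis unfolding wa using s_ge[of n] by (simp add: mult.commute)
  qed
  then show ?thesis using K(1) by blast
qed

text \<open>By Lagrange's identity, consecutive vectors scaled to \<open>e\<close>-value 1 differ by
  \<open>e \<times> w (n + 2)\<close> divided by \<open>t (n + 2) * t (n + 3)\<close>. As
  \<open>w (n + 2)\<close> is of order \<open>s (n + 2)\<close> and \<open>t (n + 3)\<close> of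
  order \<open>s (n + 2) * t (n + 2)\<close>, this is of order
  \<open>1 / (t (n + 2))\<^sup>2\<close>.\<close>

lemma limit_direction:
  obtains \<Xi> K where "K > 0" "\<And>n. norm (y (n + 2) - t (n + 2) *\<^sub>R \<Xi>) \<le> K / t (n + 2)"
    "(\<lambda>n. (1 / t (n + 2)) *\<^sub>R y (n + 2)) \<longlonglongrightarrow> \<Xi>"
proof -
  obtain K where K: "K > 0" "\<And>n. norm (w n) \<le> K * s n" using w_bound by blast
  let ?z = "\<lambda>n. (1 / t (n + 2)) *\<^sub>R y (n + 2)"
  define D where "D = 2 * K * (norm e + 1)"
  have D: "D > 0" unfolding D_def using K(1) by (simp add: add_nonneg_pos)
  have "norm (?z (Suc n) - ?z n) \<le> D / (t (n + 2))\<^sup>2" for n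
  proof -
    let ?t = "t (n + 2)" and ?t' = "t (n + 3)"
    have "e \<times> w (n + 2) = ?t' *\<^sub>R y (n + 2) - ?t *\<^sub>R y (n + 3)"
      by (simp add: w_def Lagrange t_def numeral_eq_Suc)
    then have "(- 1 / (?t * ?t')) *\<^sub>R (e \<times> w (n + 2)) = (1 / ?t') *\<^sub>R y (n + 3) - (1 / ?t) *\<^sub>R y (n + 2)"
      using t_pos[of "n + 2"] t_pos[of "n + 3"] by (simp add: scaleR_right_diff_distrib)
    then have eq: "?z (Suc n) - ?z n = (- 1 / (?t * ?t')) *\<^sub>R (e \<times> w (n + 2))"
      by (simp add: numeral_eq_Suc)
    have "norm (?z (Suc n) - ?z n) = norm (e \<times> w (n + 2)) / (?t * ?t')"
      unfolding eq using t_pos[of "n + 2"] t_pos[of "n + 3"] by simp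
    also have "\<dots> \<le> (D / 2 * s (n + 2)) / (?t * (s (n + 2) / 2 * ?t))"
    proof (rule frac_le)
      have "norm (e \<times> w (n + 2)) \<le> norm e * (K * s (n + 2))"
        using norm_cross_le[of e "w (n + 2)"] mult_left_mono[OF K(2)[of "n + 2"], of "norm e"] by simp
      also have "\<dots> \<le> D / 2 * s (n + 2)"
        unfolding D_def using K(1) s_ge[of "n + 2"] by (simp add: algebra_simps)
      finally show "norm (e \<times> w (n + 2)) \<le> D / 2 * s (n + 2)" .
      have "s (n + 2) / 2 * ?t \<le> (s (n + 2) - 1) * ?t"
        using s_ge[of "n + 2"] t_pos[of "n + 2"] by (intro mult_right_mono) auto
      then have "s (n + 2) / 2 * ?t \<le> ?t'" using t_lower[of n] by linarith
      then show "?t * (s (n + 2) / 2 * ?t) \<le> ?t * ?t'"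
        using t_pos[of "n + 2"] by (intro mult_left_mono) auto
      show "0 < ?t * (s (n + 2) / 2 * ?t)" using s_ge[of "n + 2"] t_pos[of "n + 2"] by simp
    qed (use D s_ge[of "n + 2"] in auto)
    also have "\<dots> = D / ?t\<^sup>2" using s_ge[of "n + 2"] t_pos[of "n + 2"] by (simp add: field_simps power2_eq_square)
    finally show ?thesis .
  qed
  moreover have "D / (t (Suc n + 2))\<^sup>2 \<le> D / (t (n + 2))\<^sup>2 / 2" for n
  proof -
    have "(2 * t (n + 2))\<^sup>2 \<le> (t (n + 3))\<^sup>2" using t_3[of n] t_pos[of "n + 2"] by (intro power_mono) auto
    then have "2 * (t (n + 2))\<^sup>2 \<le> (t (n + 3))\<^sup>2" by (simp add: power2_eq_square) (smt (verit) zero_le_square)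
    then have "D / (t (n + 3))\<^sup>2 \<le> D / (2 * (t (n + 2))\<^sup>2)"
      using D t_pos[of "n + 2"] t_pos[of "n + 3"] by (intro divide_left_mono) auto
    then show ?thesis by (simp add: numeral_eq_Suc)
  qed
  ultimately obtain \<Xi> where \<Xi>: "?z \<longlonglongrightarrow> \<Xi>" "\<And>n. norm (?z n - \<Xi>) \<le> 2 * (D / (t (n + 2))\<^sup>2)"
    using geometric_limit[of ?z "\<lambda>n. D / (t (n + 2))\<^sup>2"] by blast
  have "norm (y (n + 2) - t (n + 2) *\<^sub>R \<Xi>) \<le> 2 * D / t (n + 2)" for n
  proof -
    have "y (n + 2) - t (n + 2) *\<^sub>R \<Xi> = t (n + 2) *\<^sub>R (?z n - \<Xi>)"
      using t_pos[of "n + 2"] by (simp add: scaleR_right_diff_distrib)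
    then have "norm (y (n + 2) - t (n + 2) *\<^sub>R \<Xi>) = t (n + 2) * norm (?z n - \<Xi>)"
      using t_pos[of "n + 2"] by simp
    also have "\<dots> \<le> t (n + 2) * (2 * (D / (t (n + 2))\<^sup>2))"
      using \<Xi>(2) t_pos[of "n + 2"] by (intro mult_left_mono) auto
    finally show ?thesis using t_pos[of "n + 2"] by (simp add: power2_eq_square field_simps)
  qed
  then show thesis using that[of "2 * D" \<Xi>] D \<Xi>(1) by simp
qed

text \<open>The logarithms \<open>T\<close> obey the Fibonacci rule up to a bounded error. In
  \<open>T (n + 1) - golden_ratio * T n\<close> the growing solution is removed; what is left is
  multiplied at each step by \<open>- 1 / golden_ratio\<close>, the other root of
  \<open>X\<^sup>2 = X + 1\<close>, plus a bounded error.\<close>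

lemma golden_growth:
  obtains B where "\<And>n. \<bar>ln (t (n + 3)) - golden_ratio * ln (t (n + 2))\<bar> \<le> B" "B \<ge> 0"
proof -
  obtain K where K: "K > 0" "\<And>n. s (n + 3) \<le> K * t (n + 2)" using s_le_t by blast
  obtain K' where K': "K' > 0" "\<And>n. t (n + 2) \<le> K' * s (n + 3)" using t_le_s by blast
  define T where "T n = ln (t (n + 2))" for n
  define c where "c = \<bar>ln K\<bar> + \<bar>ln (2 * K')\<bar>"
  have c: "\<bar>T (n + 2) - T (n + 1) - T n\<bar> \<le> c" for n
  proof -
    have pos: "t (n + 2) > 0" "t (n + 3) > 0" "t (n + 4) > 0" "s (n + 3) > 0"
      using t_pos s_ge[of "n + 3"] by auto
    have "t (n + 4) \<le> s (n + 3) * t (n + 3)" using t_upper[of "n + 1"] by (simp add: numeral_eq_Suc)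
    also have "\<dots> \<le> (K * t (n + 2)) * t (n + 3)" using K(2)[of n] pos by (intro mult_right_mono) auto
    finally have "ln (t (n + 4)) \<le> ln ((K * t (n + 2)) * t (n + 3))" using pos K(1) by simp
    then have 1: "T (n + 2) \<le> ln K + T n + T (n + 1)"
      using pos K(1) by (simp add: T_def ln_mult numeral_eq_Suc)
    have "t (n + 2) * t (n + 3) \<le> (K' * s (n + 3)) * t (n + 3)" using K'(2)[of n] pos by (intro mult_right_mono) auto
    also have "\<dots> \<le> K' * (2 * (s (n + 3) - 1)) * t (n + 3)"
      using s_ge[of "n + 3"] K'(1) pos by (intro mult_right_mono mult_left_mono) auto
    also have "\<dots> = 2 * K' * ((s (n + 3) - 1) * t (n + 3))" by simp
    also have "\<dots> \<le> 2 * K' * t (n + 4)"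
      using t_lower[of "n + 1"] K'(1) by (intro mult_left_mono) (auto simp: numeral_eq_Suc)
    finally have "ln (t (n + 2) * t (n + 3)) \<le> ln (2 * K' * t (n + 4))" using pos K'(1) by simp
    then have 2: "T n + T (n + 1) \<le> ln (2 * K') + T (n + 2)"
      using pos K'(1) by (simp add: T_def ln_mult numeral_eq_Suc)
    show ?thesis using 1 2 unfolding c_def by linarith
  qed
  let ?g = golden_ratio
  have sq: "sqrt 5 * sqrt 5 = (5::real)" by simp
  have g: "?g * ?g = ?g + 1" using sq by (simp add: golden_ratio_def field_simps)
  have g1: "?g > 1" by (simp add: golden_ratio_def)
  define P where "P n = T (n + 1) - ?g * T n" for n
  \<comment> \<open>The second summand is the fixed point of the bound
    \<open>B \<mapsto> c + B / golden_ratio\<close>.\<close>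
  define B where "B = \<bar>P 0\<bar> + c * ?g / (?g - 1)"
  have "c \<ge> 0" by (simp add: c_def)
  then have cB: "c \<le> B * (1 - 1 / ?g)" "B \<ge> 0"
  proof -
    have "c = (c * ?g / (?g - 1)) * (1 - 1 / ?g)" using g1 by (simp add: field_simps)
    also have "\<dots> \<le> B * (1 - 1 / ?g)" unfolding B_def using g1 by (intro mult_right_mono) auto
    finally show "c \<le> B * (1 - 1 / ?g)" .
    show "B \<ge> 0" unfolding B_def using g1 \<open>c \<ge> 0\<close> by simp
  qed
  have "\<bar>P n\<bar> \<le> B" for n
  proof (induction n)
    case 0
    show ?case unfolding B_def using g1 \<open>c \<ge> 0\<close> by simp
  next
    case (Suc n)
    have "?g = 1 + 1 / ?g" using g g1 by (simp add: field_simps)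
    then have "?g * T (n + 1) = (1 + 1 / ?g) * T (n + 1)" by (rule arg_cong)
    moreover have "(1 / ?g) * P n = (1 / ?g) * T (n + 1) - T n"
      using g1 by (simp add: P_def right_diff_distrib)
    ultimately have "P (Suc n) = (T (n + 2) - T (n + 1) - T n) - (1 / ?g) * P n"
      unfolding P_def[of "Suc n"] by (simp add: distrib_right)
    then have "\<bar>P (Suc n)\<bar> \<le> c + (1 / ?g) * \<bar>P n\<bar>"
      using c[of n] g1 abs_triangle_ineq4[of "T (n + 2) - T (n + 1) - T n" "(1 / ?g) * P n"] by (simp add: abs_mult)
    also have "\<dots> \<le> c + (1 / ?g) * B" using Suc g1 by (intro add_left_mono mult_left_mono) auto
    also have "\<dots> \<le> B" using cB(1) by (simp add: algebra_simps)
    finally show ?case .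
  qed
  then show thesis using that[of B] cB(2) unfolding P_def T_def by (simp add: numeral_eq_Suc)
qed

text \<open>For \<open>t (m + 2) \<le> X < t (m + 3)\<close> the vector \<open>y (m + 2)\<close>
  serves: its distance to the line is of order \<open>1 / t (m + 2)\<close>, and by
  \<open>golden_growth\<close> \<open>X\<close> is at most a constant times
  \<open>t (m + 2) powr golden_ratio\<close>.\<close>

lemma limit_uniform_approx:
  assumes K: "K > 0" "\<And>n. norm (y (n + 2) - t (n + 2) *\<^sub>R \<Xi>) \<le> K / t (n + 2)"
  shows "uniform_approx \<Xi> (1 / golden_ratio)"
proof -
  obtain B where B: "\<And>n. \<bar>ln (t (n + 3)) - golden_ratio * ln (t (n + 2))\<bar> \<le> B" "B \<ge> 0"
    using golden_growth by blast
  have g1: "golden_ratio > 1" by (simp add: golden_ratio_def)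
  define c where "c = (norm \<Xi> + 1) * (K + 1) * exp B"
  have eB: "exp B \<ge> 1" using B(2) by simp
  have c: "K + norm \<Xi> \<le> c" "norm \<Xi> * K * exp B \<le> c" "c > 0"
  proof -
    have "K + norm \<Xi> \<le> (norm \<Xi> + 1) * (K + 1) * 1" using K(1) by (simp add: algebra_simps)
    also have "\<dots> \<le> c" unfolding c_def using eB K(1) by (intro mult_left_mono) auto
    finally show "K + norm \<Xi> \<le> c" .
    show "norm \<Xi> * K * exp B \<le> c" unfolding c_def using K(1) by (intro mult_mono) auto
    show "c > 0" unfolding c_def using K(1) by (simp add: add_nonneg_pos)
  qed
  have "\<exists>x\<in>Z3. x \<noteq> 0 \<and> norm x \<le> c * X \<and> norm (x \<times> \<Xi>) \<le> c * X powr - (1 / golden_ratio)" if X: "X \<ge> 1" for X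
  proof -
    have "\<exists>n. X < t (n + 2)"
    proof -
      obtain n where "X < 3 ^ n" using real_arch_pow[of 3 X] by auto
      then show ?thesis using t_growth[of n] by (intro exI[of _ n]) linarith
    qed
    define n where "n = (LEAST n. X < t (n + 2))"
    have n: "X < t (n + 2)" unfolding n_def using \<open>\<exists>n. X < t (n + 2)\<close> by (rule LeastI_ex)
    then have "n \<noteq> 0" using t_init X by (cases n) (auto simp: numeral_2_eq_2)
    then obtain m where m: "n = Suc m" by (cases n) auto
    have mX: "t (m + 2) \<le> X" using not_less_Least[of m "\<lambda>n. X < t (n + 2)"] m n_def by auto
    have Xm: "X < t (m + 3)" using n m by (simp add: numeral_eq_Suc)
    let ?t = "t (m + 2)"
    have t1: "?t \<ge> 1" using t_growth[of m] one_le_power[of "3::real" m] by linarith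
    show ?thesis
    proof (intro bexI[of _ "y (m + 2)"] conjI)
      show "y (m + 2) \<in> Z3" by (rule y_Int)
      show "y (m + 2) \<noteq> 0" using t_pos[of "m + 2"] by (auto simp: t_def)
      have "norm (y (m + 2)) \<le> norm (y (m + 2) - ?t *\<^sub>R \<Xi>) + norm (?t *\<^sub>R \<Xi>)"
        using norm_triangle_ineq[of "y (m + 2) - ?t *\<^sub>R \<Xi>" "?t *\<^sub>R \<Xi>"] by simp
      also have "\<dots> \<le> K / ?t + ?t * norm \<Xi>" using K(2)[of m] t1 by simp
      also have "\<dots> \<le> K * ?t + ?t * norm \<Xi>"
      proof -
        have "K * 1 \<le> K * (?t * ?t)" using K(1) t1 mult_mono[OF t1 t1] by (intro mult_left_mono) auto
        then show ?thesis using t1 by (simp add: divide_le_eq mult.assoc)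
      qed
      also have "\<dots> = (K + norm \<Xi>) * ?t" by (simp add: algebra_simps)
      also have "\<dots> \<le> c * X" using c mX t1 K(1) by (intro mult_mono) auto
      finally show "norm (y (m + 2)) \<le> c * X" .
      have "y (m + 2) \<times> \<Xi> = (y (m + 2) - ?t *\<^sub>R \<Xi>) \<times> \<Xi>"
        by (simp add: Cross3.left_diff_distrib cross_mult_left)
      then have "norm (y (m + 2) \<times> \<Xi>) \<le> K / ?t * norm \<Xi>"
        using norm_cross_le[of "y (m + 2) - ?t *\<^sub>R \<Xi>" \<Xi>] mult_right_mono[OF K(2)[of m], of "norm \<Xi>"] by simp
      also have "1 / ?t \<le> exp B * X powr - (1 / golden_ratio)"
      proof -
        have "ln X \<le> ln (t (m + 3))" using Xm X by simp
        also have "\<dots> \<le> golden_ratio * ln ?t + B" using B(1)[of m] by linarith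
        also have "\<dots> \<le> golden_ratio * (ln ?t + B)"
          using mult_right_mono[of 1 golden_ratio B] g1 B(2) by (simp add: algebra_simps)
        finally have "ln X / golden_ratio \<le> ln ?t + B" using g1 by (simp add: divide_le_eq mult.commute)
        then have "- ln ?t \<le> B + - (1 / golden_ratio) * ln X" by simp
        then have "exp (- ln ?t) \<le> exp (B + - (1 / golden_ratio) * ln X)" by simp
        then show ?thesis
          using t1 X by (simp add: exp_minus exp_add exp_diff powr_def inverse_eq_divide)
      qed
      then have "K / ?t * norm \<Xi> \<le> (norm \<Xi> * K * exp B) * X powr - (1 / golden_ratio)"
        using mult_left_mono[of "1 / ?t" "exp B * X powr - (1 / golden_ratio)" "norm \<Xi> * K"] K(1)
        by (simp add: mult_ac)
      also have "\<dots> \<le> c * X powr - (1 / golden_ratio)" using c(2) by (intro mult_right_mono) auto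
      finally show "norm (y (m + 2) \<times> \<Xi>) \<le> c * X powr - (1 / golden_ratio)" .
    qed
  qed
  then show ?thesis unfolding uniform_approx_def using c(3) by blast
qed

text \<open>If \<open>v\<close> annihilates \<open>\<Xi>\<close>, the integers
  \<open>v \<bullet> y (n + 2)\<close> tend to 0, hence are eventually 0. Three consecutive
  \<open>y\<close> span the space.\<close>

lemma limit_lin_indep:
  assumes K: "K > 0" "\<And>n. norm (y (n + 2) - t (n + 2) *\<^sub>R \<Xi>) \<le> K / t (n + 2)"
  shows "lin_indep \<Xi>"
  unfolding lin_indep_def
proof (intro ballI impI)
  fix v assume v: "v \<in> Z3" "v \<bullet> \<Xi> = 0"
  obtain n0 where n0: "norm v * K < 3 ^ n0" using real_arch_pow[of 3] by auto
  have orth: "v \<bullet> y (n + 2) = 0" if "n \<ge> n0" for n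
  proof -
    have "v \<bullet> y (n + 2) = v \<bullet> (y (n + 2) - t (n + 2) *\<^sub>R \<Xi>)"
      using v by (simp add: inner_diff_right)
    then have "\<bar>v \<bullet> y (n + 2)\<bar> \<le> norm v * (K / t (n + 2))"
      using Cauchy_Schwarz_ineq2[of v "y (n + 2) - t (n + 2) *\<^sub>R \<Xi>"] mult_left_mono[OF K(2)[of n], of "norm v"] by simp
    also have "\<dots> < 1"
    proof -
      have "(3::real) ^ n0 \<le> 3 ^ n" using that by (intro power_increasing) auto
      then have "norm v * K < t (n + 2)" using n0 t_growth[of n] by linarith
      then show ?thesis using t_pos[of "n + 2"] by simp
    qed
    finally show ?thesis using Ints_nonzero_abs_ge1[of "v \<bullet> y (n + 2)"] Z3_inner[OF v(1) y_Int] by fastforce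
  qed
  let ?a = "y (n0 + 2)" and ?b = "y (n0 + 3)" and ?c = "y (n0 + 4)"
  have "v \<bullet> ?a = 0" "v \<bullet> ?b = 0" "v \<bullet> ?c = 0"
    using orth[of n0] orth[of "n0 + 1"] orth[of "n0 + 2"] by (simp_all add: numeral_eq_Suc)
  then have "v \<bullet> ((?a \<bullet> (?b \<times> ?c)) *\<^sub>R v) = 0"
    unfolding triple_expand[of ?a ?b ?c v] by (simp add: inner_add_right)
  moreover have "?a \<bullet> (?b \<times> ?c) \<noteq> 0" using y_det[of "n0 + 2"] by (simp add: numeral_eq_Suc)
  ultimately show "v = 0" by simp
qed

end

section \<open>Points of exponent 1/golden_ratio from a seed, and their reflections\<close>

context int_form
begin

definition grad :: "real ^ 3 \<Rightarrow> real ^ 3" where "grad x = (\<chi> i. b x (axis i 1))"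

lemma grad_Z3: "x \<in> Z3 \<Longrightarrow> grad x \<in> Z3"
  using int[OF _ Z3_axis] by (simp add: grad_def Z3_def)

lemma b_grad: "b x y = grad x \<bullet> y"
proof -
  have "b x y = b x (\<Sum>i\<in>UNIV. y $ i *\<^sub>R axis i 1)" by (simp add: basis_expansion[of y, unfolded scalar_mult_eq_scaleR])
  also have "\<dots> = (\<Sum>i\<in>UNIV. y $ i * b x (axis i 1))" by (simp add: b.sum_right b.scaleR_right)
  finally show ?thesis by (simp add: grad_def inner_vec_def mult.commute)
qed

text \<open>An integer functional on \<open>refl x \<Xi>\<close> is the integer functional
  \<open>?u\<close> on \<open>\<Xi>\<close>, obtained with the transpose of the reflection. From
  \<open>?u = 0\<close>, evaluation at \<open>x\<close> gives \<open>v \<bullet> x = 0\<close> and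
  then \<open>v = 0\<close>.\<close>

lemma lin_indep_refl:
  assumes li: "lin_indep \<Xi>" and x: "x \<in> Z3" "b x x \<noteq> 0"
  shows "lin_indep (refl x \<Xi>)"
  unfolding lin_indep_def
proof (intro ballI impI)
  fix v assume v: "v \<in> Z3" "v \<bullet> refl x \<Xi> = 0"
  let ?u = "(2 * (v \<bullet> x)) *\<^sub>R grad x - b x x *\<^sub>R v"
  have "?u \<bullet> \<Xi> = 0"
    using v(2) by (simp add: refl_def b_grad inner_diff_left inner_diff_right algebra_simps)
  moreover have "?u \<in> Z3"
    using v x by (intro Z3_diff Z3_scale grad_Z3 Ints_mult Z3_inner int) auto
  ultimately have u: "?u = 0" using li by (auto simp: lin_indep_def)
  then have "?u \<bullet> x = 0" by simp
  then have "v \<bullet> x = 0" using x(2) by (simp add: inner_diff_left b_grad[symmetric])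
  then show "v = 0" using u x(2) by simp
qed

text \<open>Pairing with \<open>x \<times> x'\<close> shows that the proportionality factor is the
  quotient of the values of the form. The multiples of \<open>\<Xi>\<close> then cancel, and the
  independence of \<open>x\<close> and \<open>x'\<close> forces \<open>b x' \<Xi> = 0\<close>, a
  rational relation between the coordinates of \<open>\<Xi>\<close>.\<close>

lemma refl_not_parallel:
  assumes li: "lin_indep \<Xi>" and x: "x \<in> Z3" "b x x \<noteq> 0" and x': "x' \<in> Z3" "b x' x' \<noteq> 0"
    and ind: "x \<times> x' \<noteq> 0"
  shows "refl x \<Xi> \<times> refl x' \<Xi> \<noteq> 0"
proof
  assume "refl x \<Xi> \<times> refl x' \<Xi> = 0"
  then obtain c where c: "refl x' \<Xi> = c *\<^sub>R refl x \<Xi>"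
    using cross_eq_0_scaleR lin_indep_nonzero[OF lin_indep_refl[OF li x]] by metis
  let ?n = "x \<times> x'"
  have n: "?n \<bullet> \<Xi> \<noteq> 0" using li ind x x' Z3_cross by (auto simp: lin_indep_def)
  have "?n \<bullet> refl x' \<Xi> = c * (?n \<bullet> refl x \<Xi>)" by (simp add: c)
  then have q: "b x' x' = c * b x x"
    using n by (simp add: refl_def inner_diff_right dot_cross_self)
  have "(2 * b x' \<Xi>) *\<^sub>R x' = (c * (2 * b x \<Xi>)) *\<^sub>R x"
    using c unfolding refl_def q by (simp add: algebra_simps)
  then have "x \<times> ((2 * b x' \<Xi>) *\<^sub>R x') = 0" by (simp add: cross_mult_right)
  then have "grad x' \<bullet> \<Xi> = 0" using ind by (simp add: cross_mult_right b_grad)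
  then have "grad x' = 0" using li grad_Z3[OF x'(1)] by (auto simp: lin_indep_def)
  then show False using x'(2) by (simp add: b_grad)
qed

text \<open>Initial data for the recurrence; the numbers \<open>s\<^sub>i\<close> are the normalised values of the polar form.\<close>

definition seed :: "real ^ 3 \<Rightarrow> real ^ 3 \<Rightarrow> real ^ 3 \<Rightarrow> bool" where
  "seed y0 y1 y2 \<longleftrightarrow> y0 \<in> Z3 \<and> y1 \<in> Z3 \<and> y2 \<in> Z3 \<and> y0 \<bullet> (y1 \<times> y2) \<noteq> 0 \<and>
     (\<exists>a s0 s1 s2. a \<noteq> 0 \<and> b y0 y0 = a \<and> b y1 y1 = a \<and> b y2 y2 = a \<and>
        2 * b y1 y0 = a * s0 \<and> 2 * b y2 y1 = a * s1 \<and> 2 * b y2 y0 = a * s2 \<and>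
        s0 \<in> \<int> \<and> s1 \<in> \<int> \<and> s2 \<in> \<int> \<and> 4 \<le> s0 \<and> 4 \<le> s1 \<and> s0 \<le> s2 \<and> s1 \<le> s2)"

text \<open>The form has the constant value \<open>a\<close> along the sequence while
  \<open>t\<close> tends to infinity, so the limit direction is isotropic.\<close>

lemma extremal_points_exist:
  assumes "seed y0 y1 y2"
  obtains \<Xi> where "\<And>n :: nat. lin_indep (\<Xi> n)" "\<And>n. b (\<Xi> n) (\<Xi> n) = 0"
    "\<And>n. uniform_approx (\<Xi> n) (1 / golden_ratio)" "\<And>m n. m \<noteq> n \<Longrightarrow> \<Xi> m \<times> \<Xi> n \<noteq> 0"
proof -
  obtain a s0 s1 s2 where a: "a \<noteq> 0" "b y0 y0 = a" "b y1 y1 = a" "b y2 y2 = a"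
        "2 * b y1 y0 = a * s0" "2 * b y2 y1 = a * s1" "2 * b y2 y0 = a * s2"
      and s: "s0 \<in> \<int>" "s1 \<in> \<int>" "s2 \<in> \<int>" "4 \<le> s0" "4 \<le> s1" "s0 \<le> s2" "s1 \<le> s2"
      and y: "y0 \<in> Z3" "y1 \<in> Z3" "y2 \<in> Z3" "y0 \<bullet> (y1 \<times> y2) \<noteq> 0"
    using assms unfolding seed_def by blast
  define F where "F = rec_nat (s0, s1, s2) (\<lambda>_ (p, q, r). (q, r, r * q - p))"
  define s where "s n = fst (F n)" for n
  define G where "G = rec_nat (y0, y1, y2) (\<lambda>n (p, q, r). (q, r, s (n + 2) *\<^sub>R r - p))"
  define y where "y n = fst (G n)" for n
  have F: "F n = (s n, s (n + 1), s (n + 2))" for n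
    by (induction n) (auto simp: s_def F_def split: prod.splits)
  have s_rec: "s (n + 3) = s (n + 2) * s (n + 1) - s n" for n
  proof -
    have "F (Suc n) = (s (n + 1), s (n + 2), s (n + 2) * s (n + 1) - s n)"
      using F[of n] by (simp add: F_def)
    then show ?thesis using F[of "Suc n"] by (simp add: numeral_eq_Suc)
  qed
  have G: "G n = (y n, y (n + 1), y (n + 2))" for n
    by (induction n) (auto simp: y_def G_def split: prod.splits)
  have y_rec: "y (n + 3) = s (n + 2) *\<^sub>R y (n + 2) - y n" for n
  proof -
    have "G (Suc n) = (y (n + 1), y (n + 2), s (n + 2) *\<^sub>R y (n + 2) - y n)"
      using G[of n] by (simp add: G_def)
    then show ?thesis using G[of "Suc n"] by (simp add: numeral_eq_Suc)
  qed
  have s012: "s 0 = s0" "s 1 = s1" "s 2 = s2" using F[of 0] by (simp_all add: F_def numeral_2_eq_2)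
  have y012: "y 0 = y0" "y 1 = y1" "y 2 = y2" using G[of 0] by (simp_all add: G_def numeral_2_eq_2)
  interpret fibonacci_points y s
    using y_rec s_rec s y by unfold_locales (simp_all only: s012 y012 simp_thms)
  \<comment> \<open>The indices of \<open>s\<close> are explained here: \<open>s n\<close> belongs
    to the pair \<open>y (n + 1)\<close>, \<open>y n\<close>, and \<open>s (n + 2)\<close> also to
    the pair \<open>y (n + 2)\<close>, \<open>y n\<close>. The rule for \<open>s\<close> expresses
    that these two descriptions agree.\<close>
  have inv: "b (y n) (y n) = a \<and> b (y (n + 1)) (y (n + 1)) = a \<and> b (y (n + 2)) (y (n + 2)) = a \<and>
      2 * b (y (n + 1)) (y n) = a * s n \<and> 2 * b (y (n + 2)) (y (n + 1)) = a * s (n + 1) \<and>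
      2 * b (y (n + 2)) (y n) = a * s (n + 2)" for n
  proof (induction n)
    case 0
    show ?case using a s012 y012 by (simp add: numeral_2_eq_2)
  next
    case (Suc n)
    let ?p = "y n" and ?q = "y (n + 1)" and ?r = "y (n + 2)" and ?c = "s (n + 2)"
    have IH: "b ?p ?p = a" "b ?q ?q = a" "b ?r ?r = a" "2 * b ?q ?p = a * s n"
      "2 * b ?r ?q = a * s (n + 1)" "2 * b ?r ?p = a * ?c" using Suc by blast+
    have expand: "b (c *\<^sub>R r - p) (c *\<^sub>R r - p) = c * (c * b r r) - c * (2 * b r p) + b p p"
      "2 * b (c *\<^sub>R r - p) r = 2 * (c * b r r) - 2 * b r p"
      "2 * b (c *\<^sub>R r - p) q = c * (2 * b r q) - 2 * b q p" for c p q r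
      by (simp_all add: b_simps sym[of p r] sym[of p q] algebra_simps)
    have "b (?c *\<^sub>R ?r - ?p) (?c *\<^sub>R ?r - ?p) = ?c * (?c * b ?r ?r) - ?c * (2 * b ?r ?p) + b ?p ?p"
      by (rule expand)
    also have "\<dots> = a" unfolding IH by simp
    finally have 1: "b (y (n + 3)) (y (n + 3)) = a" unfolding y_rec .
    have "2 * b (?c *\<^sub>R ?r - ?p) ?r = 2 * (?c * b ?r ?r) - 2 * b ?r ?p"
      by (rule expand)
    also have "\<dots> = a * ?c" unfolding IH by simp
    finally have 2: "2 * b (y (n + 3)) (y (n + 2)) = a * s (n + 2)" unfolding y_rec .
    have "2 * b (?c *\<^sub>R ?r - ?p) ?q = ?c * (2 * b ?r ?q) - 2 * b ?q ?p"
      by (rule expand)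
    also have "\<dots> = a * s (n + 3)" unfolding IH s_rec by (simp add: algebra_simps)
    finally have 3: "2 * b (y (n + 3)) (y (n + 1)) = a * s (n + 3)" unfolding y_rec .
    show ?case using IH 1 2 3 by (simp add: numeral_eq_Suc)
  qed
  then have q: "b (y n) (y n) = a" for n by blast
  obtain \<Xi> K where K: "K > 0" "\<And>n. norm (y (n + 2) - t (n + 2) *\<^sub>R \<Xi>) \<le> K / t (n + 2)"
    and lim: "(\<lambda>n. (1 / t (n + 2)) *\<^sub>R y (n + 2)) \<longlonglongrightarrow> \<Xi>"
    using limit_direction by blast
  have li: "lin_indep \<Xi>" by (rule limit_lin_indep[OF K])
  let ?q = "\<lambda>n. b ((1 / t (n + 2)) *\<^sub>R y (n + 2)) ((1 / t (n + 2)) *\<^sub>R y (n + 2))"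
  have "(\<lambda>n. ?q n) \<longlonglongrightarrow> b \<Xi> \<Xi>"
    by (intro b.tendsto lim)
  moreover have "(\<lambda>n. ?q n) \<longlonglongrightarrow> 0"
  proof (rule Lim_null_comparison)
    show "\<forall>\<^sub>F n in sequentially. norm (?q n) \<le> \<bar>a\<bar> * (1 / 3) ^ n"
    proof (intro always_eventually allI)
      fix n
      have "norm (?q n) = \<bar>a\<bar> * (1 / t (n + 2) * (1 / t (n + 2)))"
        using t_pos[of "n + 2"] unfolding b_simps q by (simp add: abs_mult)
      also have "\<dots> \<le> \<bar>a\<bar> * ((1 / 3 ^ n) * 1)"
      proof (intro mult_left_mono mult_mono)
        show "1 / t (n + 2) \<le> 1 / 3 ^ n" using t_growth[of n] by (intro divide_left_mono) (auto simp: t_pos)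
        show "1 / t (n + 2) \<le> 1"
          using order_trans[OF one_le_power[of "3::real" n] t_growth[of n]] by (simp add: divide_le_eq_1)
      qed (use t_pos[of "n + 2"] in auto)
      finally show "norm (?q n) \<le> \<bar>a\<bar> * (1 / 3) ^ n"
        by (simp add: power_one_over)
    qed
    show "(\<lambda>n. \<bar>a\<bar> * (1 / 3) ^ n) \<longlonglongrightarrow> 0"
      by (intro tendsto_mult_right_zero LIMSEQ_power_zero) simp
  qed
  ultimately have zero: "b \<Xi> \<Xi> = 0" by (rule LIMSEQ_unique)
  have "uniform_approx \<Xi> (1 / golden_ratio)" by (rule limit_uniform_approx[OF K])
  define u where "u = (1 / norm \<Xi>) *\<^sub>R \<Xi>"
  have nz: "\<Xi> \<noteq> 0" by (rule lin_indep_nonzero[OF li])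
  have u: "norm u = 1" "lin_indep u" "b u u = 0" "uniform_approx u (1 / golden_ratio)"
    unfolding u_def using nz zero lin_indep_scaleR[OF li] uniform_approx_scaleR \<open>uniform_approx \<Xi> _\<close>
    by (auto simp: b_simps)
  show thesis
  \<comment> \<open>Each reflection in a \<open>y (n + 2)\<close> is an injective integral linear
    map that preserves the zeros of the form, so it keeps the exponent.\<close>
  proof (rule that[of "\<lambda>n. refl (y (n + 2)) u"])
    fix n
    have qn: "b (y (n + 2)) (y (n + 2)) \<noteq> 0" using q a(1) by simp
    show "lin_indep (refl (y (n + 2)) u)" by (rule lin_indep_refl[OF u(2) y_Int qn])
    show "b (refl (y (n + 2)) u) (refl (y (n + 2)) u) = 0" by (simp add: b_refl u(3))
    show "uniform_approx (refl (y (n + 2)) u) (1 / golden_ratio)"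
    proof (rule uniform_approx_linear[OF u(4) u(1) linear_refl])
      fix v assume "refl (y (n + 2)) v = 0"
      then have "(b (y (n + 2)) (y (n + 2)))\<^sup>2 *\<^sub>R v = 0"
        by (metis refl_refl linear_0[OF linear_refl])
      then show "v = 0" using qn by simp
    qed (use refl_Z3 y_Int in blast)
  next
    fix m n :: nat assume mn: "m \<noteq> n"
    show "refl (y (m + 2)) u \<times> refl (y (n + 2)) u \<noteq> 0"
    proof (rule refl_not_parallel[OF u(2)])
      show "y (m + 2) \<times> y (n + 2) \<noteq> 0"
      proof
        assume "y (m + 2) \<times> y (n + 2) = 0"
        moreover have "y (m + 2) \<noteq> 0" using t_pos[of "m + 2"] by (auto simp: t_def)
        ultimately obtain r where r: "y (n + 2) = r *\<^sub>R y (m + 2)" using cross_eq_0_scaleR by blast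
        \<comment> \<open>Proportional vectors with the same nonzero value of the form agree up to
          sign; the positive and strictly increasing \<open>t\<close> excludes both signs.\<close>
        have "a = r\<^sup>2 * a" using q[of "n + 2"] q[of "m + 2"] unfolding r by (simp add: b_simps power2_eq_square)
        then have "r = 1 \<or> r = - 1" using a(1) by (simp add: power2_eq_1_iff)
        moreover have "t (n + 2) = r * t (m + 2)" unfolding t_def r by simp
        ultimately have "t (n + 2) = t (m + 2)" using t_pos[of "n + 2"] t_pos[of "m + 2"] by auto
        then show False using t_less[of m n] t_less[of n m] mn by (cases m n rule: linorder_cases) auto
      qed
    qed (use q a(1) y_Int in auto)
  qed
qed

end

section \<open>Rational quadratic forms in three variables\<close>

text \<open>The infinitely many fractions in \<open>approx_set \<theta>\<close> give pairs of
  bounded norm \<open>h\<^sup>2 - d * k\<^sup>2\<close>. Two different pairs with the same norm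
  \<open>n\<close> and the same residues modulo \<open>n\<close> have a quotient that is an integral
  solution of norm 1.\<close>

lemma pell_solution:
  fixes d :: int
  assumes d: "d > 0" and nonsq: "\<And>m. m\<^sup>2 \<noteq> d"
  obtains u v :: int where "u \<ge> 2" "v \<noteq> 0" "u\<^sup>2 - d * v\<^sup>2 = 1"
proof -
  define \<theta> where "\<theta> = sqrt (of_int d)"
  have \<theta>: "\<theta> \<ge> 0" "\<theta>\<^sup>2 = of_int d" using d by (simp_all add: \<theta>_def)
  have "\<theta> \<notin> \<rat>"
  proof
    assume "\<theta> \<in> \<rat>"
    then obtain p q where pq: "q > 0" "coprime p q" "\<theta> = of_int p / of_int q" by (rule Rats_cases')
    have "of_int (d * q\<^sup>2) = (of_int (p\<^sup>2) :: real)"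
      using \<theta>(2) pq by (simp add: power_divide field_simps)
    then have eq: "d * q\<^sup>2 = p\<^sup>2" by linarith
    have "is_unit (q\<^sup>2)"
    proof (rule coprime_common_divisor)
      show "coprime (p\<^sup>2) (q\<^sup>2)" using pq(2) by simp
      show "q\<^sup>2 dvd p\<^sup>2" using eq by (metis dvd_triv_right)
    qed simp
    then have "q\<^sup>2 = 1" by (simp add: is_unit_power_iff)
    then show False using nonsq[of p] eq by simp
  qed
  then have inf: "infinite (approx_set \<theta>)" using rational_iff_finite_approx_set by blast
  define f where "f = (\<lambda>(h, k). h\<^sup>2 - d * k\<^sup>2)"
  define M where "M = \<lceil>2 * \<theta> + 1\<rceil>"
  have "f ` approx_set \<theta> \<subseteq> {- M..M}"
  proof clarify
    fix h k assume "(h, k) \<in> approx_set \<theta>"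
    then have k: "k > 0" and ap: "\<bar>\<theta> - of_int h / of_int k\<bar> < 1 / (of_int k)\<^sup>2"
      by (auto simp: approx_set_def)
    let ?h = "of_int h :: real" and ?k = "of_int k :: real"
    have "\<bar>\<theta> * ?k - ?h\<bar> = \<bar>\<theta> - ?h / ?k\<bar> * ?k"
      using k by (simp add: abs_mult_pos left_diff_distrib)
    also have "\<dots> \<le> 1 / ?k\<^sup>2 * ?k" using ap k by (intro mult_right_mono) auto
    also have "\<dots> = 1 / ?k" using k by (simp add: power2_eq_square)
    finally have 1: "\<bar>\<theta> * ?k - ?h\<bar> \<le> 1 / ?k" .
    have k1: "?k \<ge> 1" using k by simp
    then have "1 / ?k \<le> ?k" by (smt (verit) divide_le_eq_1)
    moreover have "0 \<le> \<theta> * ?k" using \<theta>(1) k1 by simp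
    ultimately have "\<bar>\<theta> * ?k + ?h\<bar> \<le> 2 * (\<theta> * ?k) + ?k" using 1 by linarith
    also have "\<dots> = (2 * \<theta> + 1) * ?k" by (simp add: algebra_simps)
    finally have "\<bar>\<theta> * ?k + ?h\<bar> \<le> (2 * \<theta> + 1) * ?k" .
    then have "\<bar>\<theta> * ?k - ?h\<bar> * \<bar>\<theta> * ?k + ?h\<bar> \<le> (1 / ?k) * ((2 * \<theta> + 1) * ?k)"
      using 1 k1 by (intro mult_mono) auto
    also have "\<dots> = 2 * \<theta> + 1" using k1 by simp
    also have "\<bar>\<theta> * ?k - ?h\<bar> * \<bar>\<theta> * ?k + ?h\<bar> = \<bar>(\<theta> * ?k)\<^sup>2 - ?h\<^sup>2\<bar>"
      by (simp add: abs_mult[symmetric] algebra_simps power2_eq_square)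
    also have "(\<theta> * ?k)\<^sup>2 - ?h\<^sup>2 = - of_int (h\<^sup>2 - d * k\<^sup>2)"
      by (simp add: power_mult_distrib \<theta>(2))
    finally have "\<bar>of_int (h\<^sup>2 - d * k\<^sup>2)\<bar> \<le> 2 * \<theta> + 1" by simp
    then have "\<bar>h\<^sup>2 - d * k\<^sup>2\<bar> \<le> M" unfolding M_def by linarith
    then show "f (h, k) \<in> {- M..M}" by (auto simp: f_def)
  qed
  then have "finite (f ` approx_set \<theta>)" by (rule finite_subset) simp
  then obtain a0 where a0: "infinite {a \<in> approx_set \<theta>. f a = f a0}" "a0 \<in> approx_set \<theta>"
    using pigeonhole_infinite[OF inf] by blast
  define n where "n = f a0"
  have n0: "n \<noteq> 0"
  proof
    assume "n = 0"
    obtain h k where hk: "a0 = (h, k)" by (cases a0)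
    then have k: "k > 0" and cop: "coprime h k" using a0(2) by (auto simp: approx_set_def)
    have eq: "d * k\<^sup>2 = h\<^sup>2" using \<open>n = 0\<close> by (simp add: n_def f_def hk)
    have "is_unit (k\<^sup>2)"
    proof (rule coprime_common_divisor)
      show "coprime (h\<^sup>2) (k\<^sup>2)" using cop by simp
      show "k\<^sup>2 dvd h\<^sup>2" using eq by (metis dvd_triv_right)
    qed simp
    then have "k\<^sup>2 = 1" by (simp add: is_unit_power_iff)
    then show False using nonsq[of h] eq by simp
  qed
  let ?B = "{a \<in> approx_set \<theta>. f a = n}"
  define g where "g = (\<lambda>(h, k). (h mod \<bar>n\<bar>, k mod \<bar>n\<bar>))"
  have "g a \<in> (SIGMA _:{0..\<bar>n\<bar>}. {0..\<bar>n\<bar>})" for a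
    using n0 by (cases a) (simp add: g_def less_imp_le)
  then have "g ` ?B \<subseteq> (SIGMA _:{0..\<bar>n\<bar>}. {0..\<bar>n\<bar>})" by blast
  then have "finite (g ` ?B)" by (rule finite_subset) auto
  then obtain b0 where b0: "infinite {a \<in> ?B. g a = g b0}"
    using pigeonhole_infinite[of ?B g] a0(1) unfolding n_def[symmetric] by blast
  define S where "S = {a \<in> ?B. g a = g b0}"
  have "S \<noteq> {}" using b0 unfolding S_def by (rule infinite_imp_nonempty)
  then obtain x where x: "x \<in> S" by blast
  have "S - {x} \<noteq> {}" using b0 unfolding S_def by (intro infinite_imp_nonempty infinite_remove)
  then obtain x' where x': "x' \<in> S" "x' \<noteq> x" by blast
  obtain h k h' k' where hk: "x = (h, k)" "x' = (h', k')" by (cases x, cases x')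
  have fx: "h\<^sup>2 - d * k\<^sup>2 = n" "h'\<^sup>2 - d * k'\<^sup>2 = n" using x x' unfolding S_def hk by (simp_all add: f_def)
  have "g (h, k) = g (h', k')" using x x' unfolding S_def hk by simp
  then have gx: "h' mod \<bar>n\<bar> = h mod \<bar>n\<bar>" "k' mod \<bar>n\<bar> = k mod \<bar>n\<bar>" by (simp_all add: g_def)
  have pos: "k > 0" "k' > 0" "coprime h k" "coprime h' k'" using x x' unfolding S_def hk by (simp_all add: approx_set_def)
  \<comment> \<open>Up to the sign of \<open>?v\<close>, the coefficients of
    \<open>h + k * \<theta>\<close> times the conjugate of \<open>h' + k' * \<theta>\<close>. The
    congruences make both divisible by \<open>n\<close>, and the product has norm
    \<open>n\<^sup>2\<close>.\<close>
  let ?u = "h * h' - d * k * k'" and ?v = "h * k' - h' * k"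
  have dh: "n dvd h' - h" "n dvd k' - k" using gx unfolding mod_eq_dvd_iff by simp_all
  have "?u = n + h * (h' - h) - d * k * (k' - k)" using fx(1) by (simp add: algebra_simps power2_eq_square)
  then have "n dvd ?u" using dh by simp
  moreover have "?v = h * (k' - k) - k * (h' - h)" by (simp add: algebra_simps)
  then have "n dvd ?v" using dh by simp
  ultimately obtain u v where uv: "?u = n * u" "?v = n * v" by (auto elim!: dvdE)
  have "(n * u)\<^sup>2 - d * (n * v)\<^sup>2 = (h\<^sup>2 - d * k\<^sup>2) * (h'\<^sup>2 - d * k'\<^sup>2)"
    unfolding uv[symmetric] by (simp add: algebra_simps power2_eq_square)
  also have "\<dots> = n\<^sup>2" unfolding fx by (simp add: power2_eq_square)
  finally have "n\<^sup>2 * (u\<^sup>2 - d * v\<^sup>2) = n\<^sup>2 * 1" by (simp add: algebra_simps power_mult_distrib)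
  then have pell: "u\<^sup>2 - d * v\<^sup>2 = 1" using n0 by simp
  have v0: "v \<noteq> 0"
  proof
    assume "v = 0"
    then have eq: "h * k' = h' * k" using uv by simp
    have "k dvd k'" using eq pos(3) by (metis coprime_commute coprime_dvd_mult_right_iff dvd_triv_right)
    moreover have "k' dvd k" using eq pos(4) by (metis coprime_commute coprime_dvd_mult_right_iff dvd_triv_right)
    ultimately have "k = k'" using pos by (simp add: zdvd_antisym_nonneg)
    then show False using eq pos x' by (auto simp: hk)
  qed
  have "\<bar>u\<bar> \<ge> 2"
  proof (rule ccontr)
    assume "\<not> ?thesis"
    then have "\<bar>u\<bar> \<le> 1" by simp
    then have "u\<^sup>2 \<le> 1" by (simp add: abs_square_le_1)
    moreover have "d * v\<^sup>2 > 0" using d v0 by simp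
    ultimately show False using pell by linarith
  qed
  then show thesis using that[of "\<bar>u\<bar>" v] v0 pell by simp
qed

text \<open>After division of \<open>A\<close> and \<open>B\<close> by their gcd \<open>g\<close>,
  coprimality shows that \<open>m\<close> divides \<open>g\<close>; the quotient is
  \<open>h\<close>.\<close>

lemma int_conic_param:
  fixes A B C :: int
  assumes "B\<^sup>2 = A * C"
  obtains h m n where "A = h * m\<^sup>2" "B = h * m * n" "C = h * n\<^sup>2"
proof (cases "A = 0")
  case True
  then show thesis using that[of C 0 1] assms by simp
next
  case False
  define g where "g = gcd A B"
  obtain m n where mn: "A = g * m" "B = g * n" "coprime m n"
    using False gcd_coprime_exists[of A B] unfolding g_def by (metis gcd_eq_0_iff mult.commute)
  have nz: "g \<noteq> 0" "m \<noteq> 0" using False mn by auto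
  have "g * (g * n\<^sup>2) = g * (m * C)" using assms mn by (simp add: power2_eq_square algebra_simps)
  then have eq: "g * n\<^sup>2 = m * C" using nz by simp
  have "m dvd g"
    using eq mn(3) by (metis coprime_dvd_mult_left_iff coprime_power_right_iff dvd_triv_left)
  then obtain h where h: "g = m * h" by (rule dvdE)
  have "m * (h * n\<^sup>2) = m * C" using eq h by (simp add: algebra_simps)
  then show thesis using that[of h m n] mn h nz by (simp add: power2_eq_square algebra_simps)
qed

text \<open>Gelfond's inequality for the product of the linear polynomials \<open>m + n T\<close> and \<open>a + b T\<close>.\<close>

lemma linear_product_height:
  fixes m n a b :: int
  shows "(m\<^sup>2 + n\<^sup>2) * (a\<^sup>2 + b\<^sup>2) \<le> 2 * ((m * a)\<^sup>2 + (n * a + m * b)\<^sup>2 + (n * b)\<^sup>2)"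
proof -
  have "2 * ((m * a)\<^sup>2 + (n * a + m * b)\<^sup>2 + (n * b)\<^sup>2) - (m\<^sup>2 + n\<^sup>2) * (a\<^sup>2 + b\<^sup>2)
    = (m * a + n * b)\<^sup>2 + (n * a + m * b)\<^sup>2"
    by (simp add: power2_eq_square algebra_simps)
  then show ?thesis by (smt (verit) zero_le_power2)
qed

text \<open>With \<open>(A, B, C) = (h * m\<^sup>2, h * m * n, h * n\<^sup>2)\<close>, the minors
  are up to sign \<open>h\<close> times the coefficients of \<open>(m + n T) (a + b T)\<close>,
  where \<open>a\<close> and \<open>b\<close> are integers, not both 0. Such a product cannot be
  much smaller than \<open>m + n T\<close>.\<close>

lemma int_conic_gap:
  fixes A B C A' B' C' :: int
  assumes conic: "B\<^sup>2 = A * C" and nz: "(A * B' - B * A', B * C' - C * B', C * A' - A * C') \<noteq> (0, 0, 0)"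
  shows "\<bar>A\<bar> + \<bar>B\<bar> + \<bar>C\<bar> \<le> 4 * ((A * B' - B * A')\<^sup>2 + (B * C' - C * B')\<^sup>2 + (C * A' - A * C')\<^sup>2)"
proof -
  obtain h m n where h: "A = h * m\<^sup>2" "B = h * m * n" "C = h * n\<^sup>2" using int_conic_param[OF conic] .
  define a b where "a = n * A' - m * B'" and "b = n * B' - m * C'"
  have e: "A * B' - B * A' = - h * (m * a)" "B * C' - C * B' = - h * (n * b)" "C * A' - A * C' = h * (n * a + m * b)"
    unfolding h a_def b_def by (simp_all add: power2_eq_square algebra_simps)
  let ?S = "(m * a)\<^sup>2 + (n * a + m * b)\<^sup>2 + (n * b)\<^sup>2"
  have h0: "h \<noteq> 0" and ab: "a \<noteq> 0 \<or> b \<noteq> 0" using nz unfolding e by auto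
  have ab1: "a\<^sup>2 + b\<^sup>2 \<ge> 1" using ab by (smt (verit) zero_less_power2 zero_le_power2)
  have mn: "\<bar>m * n\<bar> \<le> m\<^sup>2 + n\<^sup>2"
  proof -
    have "2 * \<bar>m * n\<bar> \<le> m\<^sup>2 + n\<^sup>2"
      using zero_le_power2[of "\<bar>m\<bar> - \<bar>n\<bar>"] by (simp add: power2_diff abs_mult)
    then show ?thesis using abs_ge_zero[of "m * n"] by linarith
  qed
  have "\<bar>A\<bar> + \<bar>B\<bar> + \<bar>C\<bar> = \<bar>h\<bar> * (m\<^sup>2 + \<bar>m * n\<bar> + n\<^sup>2)"
    unfolding h by (simp add: abs_mult algebra_simps)
  also have "\<dots> \<le> \<bar>h\<bar> * (2 * (m\<^sup>2 + n\<^sup>2))" using mn by (intro mult_left_mono) auto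
  also have "\<dots> \<le> h\<^sup>2 * (2 * ((m\<^sup>2 + n\<^sup>2) * (a\<^sup>2 + b\<^sup>2)))"
  proof (rule mult_mono)
    have "\<bar>h\<bar> * 1 \<le> \<bar>h\<bar> * \<bar>h\<bar>" using h0 by (intro mult_left_mono) auto
    then show "\<bar>h\<bar> \<le> h\<^sup>2" by (simp add: power2_eq_square abs_mult[symmetric])
    show "2 * (m\<^sup>2 + n\<^sup>2) \<le> 2 * ((m\<^sup>2 + n\<^sup>2) * (a\<^sup>2 + b\<^sup>2))"
      using mult_left_mono[OF ab1, of "m\<^sup>2 + n\<^sup>2"] by simp
  qed auto
  also have "\<dots> \<le> h\<^sup>2 * (4 * ?S)"
    using linear_product_height[of m n a b] by (intro mult_left_mono) auto
  also have "\<dots> = 4 * ((A * B' - B * A')\<^sup>2 + (B * C' - C * B')\<^sup>2 + (C * A' - A * C')\<^sup>2)"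
    unfolding e by (simp add: power2_eq_square algebra_simps)
  finally show ?thesis .
qed

lemma basis_coords:
  assumes "e0 \<bullet> (e1 \<times> e2) \<noteq> 0"
  obtains a0 a1 a2 where "x = a0 *\<^sub>R e0 + a1 *\<^sub>R e1 + a2 *\<^sub>R e2"
proof -
  let ?d = "e0 \<bullet> (e1 \<times> e2)"
  have "x = (1 / ?d) *\<^sub>R (?d *\<^sub>R x)" using assms by simp
  also have "\<dots> = ((x \<bullet> (e1 \<times> e2)) / ?d) *\<^sub>R e0 + ((e0 \<bullet> (x \<times> e2)) / ?d) *\<^sub>R e1 + ((e0 \<bullet> (e1 \<times> x)) / ?d) *\<^sub>R e2"
    unfolding triple_expand[of e0 e1 e2 x] by (simp add: scaleR_right_distrib)
  finally show thesis by (rule that)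
qed

lemma triple_combination:
  "(a0 *\<^sub>R e0 + a1 *\<^sub>R e1 + a2 *\<^sub>R e2) \<bullet> ((b0 *\<^sub>R e0 + b1 *\<^sub>R e1 + b2 *\<^sub>R e2) \<times> (c0 *\<^sub>R e0 + c1 *\<^sub>R e1 + c2 *\<^sub>R e2))
   = (a0 * (b1 * c2 - b2 * c1) - a1 * (b0 * c2 - b2 * c0) + a2 * (b0 * c1 - b1 * c0)) * (e0 \<bullet> (e1 \<times> e2))"
proof -
  have c: "e1 \<bullet> (e0 \<times> e2) = - (e0 \<bullet> (e1 \<times> e2))" "e1 \<bullet> (e2 \<times> e0) = e0 \<bullet> (e1 \<times> e2)"
    "e2 \<bullet> (e0 \<times> e1) = e0 \<bullet> (e1 \<times> e2)" "e2 \<bullet> (e1 \<times> e0) = - (e0 \<bullet> (e1 \<times> e2))"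
    "e0 \<bullet> (e2 \<times> e1) = - (e0 \<bullet> (e1 \<times> e2))"
    by (simp_all add: cross3_def inner_vec_def sum_3 algebra_simps)
  show ?thesis
    by (simp add: cross_add_left cross_add_right cross_mult_left cross_mult_right inner_add_left inner_add_right
        dot_cross_self c) (simp add: algebra_simps)
qed

section \<open>Orthogonal bases, and seeds for degenerate and for anisotropic forms\<close>

context int_form
begin

text \<open>The quadratic form is a product of two rational linear forms, with denominators cleared;
  \<open>u = 0\<close> covers the zero form.\<close>

definition splits :: bool where
  "splits \<longleftrightarrow> (\<exists>c u v. c \<in> \<int> \<and> c \<noteq> 0 \<and> u \<in> Z3 \<and> v \<in> Z3 \<and> (\<forall>x. c * b x x = (u \<bullet> x) * (v \<bullet> x)))"

lemma b_eq_0: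
  assumes "\<And>x. x \<in> Z3 \<Longrightarrow> b x x = 0"
  shows "b x y = 0"
proof -
  have Z: "b x y = 0" if "x \<in> Z3" "y \<in> Z3" for x y
    using assms[of x] assms[of y] assms[OF Z3_add[OF that]] that by (simp add: b_simps sym[of y x])
  have "grad x $ i = 0" for x i
  proof -
    have "grad (axis i 1) = 0" unfolding grad_def by (simp add: vec_eq_iff Z Z3_axis)
    then have "b (axis i 1) x = 0" by (simp add: b_grad)
    then show ?thesis by (simp add: grad_def sym[of x])
  qed
  then have "grad x = 0" by (simp add: vec_eq_iff)
  then show ?thesis by (simp add: b_grad)
qed

text \<open>Gram-Schmidt with denominators cleared. It can fail only if the form vanishes
  identically or on the complement of \<open>e0\<close>, and then it is 0 or a multiple of the
  square of \<open>b e0 _\<close>, so it splits. The last vector \<open>e2\<close> may be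
  isotropic.\<close>

lemma orthogonal_basis:
  assumes "\<not> splits"
  obtains e0 e1 e2 where "e0 \<in> Z3" "e1 \<in> Z3" "e2 \<in> Z3" "b e0 e0 \<noteq> 0" "b e1 e1 \<noteq> 0"
    "b e0 e1 = 0" "b e0 e2 = 0" "b e1 e2 = 0" "e0 \<bullet> (e1 \<times> e2) \<noteq> 0"
proof -
  obtain e0 where e0: "e0 \<in> Z3" "b e0 e0 \<noteq> 0"
  proof (rule ccontr)
    assume "\<not> thesis"
    then have "b x y = 0" for x y using that b_eq_0 by blast
    then have splits unfolding splits_def by (intro exI[of _ 1] exI[of _ 0]) simp
    then show False using assms by simp
  qed
  define p where "p v = b e0 e0 *\<^sub>R v - b e0 v *\<^sub>R e0" for v
  have p_Z3: "p v \<in> Z3" if "v \<in> Z3" for v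
    unfolding p_def using that e0 by (intro Z3_diff Z3_scale int)
  have p_orth: "b e0 (p v) = 0" for v by (simp add: p_def b_simps)
  have p_q: "b (p v) (p v) = b e0 e0 * (b e0 e0 * b v v - b e0 v * b e0 v)" for v
    by (simp add: p_def b_simps sym[of v e0] algebra_simps)
  obtain e1 where e1: "e1 \<in> Z3" "b e1 e1 \<noteq> 0" "b e0 e1 = 0"
  proof (rule ccontr)
    assume no: "\<not> thesis"
    \<comment> \<open>Up to the factor \<open>b e0 e0\<close>, the form of the projection
      \<open>p v\<close>; once it is 0, \<open>b e0 e0 * b x x\<close> is the square of
      \<open>grad e0 \<bullet> x\<close>.\<close>
    let ?b = "\<lambda>x y. b e0 e0 * b x y - b e0 x * b e0 y"
    have "int_form ?b"
    proof (rule int_form.intro)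
      have "bilinear ?b"
        unfolding bilinear_def by (auto intro!: linearI simp: b_simps algebra_simps)
      then show "bounded_bilinear ?b" by (simp add: bilinear_conv_bounded_bilinear)
      show "?b x y = ?b y x" for x y by (simp add: sym[of x y])
      show "?b x y \<in> \<int>" if "x \<in> Z3" "y \<in> Z3" for x y
        using that e0 by (intro Ints_diff Ints_mult int)
    qed
    then have "?b x x = 0" for x
    proof (rule int_form.b_eq_0)
      fix v assume "v \<in> Z3"
      then have "b (p v) (p v) = 0" using no that p_Z3 p_orth by blast
      then show "?b v v = 0" using e0 by (simp add: p_q)
    qed
    then have splits
      unfolding splits_def using e0 int[OF e0(1) e0(1)] grad_Z3[OF e0(1)]
      by (intro exI[of _ "b e0 e0"] exI[of _ "grad e0"]) (simp add: b_grad)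
    then show False using assms by simp
  qed
  define e2 where "e2 = grad e0 \<times> grad e1"
  have "e2 \<in> Z3" unfolding e2_def by (intro Z3_cross grad_Z3 e0 e1)
  moreover have "b e0 e2 = 0" "b e1 e2 = 0"
    unfolding b_grad[of _ e2] unfolding e2_def by (rule dot_cross_self)+
  moreover have "e0 \<bullet> (e1 \<times> e2) \<noteq> 0"
  proof -
    have "e0 \<bullet> (e1 \<times> e2) = (e0 \<times> e1) \<bullet> e2" using cross_triple[of e0 e1 e2] by (simp add: inner_commute)
    also have "\<dots> = (grad e0 \<bullet> e0) * (grad e1 \<bullet> e1) - (grad e1 \<bullet> e0) * (grad e0 \<bullet> e1)"
      unfolding e2_def dot_cross by (simp add: inner_commute)
    also have "\<dots> = b e0 e0 * b e1 e1" using e1 by (simp add: b_grad[symmetric])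
    finally show ?thesis using e0 e1 by simp
  qed
  ultimately show thesis using that e0 e1 by blast
qed

lemma seed_of_coords:
  assumes e: "e0 \<in> Z3" "e1 \<in> Z3" "e2 \<in> Z3" "e0 \<bullet> (e1 \<times> e2) \<noteq> 0"
    and y: "y0 = a0 *\<^sub>R e0 + a1 *\<^sub>R e1 + a2 *\<^sub>R e2" "y1 = b0 *\<^sub>R e0 + b1 *\<^sub>R e1 + b2 *\<^sub>R e2"
      "y2 = c0 *\<^sub>R e0 + c1 *\<^sub>R e1 + c2 *\<^sub>R e2"
    and Z: "{a0, a1, a2, b0, b1, b2, c0, c1, c2} \<subseteq> \<int>"
    and det: "a0 * (b1 * c2 - b2 * c1) - a1 * (b0 * c2 - b2 * c0) + a2 * (b0 * c1 - b1 * c0) \<noteq> 0"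
    and q: "a \<noteq> 0" "b y0 y0 = a" "b y1 y1 = a" "b y2 y2 = a"
      "2 * b y1 y0 = a * s0" "2 * b y2 y1 = a * s1" "2 * b y2 y0 = a * s2"
    and s: "s0 \<in> \<int>" "s1 \<in> \<int>" "s2 \<in> \<int>" "4 \<le> s0" "4 \<le> s1" "s0 \<le> s2" "s1 \<le> s2"
  shows "seed y0 y1 y2"
proof -
  have "y0 \<in> Z3" "y1 \<in> Z3" "y2 \<in> Z3"
    unfolding y using Z e by (auto intro!: Z3_add Z3_scale)
  moreover have "y0 \<bullet> (y1 \<times> y2) \<noteq> 0" unfolding y triple_combination using det e by simp
  ultimately show ?thesis unfolding seed_def using q s by blast
qed

text \<open>Modulo its radical, the form is a multiple of the norm form of a real quadratic field.\<close>

lemma degenerate_case: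
  assumes ns: "\<not> splits"
    and e: "e0 \<in> Z3" "e1 \<in> Z3" "e2 \<in> Z3" "b e0 e0 \<noteq> 0" "b e1 e1 \<noteq> 0"
    and orth: "b e0 e1 = 0" "b e0 e2 = 0" "b e1 e2 = 0" and det: "e0 \<bullet> (e1 \<times> e2) \<noteq> 0"
    and rad: "b e2 e2 = 0"
    and p: "p \<times> p' \<noteq> 0" "b p p = 0" "b p' p' = 0"
  shows "isotropic_gap \<and> (\<exists>y0 y1 y2. seed y0 y1 y2)"
proof -
  let ?a0 = "b e0 e0" and ?a1 = "b e1 e1"
  have swap: "b e1 e0 = 0" "b e2 e0 = 0" "b e2 e1 = 0" using orth sym by metis+
  have q: "b (x0 *\<^sub>R e0 + x1 *\<^sub>R e1 + x2 *\<^sub>R e2) (x0 *\<^sub>R e0 + x1 *\<^sub>R e1 + x2 *\<^sub>R e2) = ?a0 * x0\<^sup>2 + ?a1 * x1\<^sup>2" for x0 x1 x2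
    by (simp add: b_simps orth swap rad power2_eq_square algebra_simps)
  have lin: "b e0 (x0 *\<^sub>R e0 + x1 *\<^sub>R e1 + x2 *\<^sub>R e2) = ?a0 * x0" "b e1 (x0 *\<^sub>R e0 + x1 *\<^sub>R e1 + x2 *\<^sub>R e2) = ?a1 * x1" for x0 x1 x2
    by (simp_all add: b_simps orth swap)
  have key: "?a0 * ?a1 * b x x = ?a1 * (b e0 x)\<^sup>2 + ?a0 * (b e1 x)\<^sup>2" for x
  proof -
    obtain x0 x1 x2 where x: "x = x0 *\<^sub>R e0 + x1 *\<^sub>R e1 + x2 *\<^sub>R e2" using basis_coords[OF det] .
    show ?thesis unfolding x lin q by (simp add: power2_eq_square algebra_simps)
  qed
  have par: "\<exists>r. x = r *\<^sub>R e2" if "b e0 x = 0" "b e1 x = 0" for x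
  proof -
    obtain x0 x1 x2 where x: "x = x0 *\<^sub>R e0 + x1 *\<^sub>R e1 + x2 *\<^sub>R e2" using basis_coords[OF det] .
    show ?thesis using that e unfolding x lin by auto
  qed
  obtain d where d: "of_int d = - ?a0 * ?a1"
    using int[OF e(1) e(1)] int[OF e(2) e(2)] by (metis Ints_cases Ints_minus Ints_mult)
  \<comment> \<open>If both values had the same sign, every zero would lie on the radical line of
    \<open>e2\<close>, but \<open>p\<close> and \<open>p'\<close> are independent.\<close>
  have d_pos: "d > 0"
  proof (rule ccontr)
    assume "\<not> d > 0"
    then have "of_int d \<le> (0::real)" by simp
    then have pos: "?a0 * ?a1 > 0" using d e by (smt (verit) mult_eq_0_iff mult_minus_left)
    have "b e0 x = 0 \<and> b e1 x = 0" if "b x x = 0" for x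
    proof -
      have "?a0 * (?a0 * ?a1 * b x x) = ?a0 * ?a1 * (b e0 x)\<^sup>2 + ?a0\<^sup>2 * (b e1 x)\<^sup>2"
        unfolding key by (simp add: algebra_simps power2_eq_square)
      then have "?a0 * ?a1 * (b e0 x)\<^sup>2 + ?a0\<^sup>2 * (b e1 x)\<^sup>2 = 0" using that by simp
      moreover have "?a0 * ?a1 * (b e0 x)\<^sup>2 \<ge> 0" "?a0\<^sup>2 * (b e1 x)\<^sup>2 \<ge> 0" using pos by simp_all
      ultimately have "?a0 * ?a1 * (b e0 x)\<^sup>2 = 0" "?a0\<^sup>2 * (b e1 x)\<^sup>2 = 0" by linarith+
      then show ?thesis using e by simp
    qed
    then obtain r r' where "p = r *\<^sub>R e2" "p' = r' *\<^sub>R e2" using par p by metis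
    then show False using p(1) by (simp add: cross_mult_left cross_mult_right)
  qed
  have nonsq: "m\<^sup>2 \<noteq> d" for m
  proof
    assume m: "m\<^sup>2 = d"
    have m': "(of_int m)\<^sup>2 = - ?a0 * ?a1" unfolding d[symmetric] m[symmetric] by simp
    \<comment> \<open>A rational square root of the discriminant factors the form as a difference of
      two squares.\<close>
    let ?u = "?a1 *\<^sub>R grad e0 + of_int m *\<^sub>R grad e1" and ?v = "?a1 *\<^sub>R grad e0 - of_int m *\<^sub>R grad e1"
    have "(?a0 * ?a1\<^sup>2) * b x x = (?u \<bullet> x) * (?v \<bullet> x)" for x
    proof -
      have "(?u \<bullet> x) * (?v \<bullet> x) = ?a1\<^sup>2 * (b e0 x)\<^sup>2 - (of_int m)\<^sup>2 * (b e1 x)\<^sup>2"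
        by (simp add: inner_add_left inner_diff_left b_grad[symmetric] power2_eq_square algebra_simps)
      also have "\<dots> = ?a1 * (?a1 * (b e0 x)\<^sup>2 + ?a0 * (b e1 x)\<^sup>2)" unfolding m' by (simp add: power2_eq_square algebra_simps)
      also have "\<dots> = (?a0 * ?a1\<^sup>2) * b x x" unfolding key[symmetric] by (simp add: power2_eq_square)
      finally show ?thesis by simp
    qed
    moreover have "?u \<in> Z3" "?v \<in> Z3" using e int by (auto intro!: Z3_add Z3_diff Z3_scale grad_Z3)
    moreover have "?a0 * ?a1\<^sup>2 \<in> \<int>" using e int by (intro Ints_mult Ints_power) auto
    moreover have "?a0 * ?a1\<^sup>2 \<noteq> 0" using e by simp
    ultimately have splits unfolding splits_def by blast
    then show False using ns by simp
  qed
  obtain u v where uv: "u \<ge> 2" "v \<noteq> 0" "u\<^sup>2 - d * v\<^sup>2 = 1"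
    using pell_solution[OF d_pos nonsq] by blast
  let ?u = "of_int u :: real" and ?v = "of_int v :: real"
  have pell: "?u\<^sup>2 + ?a0 * ?a1 * ?v\<^sup>2 = 1"
  proof -
    have "real_of_int (u\<^sup>2 - d * v\<^sup>2) = 1" using uv by simp
    then show ?thesis by (simp add: d)
  qed
  have u2: "?u \<ge> 2" using uv by simp
  have uu: "2 * ?u \<le> 2 * (2 * ?u\<^sup>2 - 1)"
  proof -
    have "2 * ?u \<le> ?u\<^sup>2" using mult_right_mono[OF u2, of ?u] u2 by (simp add: power2_eq_square)
    moreover have "2 * r \<le> 2 * (2 * t - 1)" if "2 * r \<le> t" "2 \<le> r" for r t :: real
      using that by simp
    ultimately show ?thesis using u2 by blast
  qed
  \<comment> \<open>\<open>e0\<close> times a Pell unit and times its conjugate: both keep the value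
    \<open>?a0\<close>. The component 1 along the radical is invisible to the form but makes the
    three vectors independent.\<close>
  let ?Y0 = "?u *\<^sub>R e0 + (- ?a0 * ?v) *\<^sub>R e1 + 0 *\<^sub>R e2" and ?Y2 = "?u *\<^sub>R e0 + (?a0 * ?v) *\<^sub>R e1 + 1 *\<^sub>R e2"
  have "seed ?Y0 (1 *\<^sub>R e0 + 0 *\<^sub>R e1 + 0 *\<^sub>R e2)
      ?Y2"
  proof (rule seed_of_coords[OF e(1-3) det refl refl refl, where a = ?a0 and ?s0.0 = "2 * ?u" and ?s1.0 = "2 * ?u" and ?s2.0 = "2 * (2 * ?u\<^sup>2 - 1)"])
    show "{?u, - ?a0 * ?v, 0, 1, 0, 0, ?u, ?a0 * ?v, 1} \<subseteq> \<int>"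
      using int[OF e(1) e(1)] by (auto intro!: Ints_mult)
    have sq: "?a0 * ?u\<^sup>2 + ?a1 * (?a0 * ?v)\<^sup>2 = ?a0"
    proof -
      have "?a0 * ?u\<^sup>2 + ?a1 * (?a0 * ?v)\<^sup>2 = ?a0 * (?u\<^sup>2 + ?a0 * ?a1 * ?v\<^sup>2)"
        by (simp add: power2_eq_square algebra_simps)
      then show ?thesis by (simp add: pell)
    qed
    show "b ?Y0 ?Y0 = ?a0"
      unfolding q using sq by simp
    show "b ?Y2 ?Y2 = ?a0"
      unfolding q using sq by simp
    have "2 * b ?Y2 ?Y0
       = 2 * (?a0 * ?u\<^sup>2 - ?a0 * (?a0 * ?a1 * ?v\<^sup>2))"
      by (simp add: b_simps orth swap power2_eq_square algebra_simps)
    also have "?a0 * ?a1 * ?v\<^sup>2 = 1 - ?u\<^sup>2" using pell by simp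
    finally show "2 * b ?Y2 ?Y0
       = ?a0 * (2 * (2 * ?u\<^sup>2 - 1))" by (simp add: algebra_simps)
  qed (use e uv u2 uu in \<open>auto simp: b_simps orth swap\<close>)
  moreover have isotropic_gap
    unfolding isotropic_gap_def
  proof (intro exI[of _ "1 / norm e2"] conjI ballI impI)
    have e2: "e2 \<noteq> 0" using det by auto
    then show "0 < 1 / norm e2" by simp
    fix x y assume x: "x \<in> Z3" and y: "y \<in> Z3" and 0: "b x x = 0" and ind: "x \<times> y \<noteq> 0"
    obtain X0 X1 where X: "b e0 x = of_int X0" "b e1 x = of_int X1" using int e x by (metis Ints_cases)
    have "?a1 * (?a1 * (b e0 x)\<^sup>2 + ?a0 * (b e1 x)\<^sup>2) = 0" using key[of x] 0 by simp
    then have "(?a1 * of_int X0)\<^sup>2 = of_int d * (of_int X1)\<^sup>2" unfolding X d by (simp add: power2_eq_square algebra_simps)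
    moreover obtain A1 where A1: "?a1 = of_int A1" using int e by (metis Ints_cases)
    ultimately have "real_of_int ((A1 * X0)\<^sup>2) = of_int (d * X1\<^sup>2)" by simp
    then have sq: "(A1 * X0)\<^sup>2 = d * X1\<^sup>2" by linarith
    \<comment> \<open>As \<open>d\<close> is not a square, the integer zeros of the form are
      multiples of the radical vector \<open>e2\<close>, and for these the gap is immediate.\<close>
    have "X1 = 0"
    proof (rule ccontr)
      assume X1: "X1 \<noteq> 0"
      have "X1\<^sup>2 dvd (A1 * X0)\<^sup>2" unfolding sq by simp
      then have "X1 dvd A1 * X0" by simp
      then obtain m where m: "A1 * X0 = X1 * m" by (rule dvdE)
      have "X1\<^sup>2 * m\<^sup>2 = X1\<^sup>2 * d" using sq unfolding m by (simp add: power_mult_distrib)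
      then show False using X1 nonsq[of m] by simp
    qed
    moreover have "X0 = 0" using sq \<open>X1 = 0\<close> A1 e(5) by auto
    ultimately obtain r where r: "x = r *\<^sub>R e2" using par X by auto
    have "x \<times> y = r *\<^sub>R (e2 \<times> y)" unfolding r by (simp add: cross_mult_left)
    moreover have "e2 \<times> y \<noteq> 0" using ind r by (auto simp: cross_mult_left)
    ultimately have "norm (x \<times> y) \<ge> \<bar>r\<bar> * 1"
      using mult_left_mono[OF Z3_norm_ge_1[OF Z3_cross[OF e(3) y]], of "\<bar>r\<bar>"] by simp
    moreover have "norm (x \<times> y) \<ge> 1" using Z3_norm_ge_1[OF Z3_cross[OF x y] ind] .
    ultimately have "\<bar>r\<bar> * 1 \<le> norm (x \<times> y) * norm (x \<times> y)" by (intro mult_mono) auto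
    then show "1 / norm e2 * norm x \<le> (norm (x \<times> y))\<^sup>2" using e2 unfolding r by (simp add: power2_eq_square)
  qed
  ultimately show ?thesis by blast
qed

text \<open>The form is indefinite on the planes spanned by \<open>e0, e1\<close> and by
  \<open>e0, e2\<close>. Pell's equation gives in each of them a vector with the value of
  \<open>e0\<close>; together with \<open>e0\<close> these form the seed, with
  \<open>s\<close>-values \<open>2 u\<close>, \<open>2 u'\<close> and \<open>2 u u'\<close>.\<close>

lemma anisotropic_seed:
  assumes e: "e0 \<in> Z3" "e1 \<in> Z3" "e2 \<in> Z3" and det: "e0 \<bullet> (e1 \<times> e2) \<noteq> 0"
    and orth: "b e0 e1 = 0" "b e0 e2 = 0" "b e1 e2 = 0"
    and sgn: "b e0 e0 * b e1 e1 < 0" "b e0 e0 * b e2 e2 < 0"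
    and aniso: "\<And>x. x \<in> Z3 \<Longrightarrow> b x x = 0 \<Longrightarrow> x = 0"
  shows "\<exists>y0 y1 y2. seed y0 y1 y2"
proof -
  let ?a = "b e0 e0"
  have swap: "b e1 e0 = 0" "b e2 e0 = 0" "b e2 e1 = 0" using orth sym by metis+
  have pell: "\<exists>u v. u \<ge> 2 \<and> v \<noteq> 0 \<and> (of_int u)\<^sup>2 + ?a * b f f * (of_int v)\<^sup>2 = (1::real)"
    if f: "f \<in> Z3" "b e0 f = 0" "?a * b f f < 0" for f
  proof -
    obtain d where d: "of_int d = - ?a * b f f"
      using int[OF e(1) e(1)] int[OF f(1) f(1)] by (metis Ints_cases Ints_minus Ints_mult)
    have "real_of_int d > 0" using d f by simp
    then have "d > 0" by simp
    moreover have "m\<^sup>2 \<noteq> d" for m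
    proof
      assume m: "m\<^sup>2 = d"
      have m': "(of_int m)\<^sup>2 = - ?a * b f f" unfolding d[symmetric] m[symmetric] by simp
      \<comment> \<open>If the discriminant of the plane were a square, this would be a nonzero
        integer zero of the form.\<close>
      let ?x = "of_int m *\<^sub>R e0 + ?a *\<^sub>R f"
      have "b ?x ?x = ?a * ((of_int m)\<^sup>2 + ?a * b f f)"
        using f(2) sym[of f e0] by (simp add: b_simps power2_eq_square algebra_simps)
      then have "b ?x ?x = 0" using m' by simp
      moreover have "?x \<in> Z3" using e f int by (intro Z3_add Z3_scale) auto
      ultimately have "b ?x f = 0" using aniso by (metis b.zero_left)
      then show False using f by (auto simp: b_simps)
    qed
    ultimately obtain u v where uv: "u \<ge> 2" "v \<noteq> 0" "u\<^sup>2 - d * v\<^sup>2 = 1" using pell_solution by blast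
    then have "real_of_int (u\<^sup>2 - d * v\<^sup>2) = 1" by simp
    then have "(of_int u)\<^sup>2 + ?a * b f f * (of_int v)\<^sup>2 = (1::real)" by (simp add: d)
    then show ?thesis using uv by blast
  qed
  obtain u v where uv: "u \<ge> 2" "v \<noteq> 0" "(of_int u)\<^sup>2 + ?a * b e1 e1 * (of_int v)\<^sup>2 = (1::real)"
    using pell[OF e(2) orth(1) sgn(1)] by blast
  obtain u' v' where uv': "u' \<ge> 2" "v' \<noteq> 0" "(of_int u')\<^sup>2 + ?a * b e2 e2 * (of_int v')\<^sup>2 = (1::real)"
    using pell[OF e(3) orth(2) sgn(2)] by blast
  let ?u = "of_int u :: real" and ?v = "of_int v :: real" and ?u' = "of_int u' :: real" and ?v' = "of_int v' :: real"
  have u2: "?u \<ge> 2" "?u' \<ge> 2" using uv uv' by simp_all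
  have uu: "2 * ?u \<le> 2 * ?u * ?u'" "2 * ?u' \<le> 2 * ?u * ?u'"
    using mult_left_mono[of 1 ?u' ?u] mult_right_mono[of 1 ?u ?u'] u2 by auto
  have sq: "?u * (?u * ?a) + ?a * (?v * (?a * (?v * b e1 e1))) = ?a"
    "?u' * (?u' * ?a) + ?a * (?v' * (?a * (?v' * b e2 e2))) = ?a"
  proof -
    have "?u * (?u * ?a) + ?a * (?v * (?a * (?v * b e1 e1))) = ?a * (?u\<^sup>2 + ?a * b e1 e1 * ?v\<^sup>2)"
      by (simp add: power2_eq_square algebra_simps)
    then show "?u * (?u * ?a) + ?a * (?v * (?a * (?v * b e1 e1))) = ?a" using uv by simp
    have "?u' * (?u' * ?a) + ?a * (?v' * (?a * (?v' * b e2 e2))) = ?a * (?u'\<^sup>2 + ?a * b e2 e2 * ?v'\<^sup>2)"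
      by (simp add: power2_eq_square algebra_simps)
    then show "?u' * (?u' * ?a) + ?a * (?v' * (?a * (?v' * b e2 e2))) = ?a" using uv' by simp
  qed
  have "?a \<noteq> 0" using sgn by auto
  let ?Y0 = "?u *\<^sub>R e0 + (?a * ?v) *\<^sub>R e1 + 0 *\<^sub>R e2" and ?Y2 = "?u' *\<^sub>R e0 + 0 *\<^sub>R e1 + (?a * ?v') *\<^sub>R e2"
  have "seed ?Y0 (1 *\<^sub>R e0 + 0 *\<^sub>R e1 + 0 *\<^sub>R e2)
      ?Y2"
  proof (rule seed_of_coords[OF e det refl refl refl, where a = ?a and ?s0.0 = "2 * ?u" and ?s1.0 = "2 * ?u'" and ?s2.0 = "2 * ?u * ?u'"])
    show "{?u, ?a * ?v, 0, 1, 0, 0, ?u', 0, ?a * ?v'} \<subseteq> \<int>"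
      using int[OF e(1) e(1)] by (auto intro!: Ints_mult)
    show "b ?Y0 ?Y0 = ?a"
      using sq(1) by (simp add: b_simps orth swap mult.assoc)
    show "b ?Y2 ?Y2 = ?a"
      using sq(2) by (simp add: b_simps orth swap mult.assoc)
  qed (use \<open>?a \<noteq> 0\<close> uv uv' u2 uu in \<open>auto simp: b_simps orth swap intro!: Ints_mult\<close>)
  then show ?thesis by blast
qed

end

section \<open>Forms with a rational zero, and the conclusion for all forms\<close>

context int_form
begin

text \<open>Reflecting the zero \<open>z\<close> in a vector \<open>s\<close> not orthogonal to it
  gives a second zero \<open>r\<close>, and \<open>f\<close> is orthogonal to both. The final
  scalings by \<open>- b f f\<close> and \<open>2 * h\<close>, with \<open>h = b z r\<close>,
  balance the two sides of \<open>2 * b p r = - b f f\<close>.\<close>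

lemma hyperbolic_basis:
  assumes e: "e0 \<in> Z3" "e1 \<in> Z3" "e2 \<in> Z3" "b e0 e0 \<noteq> 0" "b e1 e1 \<noteq> 0" "b e2 e2 \<noteq> 0"
    and orth: "b e0 e1 = 0" "b e0 e2 = 0" "b e1 e2 = 0" and det: "e0 \<bullet> (e1 \<times> e2) \<noteq> 0"
    and z: "z \<in> Z3" "z \<noteq> 0" "b z z = 0"
  obtains p r f where "p \<in> Z3" "r \<in> Z3" "f \<in> Z3" "b p p = 0" "b r r = 0" "b p f = 0" "b r f = 0"
    "b f f \<noteq> 0" "2 * b p r = - b f f" "p \<bullet> (f \<times> r) \<noteq> 0"
proof -
  have swap: "b e1 e0 = 0" "b e2 e0 = 0" "b e2 e1 = 0" using orth sym by metis+
  have nondeg: "x = 0" if "b x e0 = 0" "b x e1 = 0" "b x e2 = 0" for x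
  proof -
    obtain x0 x1 x2 where x: "x = x0 *\<^sub>R e0 + x1 *\<^sub>R e1 + x2 *\<^sub>R e2" using basis_coords[OF det] .
    show ?thesis using that e unfolding x by (simp add: b_simps orth swap)
  qed
  obtain s where s: "s \<in> Z3" "b z s \<noteq> 0" using nondeg[of z] z(2) e by blast
  define r where "r = (2 * b z s) *\<^sub>R s - b s s *\<^sub>R z"
  have r: "r \<in> Z3" unfolding r_def using s z by (intro Z3_diff Z3_scale Ints_mult int) auto
  have rr: "b r r = 0" unfolding r_def using z by (simp add: b_simps sym[of s z])
  define h where "h = b z r"
  have h: "h = 2 * (b z s)\<^sup>2" unfolding h_def r_def using z by (simp add: b_simps power2_eq_square)
  then have h0: "h \<noteq> 0" using s by simp
  have hI: "h \<in> \<int>" unfolding h_def using z r by (intro int)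
  define f where "f = grad z \<times> grad r"
  have f: "f \<in> Z3" unfolding f_def using z r by (intro Z3_cross grad_Z3)
  have zf: "b z f = 0" and rf: "b r f = 0"
    unfolding b_grad[of _ f] unfolding f_def by (rule dot_cross_self)+
  have d: "(z \<times> r) \<bullet> f = - (h * h)"
  proof -
    have "(z \<times> r) \<bullet> f = (grad z \<bullet> z) * (grad r \<bullet> r) - (grad r \<bullet> z) * (grad z \<bullet> r)"
      unfolding f_def dot_cross by (simp add: inner_commute)
    then show ?thesis using z rr sym[of r z] by (simp add: b_grad[symmetric] h_def)
  qed
  have d': "z \<bullet> (f \<times> r) = h * h"
    using d cross_triple[of z r f] cross_triple[of r f z] cross_skew[of f r]
    by (simp add: inner_commute)
  have f0: "b f f \<noteq> 0"
  proof
    assume ff: "b f f = 0"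
    have "b f x = 0" for x
    proof -
      have "z \<bullet> (f \<times> r) \<noteq> 0" using d' h0 by simp
      then obtain x0 x1 x2 where x: "x = x0 *\<^sub>R z + x1 *\<^sub>R f + x2 *\<^sub>R r" by (rule basis_coords)
      show ?thesis unfolding x using ff zf rf sym[of f z] sym[of f r] by (simp add: b_simps)
    qed
    then have "f = 0" by (intro nondeg) auto
    then show False using d h0 by simp
  qed
  let ?k = "b f f"
  have kI: "?k \<in> \<int>" using f by (intro int)
  show thesis
  proof (rule that[of "(- ?k) *\<^sub>R z" "(2 * h) *\<^sub>R r" "(2 * h) *\<^sub>R f"])
    show "(- ?k) *\<^sub>R z \<in> Z3" "(2 * h) *\<^sub>R r \<in> Z3" "(2 * h) *\<^sub>R f \<in> Z3"
      using kI hI z r f by (auto intro!: Z3_scale Z3_minus Ints_mult)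
    show "((- ?k) *\<^sub>R z) \<bullet> (((2 * h) *\<^sub>R f) \<times> ((2 * h) *\<^sub>R r)) \<noteq> 0"
      using d' h0 f0 by (simp add: cross_mult_left cross_mult_right)
    show "2 * b ((- ?k) *\<^sub>R z) ((2 * h) *\<^sub>R r) = - b ((2 * h) *\<^sub>R f) ((2 * h) *\<^sub>R f)"
      by (simp add: b_simps h_def[symmetric])
  qed (use z rr zf rf f0 h0 in \<open>auto simp: b_simps\<close>)
qed

text \<open>In the coordinates \<open>X p + Y f + Z r\<close> the form is a multiple of \<open>Y\<^sup>2 - X Z\<close>.\<close>

lemma isotropic_case:
  assumes Z3: "p \<in> Z3" "r \<in> Z3" "f \<in> Z3" and iso: "b p p = 0" "b r r = 0"
    and orth: "b p f = 0" "b r f = 0" and k: "b f f \<noteq> 0" "2 * b p r = - b f f" and det: "p \<bullet> (f \<times> r) \<noteq> 0"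
  shows "isotropic_gap \<and> (\<exists>y0 y1 y2. seed y0 y1 y2)"
proof -
  let ?k = "b f f" and ?d = "p \<bullet> (f \<times> r)"
  have swap: "b f p = 0" "b f r = 0" "b r p = b p r" using orth sym by metis+
  have pr: "b p r = - ?k / 2" using k(2) by simp
  have B: "2 * b (X *\<^sub>R p + Y *\<^sub>R f + Z *\<^sub>R r) (X' *\<^sub>R p + Y' *\<^sub>R f + Z' *\<^sub>R r) = ?k * (2 * (Y * Y') - X * Z' - X' * Z)"
    for X Y Z X' Y' Z'
    by (simp add: b_simps iso orth swap pr algebra_simps)
  have q: "b (X *\<^sub>R p + Y *\<^sub>R f + Z *\<^sub>R r) (X *\<^sub>R p + Y *\<^sub>R f + Z *\<^sub>R r) = ?k * (Y * Y - X * Z)" for X Y Z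
    using B[of X Y Z X Y Z] by (simp add: algebra_simps)
  \<comment> \<open>All three satisfy \<open>X Z - Y\<^sup>2 = 1\<close>, hence the common value
    \<open>- ?k\<close>; their normalised polar values are 6, 6 and 18.\<close>
  have "seed (5 *\<^sub>R p + 2 *\<^sub>R f + 1 *\<^sub>R r) (1 *\<^sub>R p + 0 *\<^sub>R f + 1 *\<^sub>R r) (1 *\<^sub>R p + 2 *\<^sub>R f + 5 *\<^sub>R r)"
    by (rule seed_of_coords[OF Z3(1,3,2) det refl refl refl, where a = "- ?k" and ?s0.0 = 6 and ?s1.0 = 6 and ?s2.0 = 18],
        unfold B q) (use k in auto)
  moreover have isotropic_gap
  proof -
    define R where "R = norm p + norm f + norm r"
    have "p \<noteq> 0" using det by auto
    then have R: "R > 0" "norm p \<le> R" "norm f \<le> R" "norm r \<le> R" by (simp_all add: R_def add_pos_nonneg)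
    define c where "c = \<bar>?k\<bar> * ?d\<^sup>2 / (12 * R * R\<^sup>2 * ?k ^ 4)"
    have c: "c > 0" unfolding c_def using k(1) det R(1) by simp
    have "c * norm x \<le> (norm (x \<times> y))\<^sup>2" if x: "x \<in> Z3" and y: "y \<in> Z3" and x0: "b x x = 0" and ind: "x \<times> y \<noteq> 0" for x y
    proof -
      \<comment> \<open>Multiplication by \<open>?k\<close> clears the denominators: the coordinates
        become values of the polar form at integer vectors.\<close>
      have coords: "\<exists>A B C :: int. ?k *\<^sub>R v = of_int A *\<^sub>R p + of_int B *\<^sub>R f + of_int C *\<^sub>R r" if v: "v \<in> Z3" for v
      proof -
        obtain X Y Z where XYZ: "v = X *\<^sub>R p + Y *\<^sub>R f + Z *\<^sub>R r" using basis_coords[OF det] .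
        have e: "?k * X = - 2 * b v r" "?k * Y = b v f" "?k * Z = - 2 * b v p"
          unfolding XYZ by (simp_all add: b_simps iso orth swap pr)
        have "- 2 * b v r \<in> \<int>" "b v f \<in> \<int>" "- 2 * b v p \<in> \<int>"
          using v Z3 by (auto intro!: Ints_mult int Ints_minus)
        then obtain A B C where "?k * X = of_int A" "?k * Y = of_int B" "?k * Z = of_int C"
          unfolding e[symmetric] by (metis Ints_cases)
        then have "?k *\<^sub>R v = of_int A *\<^sub>R p + of_int B *\<^sub>R f + of_int C *\<^sub>R r"
          unfolding XYZ by (simp add: scaleR_right_distrib)
        then show ?thesis by blast
      qed
      obtain A B' C where A: "?k *\<^sub>R x = of_int A *\<^sub>R p + of_int B' *\<^sub>R f + of_int C *\<^sub>R r" using coords[OF x] by blast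
      obtain D E F where D: "?k *\<^sub>R y = of_int D *\<^sub>R p + of_int E *\<^sub>R f + of_int F *\<^sub>R r" using coords[OF y] by blast
      have "b (?k *\<^sub>R x) (?k *\<^sub>R x) = 0" using x0 by (simp add: b_simps)
      then have "of_int B' * of_int B' - of_int A * of_int C = (0::real)" unfolding A q using k by simp
      then have "real_of_int (B'\<^sup>2) = of_int (A * C)" by (simp add: power2_eq_square)
      then have conic: "B'\<^sup>2 = A * C" by linarith
      let ?m1 = "A * E - B' * D" and ?m2 = "B' * F - C * E" and ?m3 = "C * D - A * F"
      let ?w = "(?k *\<^sub>R x) \<times> (?k *\<^sub>R y)"
      have w: "?w = of_int ?m1 *\<^sub>R (p \<times> f) + of_int ?m2 *\<^sub>R (f \<times> r) + of_int ?m3 *\<^sub>R (r \<times> p)"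
        unfolding A D using cross_skew[of f p] cross_skew[of r f] cross_skew[of p r]
        by (simp add: cross_add_left cross_add_right cross_mult_left cross_mult_right algebra_simps)
      have w_norm: "norm ?w = ?k\<^sup>2 * norm (x \<times> y)"
        by (simp add: cross_mult_left cross_mult_right power2_eq_square abs_mult_self_eq)
      have w_nz: "?w \<noteq> 0" using ind k by (simp add: cross_mult_left cross_mult_right)
      have "(?m1, ?m2, ?m3) \<noteq> (0, 0, 0)"
      proof
        assume "(?m1, ?m2, ?m3) = (0, 0, 0)"
        then have "?m1 = 0" "?m2 = 0" "?m3 = 0" by simp_all
        then have "?w = 0" unfolding w by (simp only: of_int_0 scaleR_zero_left add_0)
        then show False using w_nz by contradiction
      qed
      from int_conic_gap[OF conic this]
      have gap: "\<bar>A\<bar> + \<bar>B'\<bar> + \<bar>C\<bar> \<le> 4 * (?m1\<^sup>2 + ?m2\<^sup>2 + ?m3\<^sup>2)" .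
      have t: "(p \<times> f) \<bullet> r = ?d" "(f \<times> r) \<bullet> p = ?d" "(r \<times> p) \<bullet> f = ?d"
        using cross_triple[of p f r] cross_triple[of r p f] by (simp_all add: inner_commute)
      \<comment> \<open>Pairing with the basis recovers the minors from the cross product, so they
        are bounded by its norm.\<close>
      have dots: "?w \<bullet> r = of_int ?m1 * ?d" "?w \<bullet> p = of_int ?m2 * ?d" "?w \<bullet> f = of_int ?m3 * ?d"
        unfolding w by (simp_all add: inner_add_left dot_cross_self t)
      have minor: "(of_int m)\<^sup>2 * ?d\<^sup>2 \<le> (norm ?w)\<^sup>2 * R\<^sup>2" if "?w \<bullet> g = of_int m * ?d" "norm g \<le> R" for m g
      proof -
        have "\<bar>?w \<bullet> g\<bar> \<le> norm ?w * R"
          using Cauchy_Schwarz_ineq2[of ?w g] mult_left_mono[OF that(2), of "norm ?w"] by simp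
        then have "\<bar>?w \<bullet> g\<bar>\<^sup>2 \<le> (norm ?w * R)\<^sup>2" by (intro power_mono) auto
        then show ?thesis unfolding that(1) by (simp add: power_mult_distrib)
      qed
      let ?S = "(of_int ?m1)\<^sup>2 + (of_int ?m2)\<^sup>2 + (of_int ?m3)\<^sup>2 :: real"
      have S: "?S * ?d\<^sup>2 \<le> 3 * ((norm ?w)\<^sup>2 * R\<^sup>2)"
        using minor[OF dots(1) R(4)] minor[OF dots(2) R(2)] minor[OF dots(3) R(3)] unfolding distrib_right by linarith
      have "\<bar>?k\<bar> * norm x = norm (?k *\<^sub>R x)" by simp
      also have "\<dots> \<le> \<bar>of_int A\<bar> * norm p + \<bar>of_int B'\<bar> * norm f + \<bar>of_int C\<bar> * norm r"
        unfolding A by (intro order_trans[OF norm_triangle_ineq] add_mono) auto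
      also have "\<dots> \<le> \<bar>of_int A\<bar> * R + \<bar>of_int B'\<bar> * R + \<bar>of_int C\<bar> * R"
        using R by (intro add_mono mult_left_mono) auto
      also have "\<dots> = of_int (\<bar>A\<bar> + \<bar>B'\<bar> + \<bar>C\<bar>) * R" by (simp add: algebra_simps)
      also have "\<dots> \<le> of_int (4 * (?m1\<^sup>2 + ?m2\<^sup>2 + ?m3\<^sup>2)) * R"
        using gap R(1) by (intro mult_right_mono) (simp_all only: of_int_le_iff less_imp_le)
      also have "\<dots> = 4 * R * ?S" by simp
      finally have "?d\<^sup>2 * (\<bar>?k\<bar> * norm x) \<le> ?d\<^sup>2 * (4 * R * ?S)" by (rule mult_left_mono) simp
      also have "\<dots> = 4 * R * (?S * ?d\<^sup>2)" by (simp only: mult_ac)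
      also have "\<dots> \<le> 4 * R * (3 * ((norm ?w)\<^sup>2 * R\<^sup>2))" using S R(1) by (intro mult_left_mono) auto
      also have "\<dots> = 12 * R * R\<^sup>2 * ?k ^ 4 * (norm (x \<times> y))\<^sup>2"
        unfolding w_norm by (simp add: power_mult_distrib power2_eq_square power4_eq_xxxx mult_ac)
      finally have "?d\<^sup>2 * (\<bar>?k\<bar> * norm x) \<le> 12 * R * R\<^sup>2 * ?k ^ 4 * (norm (x \<times> y))\<^sup>2" .
      moreover have "12 * R * R\<^sup>2 * ?k ^ 4 > 0" using R(1) k(1) by simp
      ultimately show ?thesis
        unfolding c_def by (simp add: divide_le_eq mult_ac)
    qed
    then show ?thesis unfolding isotropic_gap_def using c by blast
  qed
  ultimately show ?thesis by blast
qed

text \<open>The cases are a radical, a nonzero integer zero, and neither. In the last one the gap is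
  vacuous, and the real zero \<open>p\<close> shows that the three diagonal values do not share a
  sign, so that one of them is opposite to the other two.\<close>

theorem gap_and_seed:
  assumes ns: "\<not> splits" and p: "p \<times> p' \<noteq> 0" "b p p = 0" "b p' p' = 0"
  shows "isotropic_gap \<and> (\<exists>y0 y1 y2. seed y0 y1 y2)"
proof -
  obtain e0 e1 e2 where e: "e0 \<in> Z3" "e1 \<in> Z3" "e2 \<in> Z3" "b e0 e0 \<noteq> 0" "b e1 e1 \<noteq> 0"
    and orth: "b e0 e1 = 0" "b e0 e2 = 0" "b e1 e2 = 0" and det: "e0 \<bullet> (e1 \<times> e2) \<noteq> 0"
    using orthogonal_basis[OF ns] .
  have swap: "b e1 e0 = 0" "b e2 e0 = 0" "b e2 e1 = 0" using orth sym by metis+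
  consider "b e2 e2 = 0" | "b e2 e2 \<noteq> 0" "\<exists>z\<in>Z3. z \<noteq> 0 \<and> b z z = 0" | "b e2 e2 \<noteq> 0" "\<And>z. z \<in> Z3 \<Longrightarrow> b z z = 0 \<Longrightarrow> z = 0"
    by blast
  then show ?thesis
  proof cases
    case 1
    show ?thesis by (rule degenerate_case[OF ns e orth det 1 p])
  next
    case 2
    then obtain z where z: "z \<in> Z3" "z \<noteq> 0" "b z z = 0" by blast
    obtain p r f where "p \<in> Z3" "r \<in> Z3" "f \<in> Z3" "b p p = 0" "b r r = 0" "b p f = 0" "b r f = 0"
      "b f f \<noteq> 0" "2 * b p r = - b f f" "p \<bullet> (f \<times> r) \<noteq> 0"
      using hyperbolic_basis[OF e 2(1) orth det z] .
    then show ?thesis by (rule isotropic_case)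
  next
    case 3
    let ?a0 = "b e0 e0" and ?a1 = "b e1 e1" and ?a2 = "b e2 e2"
    have gap: isotropic_gap
      unfolding isotropic_gap_def using 3(2) by (intro exI[of _ 1]) fastforce
    obtain x0 x1 x2 where x: "p = x0 *\<^sub>R e0 + x1 *\<^sub>R e1 + x2 *\<^sub>R e2" using basis_coords[OF det] .
    have q: "?a0 * x0\<^sup>2 + ?a1 * x1\<^sup>2 + ?a2 * x2\<^sup>2 = 0"
      using p(2) unfolding x by (simp add: b_simps orth swap power2_eq_square algebra_simps)
    have "x0 \<noteq> 0 \<or> x1 \<noteq> 0 \<or> x2 \<noteq> 0" using p(1) x by auto
    then have pos: "x0\<^sup>2 + x1\<^sup>2 + x2\<^sup>2 > 0" by (smt (verit) zero_le_power2 zero_less_power2)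
    have "\<not> (?a0 > 0 \<and> ?a1 > 0 \<and> ?a2 > 0)"
    proof
      assume h: "?a0 > 0 \<and> ?a1 > 0 \<and> ?a2 > 0"
      then have "?a0 * x0\<^sup>2 \<ge> 0" "?a1 * x1\<^sup>2 \<ge> 0" "?a2 * x2\<^sup>2 \<ge> 0" by simp_all
      then have "?a0 * x0\<^sup>2 = 0" "?a1 * x1\<^sup>2 = 0" "?a2 * x2\<^sup>2 = 0" using q by linarith+
      then show False using h pos by simp
    qed
    moreover have "\<not> (?a0 < 0 \<and> ?a1 < 0 \<and> ?a2 < 0)"
    proof
      assume h: "?a0 < 0 \<and> ?a1 < 0 \<and> ?a2 < 0"
      then have "?a0 * x0\<^sup>2 \<le> 0" "?a1 * x1\<^sup>2 \<le> 0" "?a2 * x2\<^sup>2 \<le> 0" by (simp_all add: mult_nonpos_nonneg)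
      then have "?a0 * x0\<^sup>2 = 0" "?a1 * x1\<^sup>2 = 0" "?a2 * x2\<^sup>2 = 0" using q by linarith+
      then show False using h pos by simp
    qed
    ultimately consider "?a0 * ?a1 < 0" "?a0 * ?a2 < 0" | "?a1 * ?a0 < 0" "?a1 * ?a2 < 0" | "?a2 * ?a0 < 0" "?a2 * ?a1 < 0"
      using e(4,5) 3(1) unfolding mult_less_0_iff linorder_neq_iff by blast
    then have "\<exists>y0 y1 y2. seed y0 y1 y2"
    proof cases
      case 1
      then show ?thesis using anisotropic_seed[OF e(1-3) det orth] 3(2) by blast
    next
      case 2
      have "e1 \<bullet> (e0 \<times> e2) \<noteq> 0"
        using det cross_triple[of e1 e0 e2] cross_skew[of e0 e2] cross_triple[of e0 e1 e2] cross_triple[of e0 e2 e1]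
        by (simp add: inner_commute) (metis cross_skew cross_triple inner_commute inner_minus_left neg_equal_0_iff_equal)
      then show ?thesis using anisotropic_seed[of e1 e0 e2] e swap orth 2 3(2) by blast
    next
      case 3
      have "e2 \<bullet> (e0 \<times> e1) \<noteq> 0" using det cross_triple[of e0 e1 e2] by (simp add: inner_commute)
      then show ?thesis using anisotropic_seed[of e2 e0 e1] e swap orth 3 \<open>\<And>z. z \<in> Z3 \<Longrightarrow> b z z = 0 \<Longrightarrow> z = 0\<close> by blast
    qed
    then show ?thesis using gap by blast
  qed
qed

end

section \<open>The projective point of a point of the plane\<close>

definition proj :: "real ^ 2 \<Rightarrow> real ^ 3" where "proj \<xi> = vector [1, \<xi> $ 1, \<xi> $ 2]"

lemma proj_components [simp]: "proj \<xi> $ 1 = 1" "proj \<xi> $ 2 = \<xi> $ 1" "proj \<xi> $ 3 = \<xi> $ 2"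
  by (simp_all add: proj_def)

lemma proj_nz: "proj \<xi> \<noteq> 0"
  by (metis proj_components(1) zero_index zero_neq_one)

lemma proj_cross: "proj \<xi> \<times> proj \<xi>' = 0 \<Longrightarrow> \<xi> = \<xi>'"
  using cross_components[of "proj \<xi>" "proj \<xi>'"] by (simp add: vec_eq_iff forall_2)

lemma proj_affine: "\<Xi> $ 1 \<noteq> 0 \<Longrightarrow> proj (vector [\<Xi> $ 2 / \<Xi> $ 1, \<Xi> $ 3 / \<Xi> $ 1]) = (1 / \<Xi> $ 1) *\<^sub>R \<Xi>"
  by (simp add: vec_eq_iff forall_3)

lemma lin_indep_proj:
  "lin_indep (proj \<xi>) \<longleftrightarrow> (\<forall>a b c :: rat. of_rat a + of_rat b * (\<xi> $ 1) + of_rat c * (\<xi> $ 2) = 0 \<longrightarrow> a = 0 \<and> b = 0 \<and> c = 0)"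
  (is "_ \<longleftrightarrow> ?R")
proof
  assume li: "lin_indep (proj \<xi>)"
  show ?R
  proof (intro allI impI)
    fix a b c :: rat assume eq: "of_rat a + of_rat b * (\<xi> $ 1) + of_rat c * (\<xi> $ 2) = 0"
    obtain p d where a: "a = of_int p / of_int d" "d > 0" by (metis Fract_of_int_quotient Rat_cases)
    obtain p' d' where b: "b = of_int p' / of_int d'" "d' > 0" by (metis Fract_of_int_quotient Rat_cases)
    obtain p'' d'' where c: "c = of_int p'' / of_int d''" "d'' > 0" by (metis Fract_of_int_quotient Rat_cases)
    have r: "of_rat a = (of_int p / of_int d :: real)" "of_rat b = (of_int p' / of_int d' :: real)"
      "of_rat c = (of_int p'' / of_int d'' :: real)" using a b c by (simp_all add: of_rat_divide)
    let ?w = "vector [of_int (p * d' * d''), of_int (p' * d * d''), of_int (p'' * d * d')] :: real ^ 3"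
    have "?w \<bullet> proj \<xi> = of_int (d * d' * d'') * (of_rat a + of_rat b * (\<xi> $ 1) + of_rat c * (\<xi> $ 2))"
      using a(2) b(2) c(2) unfolding r by (simp add: inner_vec_def sum_3 field_simps)
    then have "?w \<bullet> proj \<xi> = 0" using eq by simp
    moreover have "?w \<in> Z3" by (intro Z3_vector Ints_of_int)
    ultimately have "?w = 0" using li by (auto simp: lin_indep_def)
    then have "?w $ 1 = 0" "?w $ 2 = 0" "?w $ 3 = 0" by (simp_all only: zero_index)
    then show "a = 0 \<and> b = 0 \<and> c = 0" using a b c by simp
  qed
next
  assume R: ?R
  show "lin_indep (proj \<xi>)"
    unfolding lin_indep_def
  proof (intro ballI impI)
    fix w assume w: "w \<in> Z3" "w \<bullet> proj \<xi> = 0"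
    obtain p q r where pqr: "w $ 1 = of_int p" "w $ 2 = of_int q" "w $ 3 = of_int r"
      using w(1) unfolding Z3_def by (metis (mono_tags, lifting) Ints_cases mem_Collect_eq)
    have "of_rat (of_int p) + of_rat (of_int q) * (\<xi> $ 1) + of_rat (of_int r) * (\<xi> $ 2) = 0"
      using w(2) by (simp add: inner_vec_def sum_3 pqr)
    then have "p = 0 \<and> q = 0 \<and> r = 0" using R by (metis of_int_eq_0_iff)
    then show "w = 0" using pqr by (simp add: vec_eq_iff forall_3)
  qed
qed

section \<open>The uniform exponent in terms of integer vectors near a line\<close>

lemma approx_solvable_iff:
  fixes \<xi> :: "real ^ 2"
  shows "approx_solvable \<xi> l X \<longleftrightarrow> (\<exists>x\<in>Z3. x \<noteq> 0 \<and> \<bar>x $ 1\<bar> \<le> X \<and>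
     \<bar>x $ 1 * \<xi> $ 1 - x $ 2\<bar> \<le> X powr - l \<and> \<bar>x $ 1 * \<xi> $ 2 - x $ 3\<bar> \<le> X powr - l)"
  (is "_ \<longleftrightarrow> ?R")
proof -
  have Max: "Max (range (\<lambda>i :: 2. g i)) \<le> B \<longleftrightarrow> g 1 \<le> B \<and> g 2 \<le> B" for g :: "2 \<Rightarrow> real" and B
    by (simp add: forall_2)
  show ?thesis
  proof
    assume "approx_solvable \<xi> l X"
    then obtain x0 and x :: "int ^ 2" where x: "(x0, x) \<noteq> (0, 0)" "\<bar>real_of_int x0\<bar> \<le> X"
        "\<bar>real_of_int x0 * (\<xi> $ 1) - real_of_int (x $ 1)\<bar> \<le> X powr - l"
        "\<bar>real_of_int x0 * (\<xi> $ 2) - real_of_int (x $ 2)\<bar> \<le> X powr - l"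
      unfolding approx_solvable_def Max by (elim exE conjE) (rule that; assumption)
    let ?x = "vector [of_int x0, of_int (x $ 1), of_int (x $ 2)] :: real ^ 3"
    have "?x \<noteq> 0"
    proof
      assume "?x = 0"
      then have "?x $ 1 = 0" "?x $ 2 = 0" "?x $ 3 = 0" by (simp_all only: zero_index)
      then show False using x(1) by (simp add: vec_eq_iff forall_2)
    qed
    moreover have "?x \<in> Z3" by (intro Z3_vector Ints_of_int)
    ultimately show ?R using x by (intro bexI[of _ ?x]) simp_all
  next
    assume ?R
    then obtain x :: "real ^ 3" where x: "x \<in> Z3" "x \<noteq> 0" "\<bar>x $ 1\<bar> \<le> X"
        "\<bar>x $ 1 * \<xi> $ 1 - x $ 2\<bar> \<le> X powr - l" "\<bar>x $ 1 * \<xi> $ 2 - x $ 3\<bar> \<le> X powr - l"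
      by blast
    obtain p q r where pqr: "x $ 1 = of_int p" "x $ 2 = of_int q" "x $ 3 = of_int r"
      using x(1) unfolding Z3_def by (metis (mono_tags, lifting) Ints_cases mem_Collect_eq)
    have "(p, vector [q, r] :: int ^ 2) \<noteq> (0, 0)"
    proof
      assume "(p, vector [q, r] :: int ^ 2) = (0, 0)"
      then have "p = 0" "(vector [q, r] :: int ^ 2) $ 1 = 0" "(vector [q, r] :: int ^ 2) $ 2 = 0" by simp_all
      then show False using x(2) pqr by (simp add: vec_eq_iff forall_3)
    qed
    then show "approx_solvable \<xi> l X"
      unfolding approx_solvable_def Max using x pqr by (intro exI[of _ p] exI[of _ "vector [q, r]"]) simp
  qed
qed

text \<open>Solvability for large \<open>X\<close> suffices: for \<open>X\<close> between 1 and the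
  threshold \<open>X0\<close> the solution at \<open>X0\<close> is reused, at the cost of the
  constant.\<close>

lemma uniform_approx_of_solvable:
  assumes ev: "\<forall>\<^sub>F X in at_top. approx_solvable \<xi> l X" and l: "l \<ge> 0"
  shows "uniform_approx (proj \<xi>) l"
proof -
  let ?\<Xi> = "proj \<xi>"
  have bound: "\<exists>x\<in>Z3. x \<noteq> 0 \<and> norm x \<le> (norm ?\<Xi> + 2) * X \<and> norm (x \<times> ?\<Xi>) \<le> 2 * norm ?\<Xi> * X powr - l"
    if X: "X \<ge> 1" and s: "approx_solvable \<xi> l X" for X
  proof -
    obtain x :: "real ^ 3" where x: "x \<in> Z3" "x \<noteq> 0" "\<bar>x $ 1\<bar> \<le> X"
        "\<bar>x $ 1 * \<xi> $ 1 - x $ 2\<bar> \<le> X powr - l" "\<bar>x $ 1 * \<xi> $ 2 - x $ 3\<bar> \<le> X powr - l"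
      using s unfolding approx_solvable_iff by blast
    let ?d = "x - x $ 1 *\<^sub>R ?\<Xi>"
    have "norm ?d \<le> (\<Sum>i\<in>UNIV. \<bar>?d $ i\<bar>)" by (rule norm_le_l1_cart)
    also have "\<dots> \<le> 2 * X powr - l" using x(4,5) by (simp add: sum_3 abs_minus_commute)
    finally have d: "norm ?d \<le> 2 * X powr - l" .
    have "X powr - l \<le> X" using X l powr_mono[of "- l" 1 X] by simp
    then have "norm ?d \<le> 2 * X" using d by simp
    moreover have "norm x \<le> norm ?d + norm (x $ 1 *\<^sub>R ?\<Xi>)"
      using norm_triangle_ineq[of ?d "x $ 1 *\<^sub>R ?\<Xi>"] by simp
    moreover have "norm (x $ 1 *\<^sub>R ?\<Xi>) \<le> X * norm ?\<Xi>" using x(3) by (simp add: mult_right_mono)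
    ultimately have 1: "norm x \<le> (norm ?\<Xi> + 2) * X" by (simp add: algebra_simps)
    have "x \<times> ?\<Xi> = ?d \<times> ?\<Xi>" by (simp add: Cross3.left_diff_distrib cross_mult_left)
    then have "norm (x \<times> ?\<Xi>) \<le> 2 * X powr - l * norm ?\<Xi>"
      using norm_cross_le[of ?d ?\<Xi>] mult_right_mono[OF d, of "norm ?\<Xi>"] by simp
    then show ?thesis using x(1,2) 1 by (intro bexI[of _ x]) (simp_all add: mult_ac)
  qed
  obtain X0' where X0': "\<And>X. X \<ge> X0' \<Longrightarrow> approx_solvable \<xi> l X" using ev by (auto simp: eventually_at_top_linorder)
  define X0 where "X0 = max X0' 1"
  have X0: "X0 \<ge> 1" "\<And>X. X \<ge> X0 \<Longrightarrow> approx_solvable \<xi> l X" using X0' by (auto simp: X0_def)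
  let ?M = "norm ?\<Xi> + 2"
  define c where "c = 2 * ?M * X0 powr (1 + l)"
  have p1: "X0 powr (1 + l) \<ge> X0" "X0 powr (1 + l) \<ge> 1" "X0 powr (1 + l) \<ge> X0 powr l"
    using X0(1) l powr_mono[of 1 "1 + l" X0] powr_mono[of l "1 + l" X0] by (simp_all add: ge_one_powr_ge_zero)
  have c: "?M \<le> c" "2 * norm ?\<Xi> \<le> c" "?M * X0 \<le> c" "c > 0"
  proof -
    have M: "?M > 0" by (simp add: add_nonneg_pos)
    have "2 * ?M * 1 \<le> c" unfolding c_def using p1 M by (intro mult_left_mono) auto
    then show "?M \<le> c" "2 * norm ?\<Xi> \<le> c" "c > 0" using M by auto
    have "?M * X0 \<le> ?M * X0 powr (1 + l)" using p1 M by (intro mult_left_mono) auto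
    also have "\<dots> \<le> c" unfolding c_def using M p1 by (intro mult_right_mono) auto
    finally show "?M * X0 \<le> c" .
  qed
  have "\<exists>x\<in>Z3. x \<noteq> 0 \<and> norm x \<le> c * X \<and> norm (x \<times> ?\<Xi>) \<le> c * X powr - l" if X: "X \<ge> 1" for X
  proof (cases "X \<ge> X0")
    case True
    then obtain x :: "real ^ 3" where x: "x \<in> Z3" "x \<noteq> 0" "norm x \<le> ?M * X" "norm (x \<times> ?\<Xi>) \<le> 2 * norm ?\<Xi> * X powr - l"
      using bound[OF X] X0 by blast
    have "?M * X \<le> c * X" "2 * norm ?\<Xi> * X powr - l \<le> c * X powr - l"
      using c X by (intro mult_right_mono; simp)+
    then show ?thesis using x by (meson order_trans)
  next
    case False
    obtain x :: "real ^ 3" where x: "x \<in> Z3" "x \<noteq> 0" "norm x \<le> ?M * X0" "norm (x \<times> ?\<Xi>) \<le> 2 * norm ?\<Xi> * X0 powr - l"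
      using bound[OF X0(1)] X0 by blast
    have "?M * X0 \<le> c * 1" using c by simp
    also have "\<dots> \<le> c * X" using c X by (intro mult_left_mono) auto
    finally have 1: "norm x \<le> c * X" using x(3) by linarith
    have "X0 powr - l \<le> X powr - l" using False X l by (intro powr_mono2') auto
    then have "2 * norm ?\<Xi> * X0 powr - l \<le> c * X powr - l" using c by (intro mult_mono) auto
    then show ?thesis using x 1 by (meson order_trans)
  qed
  then show ?thesis unfolding uniform_approx_def using c(4) by blast
qed

text \<open>Taking the parameter \<open>X / c\<close> removes the constant from the bound on the
  norm, and the smaller exponent \<open>l'\<close> absorbs the one in the distance.\<close>

lemma solvable_of_uniform_approx:
  assumes U: "uniform_approx (proj \<xi>) l" and l': "l' < l"
  shows "\<forall>\<^sub>F X in at_top. approx_solvable \<xi> l' X"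
proof -
  obtain c where c: "c > 0" and
    U: "\<And>X. X \<ge> 1 \<Longrightarrow> \<exists>x\<in>Z3. x \<noteq> 0 \<and> norm x \<le> c * X \<and> norm (x \<times> proj \<xi>) \<le> c * X powr (- l)"
    using U by (auto simp: uniform_approx_def)
  define D where "D = c * c powr l"
  have "filterlim (\<lambda>X::real. X powr (l - l')) at_top at_top" using l' by real_asymp
  then have "\<forall>\<^sub>F X in at_top. D \<le> X powr (l - l')" by (simp add: filterlim_at_top)
  moreover have "\<forall>\<^sub>F X in at_top. max c 1 \<le> X" by (rule eventually_ge_at_top)
  ultimately show ?thesis
  proof eventually_elim
    case (elim X)
    then have X: "X / c \<ge> 1" "X > 0" using c by auto
    obtain x :: "real ^ 3" where x: "x \<in> Z3" "x \<noteq> 0" "norm x \<le> c * (X / c)" "norm (x \<times> proj \<xi>) \<le> c * (X / c) powr - l"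
      using U[OF X(1)] by blast
    have "c * (X / c) powr - l = D * X powr - l"
      using c X by (simp add: D_def powr_divide powr_minus field_simps)
    also have "\<dots> \<le> X powr (l - l') * X powr - l" using elim(1) by (intro mult_right_mono) auto
    also have "\<dots> = X powr - l'" by (simp add: powr_add[symmetric])
    finally have le: "norm (x \<times> proj \<xi>) \<le> X powr - l'" using x(4) by simp
    have "\<bar>(x \<times> proj \<xi>) $ 3\<bar> \<le> X powr - l'" "\<bar>(x \<times> proj \<xi>) $ 2\<bar> \<le> X powr - l'"
      using component_le_norm_cart order_trans[OF _ le] by blast+
    then have "\<bar>x $ 1 * \<xi> $ 1 - x $ 2\<bar> \<le> X powr - l'" "\<bar>x $ 1 * \<xi> $ 2 - x $ 3\<bar> \<le> X powr - l'"
      by (simp_all add: cross_components mult.commute abs_minus_commute)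
    moreover have "\<bar>x $ 1\<bar> \<le> X" using component_le_norm_cart[of x 1] x(3) c by simp
    ultimately show ?case unfolding approx_solvable_iff using x(1,2) by blast
  qed
qed

lemma uniform_exponent_ge:
  assumes "uniform_approx (proj \<xi>) l"
  shows "uniform_exponent \<xi> \<ge> ereal l"
proof (rule dense_le)
  fix z assume z: "z < ereal l"
  show "z \<le> uniform_exponent \<xi>"
  proof (cases z)
    case (real r)
    then have "\<forall>\<^sub>F X in at_top. approx_solvable \<xi> r X" using z solvable_of_uniform_approx[OF assms, of r] by simp
    then show ?thesis unfolding uniform_exponent_def real by (intro SUP_upper) simp
  qed (use z in auto)
qed

lemma uniform_exponent_gt:
  assumes "uniform_exponent \<xi> > ereal l" "l \<ge> 0"
  shows "uniform_approx (proj \<xi>) l"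
proof -
  obtain l' where l': "\<forall>\<^sub>F X in at_top. approx_solvable \<xi> l' X" "l < l'"
    using assms(1) unfolding uniform_exponent_def less_SUP_iff by auto
  then show ?thesis using uniform_approx_of_solvable[of \<xi> l'] uniform_approx_mono[of "proj \<xi>" l' l] assms(2) by simp
qed

lemma golden_facts: "617 / 1000 < 1 / golden_ratio" "1 / golden_ratio < 1" "(1 / golden_ratio)\<^sup>2 + 1 / golden_ratio = 1"
proof -
  have "golden_ratio * ((sqrt 5 - 1) / 2) = 1" by (simp add: golden_ratio_def field_simps)
  then have inv: "1 / golden_ratio = (sqrt 5 - 1) / 2" using inverse_unique inverse_eq_divide by metis
  have "(2234 / 1000 :: real) < sqrt 5" by (rule real_less_rsqrt) (simp add: power2_eq_square)
  then show "617 / 1000 < 1 / golden_ratio" unfolding inv by simp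
  have "sqrt 5 < (3 :: real)" by (rule real_less_lsqrt) auto
  then show "1 / golden_ratio < 1" unfolding inv by simp
  show "(1 / golden_ratio)\<^sup>2 + 1 / golden_ratio = 1" unfolding inv by (simp add: power2_eq_square field_simps)
qed

section \<open>The theorem for the zeros of an integral form\<close>

lemma (in int_form) exponent_le:
  assumes gap: isotropic_gap and li: "lin_indep \<Xi>" and z: "b \<Xi> \<Xi> = 0" and U: "uniform_approx \<Xi> l"
  shows "l \<le> 1 / golden_ratio"
proof (rule ccontr)
  let ?g = "1 / golden_ratio"
  assume "\<not> l \<le> ?g"
  then have "l > ?g" by simp
  \<comment> \<open>The exponent is lowered to stay below 1, as \<open>exponent_quadratic_le\<close>
    requires, while still exceeding \<open>?g\<close>.\<close>
  define l' where "l' = min l ((?g + 1) / 2)"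
  have l': "?g < l'" "l' < 1" "l' \<le> l" using \<open>l > ?g\<close> golden_facts unfolding l'_def by (auto simp: min_def)
  have "\<Xi> \<noteq> 0" using lin_indep_nonzero[OF li] .
  define u where "u = (1 / norm \<Xi>) *\<^sub>R \<Xi>"
  have u: "norm u = 1" "lin_indep u" "b u u = 0" "uniform_approx u l'"
    using \<open>\<Xi> \<noteq> 0\<close> lin_indep_scaleR[OF li] z uniform_approx_mono[OF uniform_approx_scaleR[OF U] l'(3)]
    by (auto simp: u_def b_simps)
  obtain x C where "minimal_points u l' x C"
    using minimal_points_exist[OF u(1,2,4)] l' golden_facts by auto
  then interpret minimal_points u l' x C .
  interpret conic_minimal b u l' x C
    using u gap l' golden_facts by unfold_locales auto
  have "l'\<^sup>2 + l' - 1 \<le> 0" by (rule exponent_quadratic_le[OF l'(2)])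
  moreover have "?g\<^sup>2 < l'\<^sup>2"
    by (rule power_strict_mono) (use l'(1) golden_facts(1) in linarith)+
  ultimately show False using golden_facts(3) l'(1) by linarith
qed

text \<open>Two distinct points of the curve give two independent real zeros of \<open>b\<close>,
  which \<open>gap_and_seed\<close> takes to exclude forms that are definite modulo their radical.
  Countability comes from \<open>1 / golden_ratio > 617/1000\<close>, infinity from the reflections
  of one limit point.\<close>

lemma (in int_form) exponent_theorem:
  fixes C :: "(real ^ 2) set"
  assumes C: "\<And>\<xi>. \<xi> \<in> C \<longleftrightarrow> b (proj \<xi>) (proj \<xi>) = 0" and ns: "\<not> splits"
    and two: "\<xi>0 \<in> C" "\<xi>1 \<in> C" "\<xi>0 \<noteq> \<xi>1"
  shows "curve_exponent C = ereal (1 / golden_ratio) \<and>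
         countable {\<xi> \<in> li_points C. uniform_exponent \<xi> = ereal (1 / golden_ratio)} \<and>
         infinite {\<xi> \<in> li_points C. uniform_exponent \<xi> = ereal (1 / golden_ratio)}"
proof -
  let ?g = "1 / golden_ratio" and ?S = "{\<xi> \<in> li_points C. uniform_exponent \<xi> = ereal (1 / golden_ratio)}"
  have lp: "\<xi> \<in> li_points C \<longleftrightarrow> b (proj \<xi>) (proj \<xi>) = 0 \<and> lin_indep (proj \<xi>)" for \<xi>
    unfolding li_points_def lin_indep_proj by (simp add: C)
  have "proj \<xi>0 \<times> proj \<xi>1 \<noteq> 0" using proj_cross two(3) by blast
  then obtain y0 y1 y2 where gap: isotropic_gap and seed: "seed y0 y1 y2"
    using gap_and_seed[OF ns] C two by blast
  have upper: "uniform_exponent \<xi> \<le> ereal ?g" if "\<xi> \<in> li_points C" for \<xi>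
    unfolding uniform_exponent_def
  proof (rule SUP_least)
    fix l assume "l \<in> {l. \<forall>\<^sub>F X in at_top. approx_solvable \<xi> l X}"
    then have ev: "\<forall>\<^sub>F X in at_top. approx_solvable \<xi> l X" by simp
    show "ereal l \<le> ereal ?g"
    proof (cases "l \<ge> 0")
      case True
      then show ?thesis using exponent_le[OF gap _ _ uniform_approx_of_solvable[OF ev]] that unfolding lp by simp
    next
      case False
      then show ?thesis using golden_facts by simp
    qed
  qed
  have inf: "infinite ?S"
  proof -
    obtain \<Xi> where \<Xi>: "\<And>n :: nat. lin_indep (\<Xi> n)" "\<And>n. b (\<Xi> n) (\<Xi> n) = 0"
      "\<And>n. uniform_approx (\<Xi> n) ?g" "\<And>m n. m \<noteq> n \<Longrightarrow> \<Xi> m \<times> \<Xi> n \<noteq> 0"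
      using extremal_points_exist[OF seed] by blast
    have nz: "\<Xi> n $ 1 \<noteq> 0" for n
    proof
      assume "\<Xi> n $ 1 = 0"
      then have "axis 1 1 \<bullet> \<Xi> n = 0" by (simp add: inner_axis')
      then show False using \<Xi>(1)[of n] Z3_axis[of 1] by (auto simp: lin_indep_def axis_eq_0_iff)
    qed
    define P where "P n = (vector [\<Xi> n $ 2 / \<Xi> n $ 1, \<Xi> n $ 3 / \<Xi> n $ 1] :: real ^ 2)" for n
    have P: "proj (P n) = (1 / \<Xi> n $ 1) *\<^sub>R \<Xi> n" for n unfolding P_def by (rule proj_affine[OF nz])
    have "P n \<in> ?S" for n
    proof -
      have "P n \<in> li_points C" unfolding lp P using \<Xi>(1,2) nz lin_indep_scaleR by (simp add: b_simps)
      moreover have "uniform_exponent (P n) \<ge> ereal ?g"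
        using uniform_exponent_ge uniform_approx_scaleR[OF \<Xi>(3)] P by metis
      ultimately show ?thesis using upper[of "P n"] by (simp add: antisym)
    qed
    moreover have "inj P"
    proof (rule injI)
      fix m n assume "P m = P n"
      then have "proj (P m) \<times> proj (P n) = 0" by simp
      then have "\<Xi> m \<times> \<Xi> n = 0" unfolding P using nz by (simp add: cross_mult_left cross_mult_right)
      then show "m = n" using \<Xi>(4) by blast
    qed
    ultimately show ?thesis by (meson finite_subset image_subsetI range_inj_infinite)
  qed
  have cnt: "countable ?S"
  proof -
    define N where "N \<xi> = (1 / norm (proj \<xi>)) *\<^sub>R proj \<xi>" for \<xi>
    have N_cross: "\<xi> = \<xi>'" if "N \<xi> \<times> N \<xi>' = 0" for \<xi> \<xi>'
      using that proj_nz proj_cross unfolding N_def by (simp add: cross_mult_left cross_mult_right)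
    have "countable (N ` ?S)"
    proof (rule countable_approximable[OF gap])
      fix \<Xi> assume "\<Xi> \<in> N ` ?S"
      then obtain \<xi> where \<xi>: "\<Xi> = N \<xi>" "\<xi> \<in> li_points C" "uniform_exponent \<xi> = ereal ?g" by blast
      have "uniform_approx (proj \<xi>) (617 / 1000)"
        using \<xi>(3) golden_facts(1) by (intro uniform_exponent_gt) auto
      then show "norm \<Xi> = 1 \<and> lin_indep \<Xi> \<and> uniform_approx \<Xi> (617 / 1000) \<and> b \<Xi> \<Xi> = 0"
        using \<xi>(2) proj_nz uniform_approx_scaleR unfolding \<xi>(1) N_def lp by (auto simp: lin_indep_scaleR b_simps)
    next
      fix \<Xi> \<Xi>' assume "\<Xi> \<in> N ` ?S" "\<Xi>' \<in> N ` ?S" "\<Xi> \<times> \<Xi>' = 0"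
      then show "\<Xi> = \<Xi>'" using N_cross by blast
    qed
    moreover have "inj_on N ?S"
    proof (rule inj_onI)
      fix \<xi> \<xi>' assume "N \<xi> = N \<xi>'"
      then show "\<xi> = \<xi>'" using N_cross[of \<xi> \<xi>'] by simp
    qed
    ultimately show ?thesis by (simp add: countable_image_inj_eq)
  qed
  have "curve_exponent C = ereal ?g"
  proof (rule antisym)
    show "curve_exponent C \<le> ereal ?g" unfolding curve_exponent_def by (rule SUP_least) (rule upper)
    obtain \<xi> where "\<xi> \<in> ?S" using inf by (metis finite.emptyI ex_in_conv)
    then show "ereal ?g \<le> curve_exponent C" unfolding curve_exponent_def by (metis (mono_tags, lifting) SUP_upper mem_Collect_eq)
  qed
  then show ?thesis using inf cnt by blast
qed

section \<open>Plane conics over the rationals\<close>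

lemma poly_eq_quadratic:
  fixes p :: "'a :: zero poly"
  assumes "\<And>n. n > 2 \<Longrightarrow> coeff p n = 0"
  shows "p = [:coeff p 0, coeff p 1, coeff p 2:]"
proof (rule poly_eqI)
  fix n :: nat
  consider "n = 0" | "n = 1" | "n = 2" | "n > 2" by linarith
  then show "coeff p n = coeff [:coeff p 0, coeff p 1, coeff p 2:] n"
    using assms by cases (auto simp: coeff_pCons numeral_2_eq_2 split: nat.split)
qed

lemma total_degree_le_coeff:
  assumes "coeff (coeff f i) j \<noteq> 0"
  shows "i + j \<le> total_degree f"
proof -
  let ?S = "{i + j | i j. coeff (coeff f i) j \<noteq> 0}"
  have "?S \<subseteq> (\<Union>i\<in>{..degree f}. (\<lambda>j. i + j) ` {..degree (coeff f i)})"
  proof clarify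
    fix i j assume nz: "coeff (coeff f i) j \<noteq> 0"
    then have "i \<le> degree f" by (metis coeff_0 le_degree)
    moreover have "j \<le> degree (coeff f i)" using nz by (rule le_degree)
    ultimately show "i + j \<in> (\<Union>i\<in>{..degree f}. (\<lambda>j. i + j) ` {..degree (coeff f i)})" by blast
  qed
  then have "finite ?S" by (rule finite_subset) simp
  moreover have "i + j \<in> insert 0 ?S" using assms by blast
  ultimately show ?thesis unfolding total_degree_def by (intro Max_ge) simp_all
qed

lemma total_degree_attained:
  assumes "total_degree f > 0"
  obtains i j where "coeff (coeff f i) j \<noteq> 0" "i + j = total_degree f"
proof -
  let ?S = "{i + j | i j. coeff (coeff f i) j \<noteq> 0}"
  have "?S \<subseteq> {..total_degree f}" by clarify (simp add: total_degree_le_coeff)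
  then have "finite ?S" by (rule finite_subset) simp
  then have "Max (insert 0 ?S) \<in> insert 0 ?S" by (intro Max_in) simp_all
  then have "total_degree f \<in> insert 0 ?S" unfolding total_degree_def .
  then have "total_degree f \<in> ?S"
  proof (rule insertE)
    assume "total_degree f = 0"
    then show ?thesis using assms by (simp only: less_irrefl)
  qed
  then obtain i j where "total_degree f = i + j" "coeff (coeff f i) j \<noteq> 0" by blast
  then show thesis by (intro that[of i j]) simp_all
qed

locale rational_conic =
  fixes f :: "rat poly poly"
  assumes irr: "irreducible f" and deg: "total_degree f = 2"
begin

definition c :: "nat \<Rightarrow> nat \<Rightarrow> rat" where "c i j = coeff (coeff f i) j"

lemma c_eq_0: "i + j > 2 \<Longrightarrow> c i j = 0"
  using total_degree_le_coeff[of f i j] deg unfolding c_def by fastforce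

lemma f_eq: "f = [:[:c 0 0, c 0 1, c 0 2:], [:c 1 0, c 1 1:], [:c 2 0:]:]"
proof -
  have "coeff f i = 0" if "i > 2" for i
    by (rule poly_eqI) (use c_eq_0[of i] that in \<open>simp add: c_def\<close>)
  then have "f = [:coeff f 0, coeff f 1, coeff f 2:]" by (rule poly_eq_quadratic)
  moreover have "coeff f i = [:c i 0, c i 1, c i 2:]" for i
    unfolding c_def by (rule poly_eq_quadratic) (use c_eq_0[of i] in \<open>simp add: c_def\<close>)
  moreover have "c 1 2 = 0" "c 2 1 = 0" "c 2 2 = 0" by (simp_all add: c_eq_0)
  ultimately show ?thesis by simp
qed

lemma top_coeff: "c 0 2 \<noteq> 0 \<or> c 1 1 \<noteq> 0 \<or> c 2 0 \<noteq> 0"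
proof -
  obtain i j where ij: "c i j \<noteq> 0" "i + j = 2"
    using total_degree_attained[of f] deg unfolding c_def by auto
  then have "(i = 0 \<and> j = 2) \<or> (i = 1 \<and> j = 1) \<or> (i = 2 \<and> j = 0)" by linarith
  then show ?thesis using ij by auto
qed

definition r :: "nat \<Rightarrow> nat \<Rightarrow> real" where "r i j = of_rat (c i j)"

lemma eval2_f: "eval2 (map_poly (map_poly of_rat) f) \<xi> =
    r 0 0 + r 0 1 * \<xi> $ 1 + r 0 2 * (\<xi> $ 1)\<^sup>2 + \<xi> $ 2 * (r 1 0 + r 1 1 * \<xi> $ 1) + r 2 0 * (\<xi> $ 2)\<^sup>2"
proof -
  have 0: "map_poly of_rat 0 = (0 :: real poly)" by simp
  have "map_poly (map_poly of_rat) f = [:[:r 0 0, r 0 1, r 0 2:], [:r 1 0, r 1 1:], [:r 2 0:]:]"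
    by (rule poly_eqI, rule poly_eqI, subst f_eq)
      (simp add: coeff_map_poly coeff_pCons r_def split: nat.split)
  then show ?thesis by (simp add: eval2_def power2_eq_square algebra_simps)
qed

lemma common_denominator: "\<exists>N :: int. N > 0 \<and> (\<forall>i\<le>2. \<forall>j\<le>2. of_int N * r i j \<in> \<int>)"
proof -
  have "\<exists>d :: int. d > 0 \<and> of_int d * (of_rat q :: real) \<in> \<int>" for q
  proof -
    obtain a d where q: "q = of_int a / of_int d" "d > 0" by (metis Fract_of_int_quotient Rat_cases)
    then have "of_int d * (of_rat q :: real) = of_int a" by (simp add: of_rat_divide)
    then show ?thesis using q(2) by (metis Ints_of_int)
  qed
  then obtain d where d: "\<And>q. d q > 0" "\<And>q. of_int (d q) * (of_rat q :: real) \<in> \<int>" by metis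
  let ?N = "\<Prod>i\<le>2. \<Prod>j\<le>2. d (c i j)"
  have "of_int ?N * r i j \<in> \<int>" if "i \<le> 2" "j \<le> 2" for i j
  proof -
    have "d (c i j) dvd (\<Prod>j\<le>2. d (c i j))" using that by (intro dvd_prodI) auto
    also have "\<dots> dvd ?N" using that by (intro dvd_prodI[of _ _ "\<lambda>i. \<Prod>j\<le>2. d (c i j)"]) auto
    finally obtain k where k: "?N = d (c i j) * k" by (rule dvdE)
    have "of_int ?N * r i j = of_int k * (of_int (d (c i j)) * of_rat (c i j))" unfolding k r_def by simp
    also have "\<dots> \<in> \<int>" by (rule Ints_mult[OF Ints_of_int d(2)])
    finally show ?thesis .
  qed
  moreover have "?N > 0" using d by (intro prod_pos) auto
  ultimately show ?thesis by blast
qed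

definition den :: int where
  "den = (SOME N. N > 0 \<and> (\<forall>i\<le>2. \<forall>j\<le>2. of_int N * r i j \<in> \<int>))"

lemma den: "den > 0 \<and> (\<forall>i\<le>2. \<forall>j\<le>2. of_int den * r i j \<in> \<int>)"
  unfolding den_def by (rule someI_ex[OF common_denominator])

lemma den_pos: "den > 0"
  using den by simp

definition R :: "nat \<Rightarrow> nat \<Rightarrow> real" where "R i j = of_int den * r i j"

lemma R_Ints: "i \<le> 2 \<Longrightarrow> j \<le> 2 \<Longrightarrow> R i j \<in> \<int>"
  using den by (simp add: R_def)

text \<open>The polar form of the homogenisation of \<open>f\<close>, with denominators cleared.\<close>

definition b :: "real ^ 3 \<Rightarrow> real ^ 3 \<Rightarrow> real" where
  "b x y = 2 * R 0 0 * (x $ 1 * y $ 1) + R 0 1 * (x $ 1 * y $ 2 + x $ 2 * y $ 1)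
     + R 1 0 * (x $ 1 * y $ 3 + x $ 3 * y $ 1) + 2 * R 0 2 * (x $ 2 * y $ 2)
     + R 1 1 * (x $ 2 * y $ 3 + x $ 3 * y $ 2) + 2 * R 2 0 * (x $ 3 * y $ 3)"

sublocale int_form b
proof (rule int_form.intro)
  have "linear (b x)" "linear (\<lambda>y. b y x)" for x
    by (rule linearI; simp add: b_def algebra_simps)+
  then have "bilinear b" by (simp add: bilinear_def)
  then show "bounded_bilinear b" by (simp add: bilinear_conv_bounded_bilinear)
  show "b x y = b y x" for x y by (simp add: b_def algebra_simps)
  show "b x y \<in> \<int>" if "x \<in> Z3" "y \<in> Z3" for x y
    using that unfolding b_def Z3_def by (auto intro!: Ints_add Ints_mult R_Ints)
qed

lemma zero_set_iff: "\<xi> \<in> zero_set {map_poly (map_poly of_rat) f} \<longleftrightarrow> b (proj \<xi>) (proj \<xi>) = 0"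
proof -
  have "b (proj \<xi>) (proj \<xi>) = 2 * of_int den * eval2 (map_poly (map_poly of_rat) f) \<xi>"
    by (simp add: b_def R_def eval2_f power2_eq_square algebra_simps)
  then show ?thesis using den_pos by (simp add: zero_set_def)
qed

text \<open>A splitting of the homogeneous form dehomogenises to a factorisation of a multiple of
  \<open>f\<close> into polynomials of degree at most 1. By irreducibility one of them is constant,
  and then \<open>f\<close> has no terms of degree 2.\<close>

lemma not_splits: "\<not> splits"
proof
  assume splits
  then obtain k u v where k: "k \<in> \<int>" "k \<noteq> 0" and uv: "u \<in> Z3" "v \<in> Z3" "\<And>x. k * b x x = (u \<bullet> x) * (v \<bullet> x)"
    unfolding splits_def by blast
  obtain K where K: "k = of_int K" using k(1) by (rule Ints_cases)
  obtain u1 u2 u3 where u: "u $ 1 = of_int u1" "u $ 2 = of_int u2" "u $ 3 = of_int u3"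
    using uv(1) unfolding Z3_def by (metis (mono_tags, lifting) Ints_cases mem_Collect_eq)
  obtain v1 v2 v3 where v: "v $ 1 = of_int v1" "v $ 2 = of_int v2" "v $ 3 = of_int v3"
    using uv(2) unfolding Z3_def by (metis (mono_tags, lifting) Ints_cases mem_Collect_eq)
  define a where "a = (2 * of_int K * of_int den :: rat)"
  have a0: "a \<noteq> 0" using k(2) K den_pos by (simp add: a_def)
  have ra: "(of_rat a :: real) = 2 * k * of_int den" by (simp add: a_def K of_rat_mult)
  have id: "of_rat a * (r 0 0 * x1\<^sup>2 + r 0 1 * (x1 * x2) + r 1 0 * (x1 * x3) + r 0 2 * x2\<^sup>2 + r 1 1 * (x2 * x3) + r 2 0 * x3\<^sup>2)
     = (of_int u1 * x1 + of_int u2 * x2 + of_int u3 * x3) * (of_int v1 * x1 + of_int v2 * x2 + of_int v3 * x3)" for x1 x2 x3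
  proof -
    have "k * b (vector [x1, x2, x3]) (vector [x1, x2, x3]) = of_rat a * (r 0 0 * x1\<^sup>2 + r 0 1 * (x1 * x2) + r 1 0 * (x1 * x3)
       + r 0 2 * x2\<^sup>2 + r 1 1 * (x2 * x3) + r 2 0 * x3\<^sup>2)"
      unfolding ra by (simp add: b_def R_def power2_eq_square algebra_simps)
    then show ?thesis using uv(3)[of "vector [x1, x2, x3]"] by (simp add: inner_vec_def sum_3 u v)
  qed
  have real_eqs: "of_rat a * r 0 0 = of_int (u1 * v1)" "of_rat a * r 0 2 = of_int (u2 * v2)"
      "of_rat a * r 2 0 = of_int (u3 * v3)"
    using id[of 1 0 0] id[of 0 1 0] id[of 0 0 1] by simp_all
  have real_eqs': "of_rat a * r 0 1 = of_int (u1 * v2 + u2 * v1)" "of_rat a * r 1 0 = of_int (u1 * v3 + u3 * v1)"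
      "of_rat a * r 1 1 = of_int (u2 * v3 + u3 * v2)"
    using id[of 1 1 0] id[of 1 0 1] id[of 0 1 1] real_eqs by (simp_all add: algebra_simps)
  \<comment> \<open>The coefficient identities are brought back to the rationals, because
    \<open>f\<close> is irreducible as a rational polynomial.\<close>
  have to_rat: "a * c i j = of_int m" if "of_rat a * r i j = of_int m" for i j m
  proof -
    have "(of_rat (a * c i j) :: real) = of_rat (of_int m)" using that by (simp add: r_def of_rat_mult)
    then show ?thesis by (simp only: of_rat_eq_iff)
  qed
  let ?g = "[:[:of_int u1, of_int u2:], [:of_int u3:]:] :: rat poly poly"
  let ?h = "[:[:of_int v1, of_int v2:], [:of_int v3:]:] :: rat poly poly"
  have gh: "?g * ?h = [:[:a:]:] * f"
    by (subst f_eq) (simp add: real_eqs[THEN to_rat] real_eqs'[THEN to_rat] algebra_simps del: One_nat_def)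
  have "f = [:[:1 / a:]:] * ([:[:a:]:] * f)"
    using a0 by (simp add: mult.assoc[symmetric] one_pCons[symmetric])
  also have "\<dots> = ?g * ([:[:1 / a:]:] * ?h)"
    unfolding gh[symmetric] by (rule mult.left_commute)
  finally have "f = ?g * ([:[:1 / a:]:] * ?h)" .
  then have "is_unit ?g \<or> is_unit ([:[:1 / a:]:] * ?h)" by (rule irreducibleD[OF irr])
  then have "is_unit ?g \<or> is_unit ?h" using is_unit_mult_iff by blast
  then have "(u2 = 0 \<and> u3 = 0) \<or> (v2 = 0 \<and> v3 = 0)"
    by (auto simp: is_unit_poly_iff)
  then have "of_rat a * r 0 2 = 0 \<and> of_rat a * r 1 1 = 0 \<and> of_rat a * r 2 0 = 0"
    unfolding real_eqs real_eqs' by auto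
  then show False using top_coeff a0 by (simp add: r_def)
qed

end

text \<open>A chain of positive length starts with a nonempty set strictly contained in the next
  one.\<close>

lemma two_points_of_dim_1:
  assumes "alg_dim C = 1"
  obtains \<xi> \<xi>' where "\<xi> \<in> C" "\<xi>' \<in> C" "\<xi> \<noteq> \<xi>'"
proof -
  define P where "P n \<longleftrightarrow> (\<exists>Z :: nat \<Rightarrow> (real ^ 2) set.
       (\<forall>i\<le>n. irreducible_over UNIV (Z i) \<and> Z i \<subseteq> C) \<and> (\<forall>i<n. Z i \<subset> Z (Suc i)))" for n
  have dim: "alg_dim C = (SUP n \<in> {n. P n}. enat n)" by (simp only: alg_dim_def P_def)
  have "\<exists>n>0. P n"
  proof (rule ccontr)
    assume no: "\<not> (\<exists>n>0. P n)"
    have "alg_dim C \<le> 0"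
      unfolding dim by (rule SUP_least) (use no in \<open>auto simp: zero_enat_def\<close>)
    then show False using assms by simp
  qed
  then obtain n where n: "n > 0" "P n" by blast
  then obtain Z where Z: "\<forall>i\<le>n. irreducible_over UNIV (Z i) \<and> Z i \<subseteq> C" "\<forall>i<n. Z i \<subset> Z (Suc i)"
    unfolding P_def by (elim exE conjE) (rule that)
  have "Z 0 \<noteq> {}" using Z(1) by (simp add: irreducible_over_def)
  moreover have "Z 0 \<subset> Z 1" "Z 1 \<subseteq> C" using Z n(1) by simp_all
  ultimately show thesis using that by blast
qed

theorem theorem1p1:
  fixes C :: "(real ^ 2) set"
  assumes "algebraic_over \<rat> C"
    and "irreducible_over \<rat> C"
    and "alg_dim C = 1"
    and "has_degree C 2"
  shows "curve_exponent C = ereal (1 / golden_ratio) \<and>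
         countable {\<xi> \<in> li_points C. uniform_exponent \<xi> = ereal (1 / golden_ratio)} \<and>
         infinite {\<xi> \<in> li_points C. uniform_exponent \<xi> = ereal (1 / golden_ratio)}"
proof -
  obtain f :: "rat poly poly" where f: "irreducible f" "total_degree f = 2"
    and C: "C = zero_set {map_poly (map_poly of_rat) f}"
    using assms(4) unfolding has_degree_def by blast
  interpret rational_conic f using f by unfold_locales
  obtain \<xi> \<xi>' where "\<xi> \<in> C" "\<xi>' \<in> C" "\<xi> \<noteq> \<xi>'" using two_points_of_dim_1[OF assms(3)] .
  then show ?thesis
    by (rule exponent_theorem[OF _ not_splits, rotated]) (simp add: C zero_set_iff)
qed

end
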